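(* Let $\lambda=(\lambda_1,\ldots,\lambda_\ell)$ be a partition. (1) For every semistandard tableau $Q$ of content $\lambda^2$ and shape some $\nu\vdash 2|\lambda|$, and every $1\le i\le \ell$, let $Q^{(i)}$ be the (skew) subtableau of $Q$ formed by the entries $2i-1$ and $2i$. Then $Q_i=\mathrm{Rect}(Q^{(i)})$ has shape $(2\lambda_i-j_i,j_i)$ for some integer $0\le j_i\le\lambda_i$. Put $\mathrm{sign}(Q)=\prod_{i=1}^{\ell}(-1)^{j_i}$. Under the indexing $h_\lambda^2=\sum_{Q}s_{\mathrm{shape}(Q)}$ of the Schur constituents of $h_\lambda^2$ by the semistandard tableaux $Q$ of content $\lambda^2$, the copy of $s_\nu$ indexed by $Q$ lies in $s_2[h_\lambda]$ if $\mathrm{sign}(Q)=1$ and in $s_{11}[h_\lambda]$ if $\mathrm{sign}(Q)=-1$; that is, $$s_2[h_\lambda]=\sum_{Q:\ \mathrm{sign}(Q)=1}s_{\mathrm{shape}(Q)},\qquad s_{11}[h_\lambda]=\sum_{Q:\ \mathrm{sign}(Q)=-1}s_{\mathrm{shape}(Q)},$$ where $Q$ runs over semistandard tableaux of content $\lambda^2$ (of straight shape). (2) For every conjugate tableau $\widetilde Q$ of content $\lambda^2$ and shape some $\nu\vdash 2|\lambda|$, and every $1\le i\le\ell$, let $\widetilde{Q^{(i)}}$ be the (skew) sub-filling of $\widetilde Q$ formed by the entries $2i-1$ and $2i$. Then $\widetilde{Q_i}=\bigl(\mathrm{Rect}((\widetilde{Q^{(i)}})')\bigr)'$ has shape $(2^{\lambda_i-j_i},1^{2j_i})$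 for some integer $0\le j_i\le\lambda_i$. Put $\mathrm{sign}_c(\widetilde Q)=\prod_{i=1}^{\ell}(-1)^{j_i}$. Under the indexing $e_\lambda^2=\sum_{\widetilde Q}s_{\mathrm{shape}(\widetilde Q)}$ of the Schur constituents of $e_\lambda^2$ by the conjugate tableaux $\widetilde Q$ of content $\lambda^2$, the copy of $s_\nu$ indexed by $\widetilde Q$ lies in $s_2[e_\lambda]$ if $\mathrm{sign}_c(\widetilde Q)=1$ and in $s_{11}[e_\lambda]$ if $\mathrm{sign}_c(\widetilde Q)=-1$; that is, $$s_2[e_\lambda]=\sum_{\widetilde Q:\ \mathrm{sign}_c(\widetilde Q)=1}s_{\mathrm{shape}(\widetilde Q)},\qquad s_{11}[e_\lambda]=\sum_{\widetilde Q:\ \mathrm{sign}_c(\widetilde Q)=-1}s_{\mathrm{shape}(\widetilde Q)},$$ where $\widetilde Q$ runs over conjugate tableaux of content $\lambda^2$ (of straight shape).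
   Context: Partitions are identified with their diagrams in English notation (left- and top-justified, $\lambda_i$ boxes in row $i$ from the top). $|\lambda|=\sum_i\lambda_i$, $\lambda'$ is the conjugate partition, and $\lambda^2=(\lambda_1,\lambda_1,\lambda_2,\lambda_2,\ldots,\lambda_\ell,\lambda_\ell)$. A (semistandard) tableau of straight or skew shape is a filling with positive integers, weakly increasing along rows from left to right and strictly increasing down columns. Its content is $(\alpha_1,\alpha_2,\ldots)$ where $\alpha_k$ is the number of entries equal to $k$. The conjugate $t'$ of a filling $t$ is its reflection in the main diagonal. A conjugate tableau is a filling $\widetilde Q$ whose conjugate $\widetilde Q'$ is a semistandard tableau (so its rows strictly increase and its columns weakly increase). $\mathrm{Rect}(T)$ denotes the rectification of a skew semistandard tableau $T$ by jeu de taquin, i.e. the straight-shape semistandard tableau obtained by applying jeu de taquin slides into inner corners until none remain (independent of choices). Thus a content-$\lambda^2$ tableau has $\lambda_i$ entries $2i-1$ and $\lambda_i$ entries $2i$. $\Lambda$ is the ring of symmetric functions over $\mathbb{Q}$; $s_\nu,h_\lambda,e_\lambda,p_\lambda$ are the Schur, complete homogeneous, elementary and power sum symmetric functions; $h_\lambda=\prod_i h_{\lambda_i}$, $e_\lambda=\prod_i e_{\lambda_i}$; $s_2=s_{(2)}$ and $s_{11}=s_{(1,1)}$. Plethysm $f[g]$ is determined by: $p_k[p_m]=p_{km}$; for each $k$, $g\mapsto p_k[g]$ is a $\mathbb{Q}$-algebra endomorphism of $\Lambda$; for each $g$, $f\mapsto f[g]$ is a $\mathbb{Q}$-algebra endomorphism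 of $\Lambda$. One has $g^2=s_2[g]+s_{11}[g]$. *)

theory Defs
  imports Complex_Main "HOL-Library.Poly_Mapping"
begin

section \<open>Formal power series in countably many variables\<close>

text \<open>Coefficient functions are indexed by exponent vectors \<open>\<alpha>\<close>, where \<open>lookup \<alpha> i\<close> is the
  exponent of the variable \<open>x\<^sub>i\<close> (\<open>i = 0, 1, 2, \<dots>\<close>).  A separate type is used so that multiplication is
  the Cauchy product.\<close>

typedef mps = "UNIV :: ((nat \<Rightarrow>\<^sub>0 nat) \<Rightarrow> rat) set"
  morphisms mcoeff Mps
  by simp

lemma mps_eqI: "(\<And>\<alpha>. mcoeff f \<alpha> = mcoeff g \<alpha>) \<Longrightarrow> f = g"
  by (simp add: mcoeff_inject[symmetric] fun_eq_iff)

lemma mcoeff_Mps [simp]: "mcoeff (Mps F) = F"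
  by (simp add: Mps_inverse)

definition splits :: "(nat \<Rightarrow>\<^sub>0 nat) \<Rightarrow> ((nat \<Rightarrow>\<^sub>0 nat) \<times> (nat \<Rightarrow>\<^sub>0 nat)) set" where
  "splits \<alpha> = {(\<beta>, \<gamma>). \<beta> + \<gamma> = \<alpha>}"

lemma finite_splits [simp]: "finite (splits \<alpha>)"
proof -
  let ?B = "{\<beta> :: nat \<Rightarrow>\<^sub>0 nat. \<exists>\<gamma>. \<beta> + \<gamma> = \<alpha>}"
  let ?K = "Poly_Mapping.keys \<alpha>"
  let ?M = "Max (insert 0 (Poly_Mapping.lookup \<alpha> ` ?K))"
  let ?F = "{f. \<forall>i. (i \<in> ?K \<longrightarrow> f i \<in> {..?M}) \<and> (i \<notin> ?K \<longrightarrow> f i = 0)}"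
  have "Poly_Mapping.lookup \<beta> \<in> ?F" if a: "\<beta> + \<gamma> = \<alpha>" for \<beta> \<gamma>
  proof -
    have le: "Poly_Mapping.lookup \<beta> i \<le> Poly_Mapping.lookup \<alpha> i" for i
      using a by (auto simp: lookup_add)
    have "Poly_Mapping.lookup \<alpha> i \<le> ?M" if "i \<in> ?K" for i
      using that by (intro Max_ge) auto
    moreover have "Poly_Mapping.lookup \<beta> i = 0" if "i \<notin> ?K" for i
      using that le[of i] by (simp add: in_keys_iff)
    ultimately show ?thesis
      using le_trans[OF le] by blast
  qed
  hence "Poly_Mapping.lookup ` ?B \<subseteq> ?F"
    by (intro image_subsetI) (elim CollectE exE)
  moreover have "finite ?F"
    by (intro finite_set_of_finite_funs) auto
  ultimately have "finite (Poly_Mapping.lookup ` ?B)"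
    by (rule finite_subset)
  hence fB: "finite ?B"
    by (rule finite_imageD) (auto intro: inj_onI poly_mapping_eqI)
  have "splits \<alpha> \<subseteq> (\<lambda>\<beta>. (\<beta>, \<alpha> - \<beta>)) ` ?B"
    by (auto simp: splits_def)
  with fB show ?thesis
    by (blast intro: finite_subset)
qed

instantiation mps :: comm_ring_1
begin

definition zero_mps :: mps where "0 = Mps (\<lambda>_. 0)"
definition one_mps :: mps where "1 = Mps (\<lambda>\<alpha>. if \<alpha> = 0 then 1 else 0)"
definition plus_mps :: "mps \<Rightarrow> mps \<Rightarrow> mps" where
  "f + g = Mps (\<lambda>\<alpha>. mcoeff f \<alpha> + mcoeff g \<alpha>)"
definition minus_mps :: "mps \<Rightarrow> mps \<Rightarrow> mps" where
  "f - g = Mps (\<lambda>\<alpha>. mcoeff f \<alpha> - mcoeff g \<alpha>)"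
definition uminus_mps :: "mps \<Rightarrow> mps" where
  "- f = Mps (\<lambda>\<alpha>. - mcoeff f \<alpha>)"
definition times_mps :: "mps \<Rightarrow> mps \<Rightarrow> mps" where
  "f * g = Mps (\<lambda>\<alpha>. \<Sum>(\<beta>, \<gamma>)\<in>splits \<alpha>. mcoeff f \<beta> * mcoeff g \<gamma>)"

instance
proof
  fix a b c :: mps
  show "a * b * c = a * (b * c)"
  proof (rule mps_eqI)
    fix \<alpha>
    have "mcoeff (a * b * c) \<alpha> =
        (\<Sum>(p, q)\<in>Sigma (splits \<alpha>) (\<lambda>p. splits (fst p)).
           mcoeff a (fst q) * mcoeff b (snd q) * mcoeff c (snd p))"
      by (subst sum.Sigma[symmetric])
         (auto simp: times_mps_def sum_distrib_right case_prod_unfold)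
    also have "\<dots> = (\<Sum>(p, q)\<in>Sigma (splits \<alpha>) (\<lambda>p. splits (snd p)).
           mcoeff a (fst p) * (mcoeff b (fst q) * mcoeff c (snd q)))"
      by (rule sum.reindex_bij_witness
            [of _ "\<lambda>(p, q). ((fst p + fst q, snd q), (fst p, fst q))"
                  "\<lambda>(p, q). ((fst q, snd q + snd p), (snd q, snd p))"])
         (auto simp: splits_def algebra_simps)
    also have "\<dots> = mcoeff (a * (b * c)) \<alpha>"
      by (subst sum.Sigma[symmetric])
         (auto simp: times_mps_def sum_distrib_left case_prod_unfold)
    finally show "mcoeff (a * b * c) \<alpha> = mcoeff (a * (b * c)) \<alpha>" .
  qed
  show "a * b = b * a"
  proof (rule mps_eqI)
    fix \<alpha>
    show "mcoeff (a * b) \<alpha> = mcoeff (b * a) \<alpha>"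
      unfolding times_mps_def mcoeff_Mps
      by (rule sum.reindex_bij_witness[of _ prod.swap prod.swap])
         (auto simp: splits_def algebra_simps)
  qed
  show "1 * a = a"
  proof (rule mps_eqI)
    fix \<alpha>
    have "mcoeff (1 * a) \<alpha> = (\<Sum>p\<in>splits \<alpha>. if p = (0, \<alpha>) then mcoeff a \<alpha> else 0)"
      unfolding times_mps_def one_mps_def mcoeff_Mps
      by (rule sum.cong) (auto simp: splits_def split: if_splits)
    also have "\<dots> = mcoeff a \<alpha>"
      using sum.delta[OF finite_splits[of \<alpha>], of "(0, \<alpha>)" "\<lambda>_. mcoeff a \<alpha>"]
      by (simp add: splits_def)
    finally show "mcoeff (1 * a) \<alpha> = mcoeff a \<alpha>" .
  qed
  show "(a + b) * c = a * c + b * c"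
    by (rule mps_eqI)
       (simp add: times_mps_def plus_mps_def case_prod_unfold algebra_simps sum.distrib)
  show "(0 :: mps) \<noteq> 1"
    by (auto simp: zero_mps_def one_mps_def Mps_inject fun_eq_iff)
qed (auto intro!: mps_eqI simp: zero_mps_def plus_mps_def minus_mps_def uminus_mps_def)

end

definition mscale :: "rat \<Rightarrow> mps \<Rightarrow> mps" where
  "mscale c f = Mps (\<lambda>\<alpha>. c * mcoeff f \<alpha>)"


section \<open>Partitions, diagrams and fillings\<close>

definition is_partition :: "nat list \<Rightarrow> bool" where
  "is_partition \<nu> \<longleftrightarrow> sorted_wrt (\<ge>) \<nu> \<and> (\<forall>x\<in>set \<nu>. 0 < x)"

text \<open>The cell \<open>(r, c)\<close> lies in row \<open>r\<close> (from the top) and column \<open>c\<close> (from the left), both counted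
  from 0.\<close>

type_synonym cell = "nat \<times> nat"
type_synonym filling = "cell \<Rightarrow> nat option"

definition diagram :: "nat list \<Rightarrow> cell set" where
  "diagram \<nu> = {(r, c). r < length \<nu> \<and> c < \<nu> ! r}"

definition has_shape :: "filling \<Rightarrow> nat list \<Rightarrow> bool" where
  "has_shape T \<nu> \<longleftrightarrow> is_partition \<nu> \<and> dom T = diagram \<nu>"

definition straight :: "filling \<Rightarrow> bool" where
  "straight T \<longleftrightarrow> (\<exists>\<nu>. has_shape T \<nu>)"

definition shape :: "filling \<Rightarrow> nat list" where
  "shape T = (THE \<nu>. has_shape T \<nu>)"

definition has_skew_shape :: "filling \<Rightarrow> nat list \<Rightarrow> nat list \<Rightarrow> bool" where
  "has_skew_shape T \<nu> \<mu> \<longleftrightarrow> is_partition \<nu> \<and> is_partition \<mu> \<and> diagram \<mu> \<subseteq> diagram \<nu> \<and>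
     dom T = diagram \<nu> - diagram \<mu>"

definition semistandard :: "filling \<Rightarrow> bool" where
  "semistandard T \<longleftrightarrow>
     (\<forall>p a. T p = Some a \<longrightarrow> 0 < a) \<and>
     (\<forall>r c c' a b. c < c' \<and> T (r, c) = Some a \<and> T (r, c') = Some b \<longrightarrow> a \<le> b) \<and>
     (\<forall>r r' c a b. r < r' \<and> T (r, c) = Some a \<and> T (r', c) = Some b \<longrightarrow> a < b)"

text \<open>Number of entries equal to \<open>k\<close>; all fillings considered have finite domain.\<close>

definition content :: "filling \<Rightarrow> nat \<Rightarrow> nat" where
  "content T k = card {p. T p = Some k}"

definition has_content :: "filling \<Rightarrow> nat list \<Rightarrow> bool" where
  "has_content T \<alpha> \<longleftrightarrow>
     (\<forall>k. content T k = (if 1 \<le> k \<and> k \<le> length \<alpha> then \<alpha> ! (k - 1) else 0))"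

definition conjugate :: "filling \<Rightarrow> filling" where
  "conjugate T = (\<lambda>(r, c). T (c, r))"

definition tableaux :: "nat list \<Rightarrow> filling set" where
  "tableaux \<alpha> = {Q. straight Q \<and> semistandard Q \<and> has_content Q \<alpha>}"

definition conj_tableaux :: "nat list \<Rightarrow> filling set" where
  "conj_tableaux \<alpha> = {Q. straight Q \<and> semistandard (conjugate Q) \<and> has_content Q \<alpha>}"

definition subfilling :: "nat set \<Rightarrow> filling \<Rightarrow> filling" where
  "subfilling A T = T |` {p. \<exists>k\<in>A. T p = Some k}"

definition double :: "nat list \<Rightarrow> nat list" where
  "double \<nu> = concat (map (\<lambda>x. [x, x]) \<nu>)"


section \<open>Jeu de taquin\<close>

text \<open>\<open>slide p T U\<close>: moving the hole at \<open>p\<close> through \<open>T\<close> until it has no neighbour to the right or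
  below yields \<open>U\<close>.  In case of equal entries the lower one moves, which preserves
  semistandardness.\<close>

inductive slide :: "cell \<Rightarrow> filling \<Rightarrow> filling \<Rightarrow> bool" where
  stop: "T (r, Suc c) = None \<Longrightarrow> T (Suc r, c) = None \<Longrightarrow> slide (r, c) T T"
| down: "T (Suc r, c) = Some b \<Longrightarrow> (\<forall>a. T (r, Suc c) = Some a \<longrightarrow> b \<le> a) \<Longrightarrow>
    slide (Suc r, c) (T((r, c) := Some b, (Suc r, c) := None)) U \<Longrightarrow> slide (r, c) T U"
| right: "T (r, Suc c) = Some a \<Longrightarrow> (\<forall>b. T (Suc r, c) = Some b \<longrightarrow> a < b) \<Longrightarrow>
    slide (r, Suc c) (T((r, c) := Some a, (r, Suc c) := None)) U \<Longrightarrow> slide (r, c) T U"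

definition corner :: "nat list \<Rightarrow> cell \<Rightarrow> bool" where
  "corner \<mu> p \<longleftrightarrow> p \<in> diagram \<mu> \<and> (fst p, Suc (snd p)) \<notin> diagram \<mu> \<and>
     (Suc (fst p), snd p) \<notin> diagram \<mu>"

text \<open>A filling only records its set of cells \<open>\<nu>/\<mu>\<close>, and \<open>\<nu>\<close>, \<open>\<mu>\<close> need not be determined by it.
  A slide into a corner of \<open>\<mu>\<close> with no cell of \<open>\<nu>/\<mu>\<close> next to it leaves the filling
  unchanged; it merely removes that corner from both \<open>\<mu>\<close> and \<open>\<nu>\<close>.\<close>

definition jdt :: "filling \<Rightarrow> filling \<Rightarrow> bool" where
  "jdt T U \<longleftrightarrow> (\<exists>\<nu> \<mu> p. has_skew_shape T \<nu> \<mu> \<and> corner \<mu> p \<and> slide p T U)"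

definition rect :: "filling \<Rightarrow> filling" where
  "rect T = (THE U. jdt\<^sup>*\<^sup>* T U \<and> straight U)"


section \<open>Symmetric functions over the rationals\<close>

definition mdeg :: "(nat \<Rightarrow>\<^sub>0 nat) \<Rightarrow> nat" where
  "mdeg \<alpha> = (\<Sum>i\<in>Poly_Mapping.keys \<alpha>. Poly_Mapping.lookup \<alpha> i)"

definition Sym :: "mps set" where
  "Sym = {f. (\<forall>\<pi> \<alpha>. bij \<pi> \<longrightarrow> mcoeff f (Poly_Mapping.map_key \<pi> \<alpha>) = mcoeff f \<alpha>) \<and>
             (\<exists>d. \<forall>\<alpha>. mcoeff f \<alpha> \<noteq> 0 \<longrightarrow> mdeg \<alpha> \<le> d)}"

definition hsym :: "nat \<Rightarrow> mps" where
  "hsym n = Mps (\<lambda>\<alpha>. if mdeg \<alpha> = n then 1 else 0)"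

definition esym :: "nat \<Rightarrow> mps" where
  "esym n = Mps (\<lambda>\<alpha>. if mdeg \<alpha> = n \<and> (\<forall>i. Poly_Mapping.lookup \<alpha> i \<le> 1) then 1 else 0)"

text \<open>Used for \<open>n \<ge> 1\<close> only.\<close>

definition psym :: "nat \<Rightarrow> mps" where
  "psym n = Mps (\<lambda>\<alpha>. if \<exists>i. \<alpha> = Poly_Mapping.single i n then 1 else 0)"

definition hsym_part :: "nat list \<Rightarrow> mps" where
  "hsym_part \<nu> = prod_list (map hsym \<nu>)"

definition esym_part :: "nat list \<Rightarrow> mps" where
  "esym_part \<nu> = prod_list (map esym \<nu>)"

text \<open>The Schur function is the generating function of semistandard tableaux; the entry \<open>i + 1\<close>
  contributes the variable \<open>x\<^sub>i\<close>.\<close>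

definition schur :: "nat list \<Rightarrow> mps" where
  "schur \<nu> = Mps (\<lambda>\<alpha>. of_nat (card {T. has_shape T \<nu> \<and> semistandard T \<and>
     (\<forall>i. content T (Suc i) = Poly_Mapping.lookup \<alpha> i)}))"

definition sym_endo :: "(mps \<Rightarrow> mps) \<Rightarrow> bool" where
  "sym_endo \<phi> \<longleftrightarrow> (\<forall>f\<in>Sym. \<phi> f \<in> Sym) \<and> \<phi> 1 = 1 \<and>
     (\<forall>f\<in>Sym. \<forall>g\<in>Sym. \<phi> (f + g) = \<phi> f + \<phi> g \<and> \<phi> (f * g) = \<phi> f * \<phi> g) \<and>
     (\<forall>c. \<forall>f\<in>Sym. \<phi> (mscale c f) = mscale c (\<phi> f))"

text \<open>\<open>P f g\<close> is the plethysm \<open>f[g]\<close>.  As the power sums \<open>p\<^sub>k\<close>, \<open>k \<ge> 1\<close>, are algebraically independent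
  generators of the algebra of symmetric functions, such a \<open>P\<close> exists and its values on symmetric
  functions are uniquely determined.\<close>

definition is_plethysm :: "(mps \<Rightarrow> mps \<Rightarrow> mps) \<Rightarrow> bool" where
  "is_plethysm P \<longleftrightarrow>
     (\<forall>k\<ge>1. \<forall>m\<ge>1. P (psym k) (psym m) = psym (k * m)) \<and>
     (\<forall>k\<ge>1. sym_endo (\<lambda>g. P (psym k) g)) \<and>
     (\<forall>g\<in>Sym. sym_endo (\<lambda>f. P f g))"


section \<open>Signs\<close>

text \<open>With parts numbered from 0, part number \<open>i\<close> belongs to the entries \<open>2 * i + 1\<close> and
  \<open>2 * i + 2\<close>.\<close>

definition Q_part :: "filling \<Rightarrow> nat \<Rightarrow> filling" where
  "Q_part Q i = rect (subfilling {2 * i + 1, 2 * i + 2} Q)"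

definition two_rows :: "nat \<Rightarrow> nat \<Rightarrow> nat list" where
  "two_rows m j = filter (\<lambda>x. 0 < x) [2 * m - j, j]"

definition sign_exp :: "nat list \<Rightarrow> filling \<Rightarrow> nat \<Rightarrow> nat" where
  "sign_exp \<nu> Q i = (THE j. j \<le> \<nu> ! i \<and> has_shape (Q_part Q i) (two_rows (\<nu> ! i) j))"

definition sign :: "nat list \<Rightarrow> filling \<Rightarrow> int" where
  "sign \<nu> Q = (\<Prod>i<length \<nu>. (-1) ^ sign_exp \<nu> Q i)"

definition Qc_part :: "filling \<Rightarrow> nat \<Rightarrow> filling" where
  "Qc_part Q i = conjugate (rect (conjugate (subfilling {2 * i + 1, 2 * i + 2} Q)))"

definition two_cols :: "nat \<Rightarrow> nat \<Rightarrow> nat list" where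
  "two_cols m j = replicate (m - j) 2 @ replicate (2 * j) 1"

definition sign_exp_c :: "nat list \<Rightarrow> filling \<Rightarrow> nat \<Rightarrow> nat" where
  "sign_exp_c \<nu> Q i = (THE j. j \<le> \<nu> ! i \<and> has_shape (Qc_part Q i) (two_cols (\<nu> ! i) j))"

definition sign_c :: "nat list \<Rightarrow> filling \<Rightarrow> int" where
  "sign_c \<nu> Q = (\<Prod>i<length \<nu>. (-1) ^ sign_exp_c \<nu> Q i)"

end

theory Submission
  imports Defs "HOL-Computational_Algebra.Formal_Power_Series"
begin

text \<open>
  Everything rests on two expansions over the tableaux \<open>Q\<close> of content \<open>\<lambda>\<^sup>2\<close>, namely
  \<open>h\<^sub>\<lambda>\<^sup>2 = \<Sum>\<^sub>Q s\<^bsub>shape(Q)\<^esub>\<close> and \<open>p\<^sub>2[h\<^sub>\<lambda>] = \<Sum>\<^sub>Q sign(Q) s\<^bsub>shape(Q)\<^esub>\<close>.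
  As \<open>2 s\<^sub>2 = p\<^sub>1\<^sup>2 + p\<^sub>2\<close> and \<open>2 s\<^bsub>11\<^esub> = p\<^sub>1\<^sup>2 - p\<^sub>2\<close>, the plethysms \<open>s\<^sub>2[g]\<close> and \<open>s\<^bsub>11\<^esub>[g]\<close>
  are half the sum and half the difference of \<open>g\<^sup>2\<close> and \<open>p\<^sub>2[g]\<close> (\<open>plethysm_degree_two\<close>), so they
  pick out the tableaux of sign \<open>1\<close> and of sign \<open>-1\<close>.

  The first expansion is the Pieri rule (\<open>pieri\<close>), applied once for every entry: a semistandard tableau
  is a chain of horizontal strips (\<open>bij_betw_level\<close>).

  For the second one, \<open>p\<^sub>2[_]\<close> is multiplicative, and by Newton's identities the generating function of
  the \<open>p\<^sub>2[h\<^sub>n]\<close> satisfies the same differential equation as \<open>H(t) H(-t)\<close> does as a series in \<open>t\<^sup>2\<close>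
  (\<open>endo_doubling_power_sums\<close>).  Hence \<open>p\<^sub>2[h\<^sub>n]\<close> is the sum of the \<open>(-1)\<^sup>a h\<^sub>a h\<^sub>b\<close> with
  \<open>a + b = 2 n\<close>.  By the Pieri rule the coefficient of \<open>s\<^sub>\<nu>\<close> in \<open>s\<^sub>\<mu> p\<^sub>2[h\<^sub>n]\<close> is then the sum of
  \<open>(-1)\<^sup>a\<close> over all semistandard fillings of \<open>\<nu>/\<mu>\<close> by two letters, where \<open>a\<close> counts the smaller letter.
  These fillings fall into \<open>sl\<^sub>2\<close>-strings: along a string the number \<open>j\<close> of bracketed pairs of letters is
  constant, and \<open>a\<close> takes every value from \<open>j\<close> to \<open>2 n - j\<close> exactly once.  A string therefore
  contributes \<open>(-1)\<^sup>j\<close>, which can be charged to its unique member with \<open>a = n\<close>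
  (\<open>signed_sum_strips_between\<close>).

  It remains to see that \<open>j\<close> is the length of the second row of the rectification.  The number of
  bracketed pairs is unchanged by jeu de taquin slides (\<open>jdt_rtrancl_invariant\<close>), and a straight
  semistandard tableau with \<open>n\<close> copies of each of two letters is determined by that number
  (\<open>straight_two_valued\<close>).  This also shows that the rectification is well defined.

  Of the Schur functions this uses only \<open>s\<^sub>\<emptyset> = 1\<close> and the Pieri rule for products with \<open>h\<^sub>n\<close>.  The functions
  \<open>s\<^bsub>\<nu>'\<^esub>\<close> indexed by conjugate partitions multiply in the same way with the \<open>e\<^sub>n\<close>
  (\<open>dual_pieri_conjugate\<close>), so the part on conjugate tableaux is the same statement for
  \<open>\<nu> \<mapsto> s\<^bsub>\<nu>'\<^esub>\<close>.  There \<open>p\<^sub>2[e\<^sub>n]\<close> acquires the factor \<open>(-1)\<^sup>n\<close>, which matches the fact that the exponent in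
  the sign of a conjugate tableau is \<open>n - j\<close>.
\<close>

unbundle fps_syntax

section \<open>Coefficients of power series in countably many variables\<close>

lemma sum_sign_reversing_involution:
  fixes g :: "'a \<Rightarrow> 'b :: linordered_idom"
  assumes "\<And>x. x \<in> S \<Longrightarrow> h x \<in> S" "\<And>x. x \<in> S \<Longrightarrow> h (h x) = x"
    and "\<And>x. x \<in> S \<Longrightarrow> g (h x) = - g x"
  shows "sum g S = 0"
proof -
  have "sum g S = (\<Sum>x\<in>S. - g x)"
    by (rule sum.reindex_bij_witness[of _ h h]) (use assms in auto)
  then show ?thesis
    by (simp add: sum_negf)
qed

lemma mcoeff_zero [simp]: "mcoeff 0 \<alpha> = 0"
  by (simp add: zero_mps_def)

lemma mcoeff_one: "mcoeff 1 \<alpha> = (if \<alpha> = 0 then 1 else 0)"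
  by (simp add: one_mps_def)

lemma mcoeff_add [simp]: "mcoeff (f + g) \<alpha> = mcoeff f \<alpha> + mcoeff g \<alpha>"
  by (simp add: plus_mps_def)

lemma mcoeff_diff [simp]: "mcoeff (f - g) \<alpha> = mcoeff f \<alpha> - mcoeff g \<alpha>"
  by (simp add: minus_mps_def)

lemma mcoeff_uminus [simp]: "mcoeff (- f) \<alpha> = - mcoeff f \<alpha>"
  by (simp add: uminus_mps_def)

lemma mcoeff_mult: "mcoeff (f * g) \<alpha> = (\<Sum>(\<beta>, \<gamma>)\<in>splits \<alpha>. mcoeff f \<beta> * mcoeff g \<gamma>)"
  by (simp add: times_mps_def)

lemma mcoeff_sum: "mcoeff (sum F A) \<alpha> = (\<Sum>x\<in>A. mcoeff (F x) \<alpha>)"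
  by (induction A rule: infinite_finite_induct) simp_all

lemma mcoeff_of_nat_mult: "mcoeff (of_nat n * f) \<alpha> = of_nat n * mcoeff f \<alpha>"
  by (induction n) (simp_all add: algebra_simps)

lemma of_nat_mult_left_cancel_mps:
  fixes f g :: mps
  assumes "0 < n" "of_nat n * f = of_nat n * g"
  shows "f = g"
proof (rule mps_eqI)
  fix \<alpha>
  have "of_nat n * mcoeff f \<alpha> = of_nat n * mcoeff g \<alpha>"
    using assms(2) by (simp flip: mcoeff_of_nat_mult)
  then show "mcoeff f \<alpha> = mcoeff g \<alpha>"
    using assms(1) by simp
qed

lemma mcoeff_sign_mult: "mcoeff ((-1) ^ n * f) \<alpha> = (-1) ^ n * mcoeff f \<alpha>"
  by (cases "even n") simp_all

lemma mdeg_superset: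
  assumes "finite K" "Poly_Mapping.keys \<alpha> \<subseteq> K"
  shows "mdeg \<alpha> = (\<Sum>i\<in>K. Poly_Mapping.lookup \<alpha> i)"
  unfolding mdeg_def by (rule sum.mono_neutral_left) (use assms in \<open>auto simp: in_keys_iff\<close>)

lemma mdeg_add: "mdeg (\<alpha> + \<beta>) = mdeg \<alpha> + mdeg \<beta>"
proof -
  let ?K = "Poly_Mapping.keys \<alpha> \<union> Poly_Mapping.keys \<beta>"
  have "mdeg (\<alpha> + \<beta>) = (\<Sum>i\<in>?K. Poly_Mapping.lookup (\<alpha> + \<beta>) i)"
    by (rule mdeg_superset) (auto simp: in_keys_iff lookup_add)
  also have "\<dots> = mdeg \<alpha> + mdeg \<beta>"
    by (simp add: lookup_add sum.distrib mdeg_superset[of ?K])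
  finally show ?thesis .
qed

lemma mdeg_zero [simp]: "mdeg 0 = 0"
  by (simp add: mdeg_def)

lemma mdeg_single [simp]: "mdeg (Poly_Mapping.single i n) = n"
  by (simp add: mdeg_def)

lemma mdeg_eq_0_iff: "mdeg \<alpha> = 0 \<longleftrightarrow> \<alpha> = 0"
proof
  assume "mdeg \<alpha> = 0"
  then have "Poly_Mapping.keys \<alpha> = {}"
    unfolding mdeg_def by (metis finite_keys in_keys_iff sum_eq_0_iff subsetI subset_empty)
  then show "\<alpha> = 0" by simp
qed simp

section \<open>Symmetric functions\<close>

lemma map_key_inv:
  assumes "bij \<pi>"
  shows "Poly_Mapping.map_key \<pi> (Poly_Mapping.map_key (inv \<pi>) \<alpha>) = \<alpha>"
    "Poly_Mapping.map_key (inv \<pi>) (Poly_Mapping.map_key \<pi> \<alpha>) = \<alpha>"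
  using assms bij_imp_bij_inv[OF assms]
  by (auto intro!: poly_mapping_eqI
      simp: map_key.rep_eq bij_is_inj inv_f_f bij_is_surj surj_f_inv_f)

lemma mdeg_map_key:
  assumes "bij \<pi>"
  shows "mdeg (Poly_Mapping.map_key \<pi> \<alpha>) = mdeg \<alpha>"
proof -
  have "bij_betw \<pi> (Poly_Mapping.keys (Poly_Mapping.map_key \<pi> \<alpha>)) (Poly_Mapping.keys \<alpha>)"
    using assms unfolding bij_betw_def
    by (auto simp: keys_map_key bij_is_inj bij_is_surj surj_image_vimage_eq intro: inj_on_subset)
  from sum.reindex_bij_betw[OF this, of "Poly_Mapping.lookup \<alpha>"] show ?thesis
    unfolding mdeg_def using assms by (simp add: map_key.rep_eq bij_is_inj)
qed

lemma Sym_hsym: "hsym n \<in> Sym"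
  unfolding Sym_def hsym_def by (auto simp: mdeg_map_key)

lemma Sym_esym: "esym n \<in> Sym"
proof -
  have "(\<forall>i. Poly_Mapping.lookup (Poly_Mapping.map_key \<pi> \<alpha>) i \<le> 1) \<longleftrightarrow> (\<forall>i. Poly_Mapping.lookup \<alpha> i \<le> 1)"
    if "bij \<pi>" for \<pi> :: "nat \<Rightarrow> nat" and \<alpha>
  proof -
    have "Poly_Mapping.lookup (Poly_Mapping.map_key \<pi> \<alpha>) = Poly_Mapping.lookup \<alpha> \<circ> \<pi>"
      using that by (simp add: map_key.rep_eq bij_is_inj comp_def)
    then show ?thesis
      using bij_is_surj[OF that] by (auto, metis surjD)
  qed
  then show ?thesis
    unfolding Sym_def esym_def mem_Collect_eq mcoeff_Mps by (auto simp only: mdeg_map_key split: if_splits intro: exI[of _ n])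
qed

lemma Sym_psym: "psym n \<in> Sym"
proof -
  have "(\<exists>i. Poly_Mapping.map_key \<pi> \<alpha> = Poly_Mapping.single i n) \<longleftrightarrow> (\<exists>i. \<alpha> = Poly_Mapping.single i n)"
    if b: "bij \<pi>" for \<pi> :: "nat \<Rightarrow> nat" and \<alpha> :: "nat \<Rightarrow>\<^sub>0 nat"
  proof
    assume "\<exists>i. Poly_Mapping.map_key \<pi> \<alpha> = Poly_Mapping.single i n"
    then obtain i where "Poly_Mapping.map_key \<pi> \<alpha> = Poly_Mapping.single i n" ..
    then have "\<alpha> = Poly_Mapping.map_key (inv \<pi>) (Poly_Mapping.single (inv \<pi> (\<pi> i)) n)"
      using map_key_inv(2)[OF b, of \<alpha>] that by (simp add: bij_is_inj)
    then show "\<exists>i. \<alpha> = Poly_Mapping.single i n"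
      using b map_key_single[OF bij_is_inj[OF bij_imp_bij_inv[OF b]]] by auto
  next
    assume "\<exists>i. \<alpha> = Poly_Mapping.single i n"
    then obtain i where "\<alpha> = Poly_Mapping.single (\<pi> (inv \<pi> i)) n"
      using surj_f_inv_f[OF bij_is_surj[OF b]] by metis
    then show "\<exists>i. Poly_Mapping.map_key \<pi> \<alpha> = Poly_Mapping.single i n"
      using b by (auto simp: bij_is_inj)
  qed
  then show ?thesis
    unfolding Sym_def psym_def by (auto intro: exI[of _ n])
qed

lemma Sym_one: "1 \<in> Sym"
proof -
  have "Poly_Mapping.map_key \<pi> \<alpha> = 0 \<longleftrightarrow> \<alpha> = 0" if "bij \<pi>" for \<pi> :: "nat \<Rightarrow> nat" and \<alpha> :: "nat \<Rightarrow>\<^sub>0 nat"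
    using mdeg_map_key[OF that, of \<alpha>] by (metis mdeg_eq_0_iff)
  then show ?thesis
    unfolding Sym_def by (auto simp: mcoeff_one intro!: exI[of _ 0])
qed

lemma Sym_uminus: "f \<in> Sym \<Longrightarrow> - f \<in> Sym"
  unfolding Sym_def by auto

lemma Sym_add:
  assumes "f \<in> Sym" "g \<in> Sym"
  shows "f + g \<in> Sym"
proof -
  obtain d e where "\<forall>\<alpha>. mcoeff f \<alpha> \<noteq> 0 \<longrightarrow> mdeg \<alpha> \<le> d" "\<forall>\<alpha>. mcoeff g \<alpha> \<noteq> 0 \<longrightarrow> mdeg \<alpha> \<le> e"
    using assms unfolding Sym_def by auto
  then have "\<forall>\<alpha>. mcoeff (f + g) \<alpha> \<noteq> 0 \<longrightarrow> mdeg \<alpha> \<le> max d e"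
    by (metis add.right_neutral le_max_iff_disj mcoeff_add)
  then show ?thesis
    using assms unfolding Sym_def by auto
qed

lemma Sym_mult:
  assumes f: "f \<in> Sym" and g: "g \<in> Sym"
  shows "f * g \<in> Sym"
proof -
  obtain d e where d: "\<And>\<alpha>. mcoeff f \<alpha> \<noteq> 0 \<Longrightarrow> mdeg \<alpha> \<le> d"
    and e: "\<And>\<alpha>. mcoeff g \<alpha> \<noteq> 0 \<Longrightarrow> mdeg \<alpha> \<le> e"
    using assms unfolding Sym_def by auto
  have "mdeg \<alpha> \<le> d + e" if nz: "mcoeff (f * g) \<alpha> \<noteq> 0" for \<alpha>
  proof -
    obtain p where "p \<in> splits \<alpha>" "mcoeff f (fst p) * mcoeff g (snd p) \<noteq> 0"
      using nz unfolding mcoeff_mult case_prod_unfold by (rule sum.not_neutral_contains_not_neutral)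
    then show ?thesis
      using d[of "fst p"] e[of "snd p"] by (auto simp: splits_def mdeg_add)
  qed
  moreover have "mcoeff (f * g) (Poly_Mapping.map_key \<pi> \<alpha>) = mcoeff (f * g) \<alpha>" if b: "bij \<pi>" for \<pi> \<alpha>
  proof -
    let ?m = "Poly_Mapping.map_key :: (nat \<Rightarrow> nat) \<Rightarrow> (nat \<Rightarrow>\<^sub>0 nat) \<Rightarrow> _"
    note inj = bij_is_inj[OF b] bij_is_inj[OF bij_imp_bij_inv[OF b]]
    have inv: "mcoeff h (?m (inv \<pi>) \<beta>) = mcoeff h \<beta>" if "h \<in> Sym" for h \<beta>
      using that bij_imp_bij_inv[OF b] unfolding Sym_def by blast
    have sp: "?m (inv \<pi>) \<beta> + ?m (inv \<pi>) \<gamma> = \<alpha>" if "\<beta> + \<gamma> = ?m \<pi> \<alpha>" for \<beta> \<gamma>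
      using that map_key_inv(2)[OF b, of \<alpha>] by (simp flip: map_key_plus[OF inj(2)])
    show ?thesis
      unfolding mcoeff_mult
      by (rule sum.reindex_bij_witness
            [of _ "\<lambda>(\<beta>, \<gamma>). (?m \<pi> \<beta>, ?m \<pi> \<gamma>)" "\<lambda>(\<beta>, \<gamma>). (?m (inv \<pi>) \<beta>, ?m (inv \<pi>) \<gamma>)"])
         (auto simp: splits_def map_key_inv[OF b] sp map_key_plus[OF inj(1)] inv[OF f] inv[OF g])
  qed
  ultimately show ?thesis
    unfolding Sym_def by blast
qed

lemma Sym_sum: "(\<And>x. x \<in> A \<Longrightarrow> F x \<in> Sym) \<Longrightarrow> sum F A \<in> Sym"
proof (induction A rule: infinite_finite_induct)
  have zero: "0 \<in> Sym"
    using Sym_add[OF Sym_one Sym_uminus[OF Sym_one]] by simp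
  { case (infinite A) then show ?case using zero by simp }
  { case empty then show ?case using zero by simp }
  case (insert x A) then show ?case by (simp add: Sym_add)
qed

lemma sym_endo_uminus:
  assumes "sym_endo \<phi>" "f \<in> Sym"
  shows "\<phi> (- f) = - \<phi> f"
proof -
  have add: "\<phi> (a + b) = \<phi> a + \<phi> b" if "a \<in> Sym" "b \<in> Sym" for a b
    using assms(1) that unfolding sym_endo_def by blast
  have z: "0 \<in> Sym"
    using Sym_sum[of "{}"] by simp
  have "\<phi> 0 = 0"
    using add[OF z z] by simp
  with add[OF assms(2) Sym_uminus[OF assms(2)]] show ?thesis
    by (simp add: eq_neg_iff_add_eq_0 add.commute)
qed

lemma sym_endo_sum:
  assumes "sym_endo \<phi>" "\<And>x. x \<in> A \<Longrightarrow> F x \<in> Sym"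
  shows "\<phi> (sum F A) = (\<Sum>x\<in>A. \<phi> (F x))"
  using assms(2)
proof (induction A rule: infinite_finite_induct)
  have add: "\<phi> (a + b) = \<phi> a + \<phi> b" if "a \<in> Sym" "b \<in> Sym" for a b
    using assms(1) that unfolding sym_endo_def by blast
  have z: "0 \<in> Sym"
    using Sym_sum[of "{}"] by simp
  have z': "\<phi> 0 = 0"
    using add[OF z z] by simp
  { case (infinite A) then show ?case using z' by simp }
  { case empty then show ?case using z' by simp }
  case (insert x A) then show ?case by (simp add: add Sym_sum)
qed

lemma sym_endo_mult:
  "sym_endo \<phi> \<Longrightarrow> f \<in> Sym \<Longrightarrow> g \<in> Sym \<Longrightarrow> \<phi> (f * g) = \<phi> f * \<phi> g"
  unfolding sym_endo_def by blast

lemma sym_endo_prod_list: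
  assumes "sym_endo \<phi>" "\<And>x. F x \<in> Sym"
  shows "prod_list (map F xs) \<in> Sym \<and> \<phi> (prod_list (map F xs)) = prod_list (map (\<lambda>x. \<phi> (F x)) xs)"
  using assms by (induction xs) (auto simp: Sym_one Sym_mult sym_endo_mult, auto simp: sym_endo_def)

lemma sym_endo_of_nat_mult:
  assumes "sym_endo \<phi>" "f \<in> Sym"
  shows "\<phi> (of_nat n * f) = of_nat n * \<phi> f"
  using sym_endo_sum[OF assms(1), of "{..<n}" "\<lambda>_. f"] assms(2) by simp

section \<open>Newton's identities\<close>

text \<open>The series \<open>P(t)\<close>, \<open>H(t)\<close>, \<open>E(t)\<close>. The formal
  series \<open>psym 0\<close> equals \<open>1\<close> and is not a power sum; Newton's identities
  need the constant term \<open>0\<close> in its place.\<close>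

definition pgen :: "mps fps" where "pgen = Abs_fps (\<lambda>k. if k = 0 then 0 else psym k)"
definition hgen :: "mps fps" where "hgen = Abs_fps hsym"
definition egen :: "mps fps" where "egen = Abs_fps esym"

text \<open>The operator \<open>t d/dt\<close>. In contrast to the derivative it does not shift
  coefficients, so that Newton's identities take the form \<open>\<theta> F = R F\<close>.\<close>

definition euler :: "'a :: comm_ring_1 fps \<Rightarrow> 'a fps" where
  "euler F = fps_X * fps_deriv F"

text \<open>The substitution \<open>t \<mapsto> -t\<close>.\<close>

definition alternate :: "'a :: comm_ring_1 fps \<Rightarrow> 'a fps" where
  "alternate F = Abs_fps (\<lambda>n. (-1) ^ n * F $ n)"

lemma euler_nth: "euler F $ n = of_nat n * F $ n"
  by (cases n) (simp_all add: euler_def)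

lemma euler_mult: "euler (F * G) = euler F * G + F * euler G"
  by (simp add: euler_def algebra_simps)

lemma alternate_nth: "alternate F $ n = (-1) ^ n * F $ n"
  by (simp add: alternate_def)

lemma alternate_mult: "alternate (F * G) = alternate F * alternate G"
proof (rule fps_ext)
  fix n
  have "(-1) ^ n * (F $ i * G $ (n - i)) = ((-1) ^ i * F $ i) * ((-1) ^ (n - i) * G $ (n - i))"
    if "i \<le> n" for i
    using that power_add[of "- 1 :: 'a" i "n - i"] by (simp add: mult.assoc mult.left_commute)
  then show "alternate (F * G) $ n = (alternate F * alternate G) $ n"
    by (simp add: alternate_nth fps_mult_nth sum_distrib_left)
qed

lemma alternate_alternate: "alternate (alternate F) = F"
  by (rule fps_ext) (simp add: alternate_nth flip: power_mult_distrib mult.assoc)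

lemma alternate_uminus: "alternate (- F) = - alternate F"
  by (rule fps_ext) (simp add: alternate_nth)

lemma euler_alternate: "euler (alternate F) = alternate (euler F)"
  by (rule fps_ext) (simp add: alternate_nth euler_nth mult.left_commute)

lemma add_diff_single:
  assumes "k \<le> Poly_Mapping.lookup \<alpha> i"
  shows "Poly_Mapping.single i k + (\<alpha> - Poly_Mapping.single i k) = (\<alpha> :: nat \<Rightarrow>\<^sub>0 nat)"
  using assms by (intro poly_mapping_eqI) (auto simp: lookup_add lookup_minus lookup_single when_def)

lemma mcoeff_psym_mult:
  assumes "1 \<le> k"
  shows "mcoeff (psym k * g) \<alpha> = (\<Sum>i | i \<in> Poly_Mapping.keys \<alpha> \<and> k \<le> Poly_Mapping.lookup \<alpha> i.
    mcoeff g (\<alpha> - Poly_Mapping.single i k))"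
proof -
  let ?I = "{i. i \<in> Poly_Mapping.keys \<alpha> \<and> k \<le> Poly_Mapping.lookup \<alpha> i}"
  let ?f = "\<lambda>i. (Poly_Mapping.single i k, \<alpha> - Poly_Mapping.single i k)"
  let ?t = "\<lambda>(\<beta>, \<gamma>). mcoeff (psym k) \<beta> * mcoeff g \<gamma>"
  have "inj_on ?f ?I"
    using assms by (intro inj_onI) (auto dest!: arg_cong[where f = Poly_Mapping.keys] split: if_splits)
  moreover have "sum ?t (splits \<alpha>) = sum ?t (?f ` ?I)"
  proof (rule sum.mono_neutral_right)
    show "?f ` ?I \<subseteq> splits \<alpha>"
      by (auto simp: splits_def add_diff_single)
    have "(\<beta>, \<gamma>) \<in> ?f ` ?I" if \<beta>: "\<beta> = Poly_Mapping.single i k" and "\<beta> + \<gamma> = \<alpha>" for i \<beta> \<gamma>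
    proof -
      have "Poly_Mapping.lookup \<alpha> i = k + Poly_Mapping.lookup \<gamma> i" "\<gamma> = \<alpha> - Poly_Mapping.single i k"
        using that by (auto simp: lookup_add)
      then show ?thesis
        using assms \<beta> by (auto simp: in_keys_iff)
    qed
    then show "\<forall>p\<in>splits \<alpha> - ?f ` ?I. ?t p = 0"
      by (auto simp: splits_def psym_def)
  qed simp
  ultimately show ?thesis
    by (simp add: mcoeff_mult sum.reindex) (auto intro!: sum.cong simp: psym_def)
qed

text \<open>A monomial \<open>\<alpha>\<close> of degree \<open>n\<close> occurs in
  \<open>p\<^sub>k h\<^bsub>n-k\<^esub>\<close> once for every variable whose exponent in
  \<open>\<alpha>\<close> is at least \<open>k\<close>. Summed over \<open>k\<close>, this counts
  every variable as often as its exponent says, \<open>n\<close> times in all.\<close>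

lemma newton_hsym: "euler hgen = pgen * hgen"
proof (rule fps_ext, rule mps_eqI)
  fix n \<alpha>
  let ?d = "if mdeg \<alpha> = n then 1 else 0 :: rat"
  let ?L = "Poly_Mapping.lookup \<alpha>"
  have h: "mcoeff (hsym (n - k)) (\<alpha> - Poly_Mapping.single i k) = ?d" if "k \<le> ?L i" "k \<le> n" for i k
    using arg_cong[OF add_diff_single[OF that(1)], of mdeg] that(2) by (auto simp: hsym_def mdeg_add)
  have "mcoeff ((pgen * hgen) $ n) \<alpha> = (\<Sum>k\<in>{1..n}. mcoeff (psym k * hsym (n - k)) \<alpha>)"
    unfolding fps_mult_nth mcoeff_sum pgen_def hgen_def
    by (rule sum.mono_neutral_cong_right) auto
  also have "\<dots> = (\<Sum>k\<in>{1..n}. \<Sum>i\<in>Poly_Mapping.keys \<alpha>. if k \<le> ?L i then ?d else 0)"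
    by (rule sum.cong) (auto simp: mcoeff_psym_mult h sum.If_cases Collect_conj_eq)
  also have "\<dots> = (\<Sum>i\<in>Poly_Mapping.keys \<alpha>. \<Sum>k\<in>{1..n}. if k \<le> ?L i then ?d else 0)"
    by (rule sum.swap)
  also have "\<dots> = (\<Sum>i\<in>Poly_Mapping.keys \<alpha>. of_nat (?L i) * ?d)"
  proof (cases "mdeg \<alpha> = n")
    case True
    have "(\<Sum>k\<in>{1..n}. if k \<le> ?L i then ?d else 0) = of_nat (?L i) * ?d"
      if "i \<in> Poly_Mapping.keys \<alpha>" for i
    proof -
      have "?L i \<le> n"
        using that True member_le_sum[of i "Poly_Mapping.keys \<alpha>" ?L] by (simp add: mdeg_def)
      then have "{1..n} \<inter> {k. k \<le> ?L i} = {1..?L i}"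
        by auto
      then show ?thesis
        using True by (simp add: sum.If_cases)
    qed
    then show ?thesis by simp
  qed simp
  also have "\<dots> = of_nat (mdeg \<alpha>) * ?d"
    by (simp add: mdeg_def sum_distrib_right)
  also have "\<dots> = mcoeff (euler hgen $ n) \<alpha>"
    by (auto simp: euler_nth hgen_def mcoeff_of_nat_mult hsym_def)
  finally show "mcoeff (euler hgen $ n) \<alpha> = mcoeff ((pgen * hgen) $ n) \<alpha>" by simp
qed

text \<open>The coefficient at \<open>\<alpha>\<close> is a signed count of factorizations
  \<open>\<alpha> = \<beta> + \<gamma>\<close> with \<open>\<beta>\<close> squarefree. If the
  variable \<open>i\<close> occurs in \<open>\<alpha>\<close>, then moving one factor
  \<open>x\<^sub>i\<close> into \<open>\<beta>\<close> or out of it changes the sign.\<close>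

lemma alternate_egen_mult_hgen: "alternate egen * hgen = 1"
proof (rule fps_ext, rule mps_eqI)
  fix n \<alpha>
  let ?B = "{p \<in> splits \<alpha>. \<forall>i. Poly_Mapping.lookup (fst p) i \<le> 1}"
  have "mcoeff ((alternate egen * hgen) $ n) \<alpha> =
      (\<Sum>a=0..n. \<Sum>p\<in>splits \<alpha>. if p \<in> ?B \<and> mdeg (fst p) = a \<and> mdeg (snd p) = n - a then (-1) ^ a else 0)"
    unfolding fps_mult_nth mcoeff_sum alternate_nth egen_def hgen_def fps_nth_Abs_fps mult.assoc mcoeff_sign_mult
    unfolding mcoeff_mult sum_distrib_left
    by (intro sum.cong) (auto simp: esym_def hsym_def)
  also have "\<dots> = (\<Sum>p\<in>splits \<alpha>. \<Sum>a=0..n. if p \<in> ?B \<and> mdeg (fst p) = a \<and> mdeg (snd p) = n - a then (-1) ^ a else 0)"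
    by (rule sum.swap)
  also have "\<dots> = (\<Sum>p\<in>splits \<alpha>. if p \<in> ?B \<and> mdeg \<alpha> = n then (-1) ^ mdeg (fst p) else 0)"
  proof (rule sum.cong)
    fix p assume "p \<in> splits \<alpha>"
    then have \<alpha>: "mdeg \<alpha> = mdeg (fst p) + mdeg (snd p)"
      by (auto simp: splits_def mdeg_add)
    have "(\<Sum>a=0..n. if p \<in> ?B \<and> mdeg (fst p) = a \<and> mdeg (snd p) = n - a then (-1) ^ a else 0 :: rat)
       = (\<Sum>a=0..n. if a = mdeg (fst p) then if p \<in> ?B \<and> mdeg \<alpha> = n then (-1) ^ a else 0 else 0)"
      by (rule sum.cong) (auto simp: \<alpha>)
    also have "\<dots> = (if p \<in> ?B \<and> mdeg \<alpha> = n then (-1) ^ mdeg (fst p) else 0)"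
      by (auto simp: \<alpha>)
    finally show "(\<Sum>a=0..n. if p \<in> ?B \<and> mdeg (fst p) = a \<and> mdeg (snd p) = n - a then (-1) ^ a else 0 :: rat)
       = (if p \<in> ?B \<and> mdeg \<alpha> = n then (-1) ^ mdeg (fst p) else 0)" .
  qed simp
  also have "\<dots> = (if mdeg \<alpha> = n then \<Sum>p\<in>?B. (-1) ^ mdeg (fst p) else 0)"
    by (auto simp: sum.If_cases intro!: sum.cong)
  also have "\<dots> = mcoeff (1 $ n) \<alpha>"
  proof (cases "\<alpha> = 0")
    case True
    then have "?B = {(0, 0)}"
      by (auto simp: splits_def)
         (metis add_is_0 lookup_add lookup_zero poly_mapping_eqI)+
    then show ?thesis
      using True by (cases n) (simp_all add: mcoeff_one)
  next
    case False
    then obtain i where i: "Poly_Mapping.lookup \<alpha> i \<noteq> 0"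
      by (metis lookup_zero poly_mapping_eqI)
    let ?s = "Poly_Mapping.single i (1 :: nat)"
    let ?h = "\<lambda>(\<beta>, \<gamma>). if Poly_Mapping.lookup \<beta> i = 0 then (\<beta> + ?s, \<gamma> - ?s) else (\<beta> - ?s, \<gamma> + ?s)"
    have cancel: "?s + (\<beta> - ?s) = \<beta>" if "Poly_Mapping.lookup \<beta> i \<noteq> 0" for \<beta>
      using that by (intro add_diff_single) simp
    have "(\<Sum>p\<in>?B. (-1) ^ mdeg (fst p)) = (0 :: rat)"
    proof (rule sum_sign_reversing_involution[where h = ?h])
      fix p assume p: "p \<in> ?B"
      obtain \<beta> \<gamma> where [simp]: "p = (\<beta>, \<gamma>)" by force
      have \<alpha>: "\<beta> + \<gamma> = \<alpha>" and le: "\<And>j. Poly_Mapping.lookup \<beta> j \<le> 1"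
        using p by (auto simp: splits_def)
      have "?h p \<in> ?B \<and> ?h (?h p) = p \<and> (-1) ^ mdeg (fst (?h p)) = - ((-1) ^ mdeg (fst p) :: rat)"
      proof (cases "Poly_Mapping.lookup \<beta> i = 0")
        case True
        then have "Poly_Mapping.lookup \<gamma> i \<noteq> 0"
          using i \<alpha> by (auto simp: lookup_add)
        note c = cancel[OF this]
        have "\<beta> + ?s + (\<gamma> - ?s) = \<alpha>"
          using c \<alpha> by (simp add: add.assoc)
        moreover have "Poly_Mapping.lookup (\<beta> + ?s) j \<le> 1" for j
          using le[of j] True by (auto simp: lookup_add lookup_single when_def)
        ultimately show ?thesis
          using True c by (auto simp: splits_def mdeg_add lookup_add add.commute)
      next
        case F: False
        note c = cancel[OF F]
        have "(\<beta> - ?s) + (\<gamma> + ?s) = \<alpha>"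
          using c \<alpha> by (metis add.assoc add.commute)
        moreover have "Poly_Mapping.lookup (\<beta> - ?s) j \<le> 1" for j
          using le[of j] by (auto simp: lookup_minus)
        moreover have "Poly_Mapping.lookup (\<beta> - ?s) i = 0"
          using le[of i] by (auto simp: lookup_minus)
        moreover have "mdeg \<beta> = Suc (mdeg (\<beta> - ?s))"
          using arg_cong[OF c, of mdeg] by (simp add: mdeg_add)
        ultimately show ?thesis
          using F c by (auto simp: splits_def add.commute)
      qed
      then show "?h p \<in> ?B" "?h (?h p) = p" "(-1) ^ mdeg (fst (?h p)) = - ((-1) ^ mdeg (fst p) :: rat)"
        by blast+
    qed
    then show ?thesis
      using False by (auto simp: mcoeff_one fps_one_nth)
  qed
  finally show "mcoeff ((alternate egen * hgen) $ n) \<alpha> = mcoeff (1 $ n) \<alpha>" .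
qed

lemma hgen_mult_alternate_egen: "hgen * alternate egen = 1"
  using alternate_egen_mult_hgen by (simp add: mult.commute)

text \<open>This is obtained from the identity for \<open>H\<close> by differentiating
  \<open>E(-t) H(t) = 1\<close>.\<close>

lemma newton_esym: "euler egen = - alternate pgen * egen"
proof -
  have "euler (1 :: mps fps) = 0"
    by (simp add: euler_def)
  then have "euler (alternate egen) * hgen + alternate egen * euler hgen = 0"
    using euler_mult[of "alternate egen" hgen] by (simp add: alternate_egen_mult_hgen)
  then have "(euler (alternate egen) * hgen + alternate egen * (pgen * hgen)) * alternate egen = 0"
    by (simp add: newton_hsym)
  then have "euler (alternate egen) * (hgen * alternate egen) + pgen * alternate egen * (hgen * alternate egen) = 0"
    by (simp add: algebra_simps)
  then have "alternate (euler egen) = - pgen * alternate egen"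
    by (simp add: hgen_mult_alternate_egen euler_alternate eq_neg_iff_add_eq_0)
  then have "alternate (alternate (euler egen)) = alternate (- pgen * alternate egen)"
    by simp
  then show ?thesis
    by (simp only: alternate_alternate alternate_mult alternate_uminus)
qed

text \<open>As \<open>A\<close> has no constant term, the equation expresses
  \<open>n F\<^sub>n\<close> by the coefficients below \<open>n\<close>.\<close>

lemma euler_ode_unique:
  fixes F G A :: "mps fps"
  assumes "euler F = A * F" "euler G = A * G" "A $ 0 = 0" "F $ 0 = G $ 0"
  shows "F = G"
proof (rule fps_ext)
  fix n show "F $ n = G $ n"
  proof (induction n rule: less_induct)
    case (less n)
    show ?case
    proof (cases "n = 0")
      case False
      have "A $ i * F $ (n - i) = A $ i * G $ (n - i)" if "i \<le> n" for i
        using less[of "n - i"] that False assms(3) by (cases "i = 0") auto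
      then have "(A * F) $ n = (A * G) $ n"
        by (simp add: fps_mult_nth)
      then show ?thesis
        using of_nat_mult_left_cancel_mps[of n "F $ n" "G $ n"] False assms(1,2)
        by (simp flip: euler_nth)
    qed (simp add: assms)
  qed
qed

section \<open>Endomorphisms that double or fix the power sums\<close>

text \<open>The coefficient of \<open>t\<^bsup>2n\<^esup>\<close> in \<open>F(t) F(-t)\<close> for
  the generating function \<open>F\<close> of \<open>q\<close>.\<close>

definition signed_square :: "(nat \<Rightarrow> mps) \<Rightarrow> nat \<Rightarrow> mps" where
  "signed_square q n = (\<Sum>a\<le>2 * n. (-1) ^ a * (q a * q (2 * n - a)))"

lemma signed_square_eq: "signed_square q n = (Abs_fps q * alternate (Abs_fps q)) $ (2 * n)"
proof -
  have "(Abs_fps q * alternate (Abs_fps q)) $ (2 * n) = (alternate (Abs_fps q) * Abs_fps q) $ (2 * n)"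
    by (simp only: mult.commute)
  then show ?thesis
    by (simp add: signed_square_def fps_mult_nth alternate_nth atMost_atLeast0 mult.assoc)
qed

text \<open>If \<open>\<theta> F = R F\<close>, then \<open>W = F(t) F(-t)\<close> satisfies
  \<open>\<theta> W = (R(t) + R(-t)) W\<close>, in which only twice the even part of
  \<open>R\<close> occurs. Read as a series in \<open>t\<^sup>2\<close>, with
  \<open>\<theta>\<close> halved accordingly, this is the equation that \<open>\<phi>\<close>
  imposes on the images of the \<open>q n\<close>. It is applied with \<open>\<epsilon> = 1\<close>
  to the complete and with \<open>\<epsilon> = -1\<close> to the elementary functions; the sign
  stems from the alternating signs in Newton's identities for the latter.\<close>

lemma endo_doubling_power_sums:
  fixes q :: "nat \<Rightarrow> mps" and R :: "mps fps" and \<epsilon> :: mps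
  assumes \<phi>: "sym_endo \<phi>" and q: "\<And>n. q n \<in> Sym" "q 0 = 1"
    and R: "\<And>n. R $ n \<in> Sym" "R $ 0 = 0"
    and ode: "euler (Abs_fps q) = R * Abs_fps q"
    and \<epsilon>: "\<epsilon> * \<epsilon> = 1"
    and double: "\<And>k. 1 \<le> k \<Longrightarrow> \<phi> (R $ k) = \<epsilon> ^ k * R $ (2 * k)"
  shows "\<phi> (q n) = \<epsilon> ^ n * signed_square q n"
proof -
  define F where "F = Abs_fps q"
  define W where "W = F * alternate F"
  define A where "A = Abs_fps (\<lambda>k. \<phi> (R $ k))"
  have even: "(R + alternate R) $ i = (if even i then 2 * R $ i else 0)" for i
    by (simp add: alternate_nth)
  have W: "euler W = (R + alternate R) * W"
  proof -
    have "euler (alternate F) = alternate R * alternate F"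
      using ode by (simp add: F_def euler_alternate alternate_mult)
    then show ?thesis
      using ode unfolding W_def euler_mult by (simp add: F_def algebra_simps)
  qed
  have \<phi>0: "\<phi> (R $ 0) = 0"
    using R(2) sym_endo_sum[OF \<phi>, of "{}"] by simp
  have "Abs_fps (\<lambda>n. \<phi> (q n)) = Abs_fps (\<lambda>n. \<epsilon> ^ n * W $ (2 * n))"
  proof (rule euler_ode_unique[of _ A])
    show "euler (Abs_fps (\<lambda>n. \<phi> (q n))) = A * Abs_fps (\<lambda>n. \<phi> (q n))"
    proof (rule fps_ext)
      fix n
      have "of_nat n * q n = (\<Sum>i=0..n. R $ i * q (n - i))"
        using arg_cong[OF ode, of "\<lambda>f. f $ n"] by (simp add: euler_nth fps_mult_nth)
      then have "of_nat n * \<phi> (q n) = \<phi> (\<Sum>i=0..n. R $ i * q (n - i))"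
        by (simp flip: sym_endo_of_nat_mult[OF \<phi> q(1)])
      also have "\<dots> = (\<Sum>i=0..n. \<phi> (R $ i) * \<phi> (q (n - i)))"
        by (simp add: sym_endo_sum[OF \<phi>] sym_endo_mult[OF \<phi>] Sym_mult q R)
      finally show "euler (Abs_fps (\<lambda>n. \<phi> (q n))) $ n = (A * Abs_fps (\<lambda>n. \<phi> (q n))) $ n"
        by (simp add: euler_nth fps_mult_nth A_def)
    qed
    show "euler (Abs_fps (\<lambda>n. \<epsilon> ^ n * W $ (2 * n))) = A * Abs_fps (\<lambda>n. \<epsilon> ^ n * W $ (2 * n))"
    proof (rule fps_ext)
      fix n
      have "of_nat (2 * n) * W $ (2 * n) = (\<Sum>i=0..2 * n. (R + alternate R) $ i * W $ (2 * n - i))"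
        using arg_cong[OF W, of "\<lambda>f. f $ (2 * n)"] by (simp only: euler_nth fps_mult_nth)
      also have "\<dots> = (\<Sum>i\<in>(\<lambda>k. 2 * k) ` {0..n}. 2 * R $ i * W $ (2 * n - i))"
        unfolding even by (rule sum.mono_neutral_cong_right) (auto elim!: evenE)
      also have "\<dots> = (\<Sum>k=0..n. 2 * R $ (2 * k) * W $ (2 * (n - k)))"
        by (subst sum.reindex) (auto simp: inj_on_def diff_mult_distrib2)
      finally have "of_nat 2 * (of_nat n * W $ (2 * n)) = of_nat 2 * (\<Sum>k=0..n. R $ (2 * k) * W $ (2 * (n - k)))"
        by (simp add: sum_distrib_left mult.assoc)
      then have "of_nat n * W $ (2 * n) = (\<Sum>k=0..n. R $ (2 * k) * W $ (2 * (n - k)))"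
        by (rule of_nat_mult_left_cancel_mps[rotated]) simp
      then have "of_nat n * (\<epsilon> ^ n * W $ (2 * n)) = (\<Sum>k=0..n. \<epsilon> ^ n * (R $ (2 * k) * W $ (2 * (n - k))))"
        by (simp only: mult.left_commute[of "of_nat n"] sum_distrib_left)
      also have "\<dots> = (\<Sum>k=0..n. \<phi> (R $ k) * (\<epsilon> ^ (n - k) * W $ (2 * (n - k))))"
      proof (rule sum.cong)
        fix k assume "k \<in> {0..n}"
        then have "\<epsilon> ^ n = \<epsilon> ^ k * \<epsilon> ^ (n - k)"
          by (simp flip: power_add)
        moreover have "\<phi> (R $ k) = \<epsilon> ^ k * R $ (2 * k)"
          using double[of k] \<phi>0 R(2) by (cases k) auto
        ultimately show "\<epsilon> ^ n * (R $ (2 * k) * W $ (2 * (n - k))) = \<phi> (R $ k) * (\<epsilon> ^ (n - k) * W $ (2 * (n - k)))"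
          by (simp add: ac_simps)
      qed simp
      finally show "euler (Abs_fps (\<lambda>n. \<epsilon> ^ n * W $ (2 * n))) $ n = (A * Abs_fps (\<lambda>n. \<epsilon> ^ n * W $ (2 * n))) $ n"
        by (simp add: euler_nth fps_mult_nth A_def)
    qed
    show "A $ 0 = 0"
      by (simp add: A_def \<phi>0)
    show "Abs_fps (\<lambda>n. \<phi> (q n)) $ 0 = Abs_fps (\<lambda>n. \<epsilon> ^ n * W $ (2 * n)) $ 0"
      using \<phi> q(2) by (simp add: sym_endo_def W_def F_def alternate_nth)
  qed
  from arg_cong[OF this, of "\<lambda>f. f $ n"] show ?thesis
    by (simp add: signed_square_eq W_def F_def)
qed

lemma endo_fixing_power_sums:
  fixes q :: "nat \<Rightarrow> mps" and R :: "mps fps"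
  assumes \<phi>: "sym_endo \<phi>" and q: "\<And>n. q n \<in> Sym" "q 0 = 1"
    and R: "\<And>n. R $ n \<in> Sym" "R $ 0 = 0"
    and ode: "euler (Abs_fps q) = R * Abs_fps q"
    and inv: "\<And>k. 1 \<le> k \<Longrightarrow> \<phi> (R $ k) = R $ k"
  shows "\<phi> (q n) = q n"
proof -
  have \<phi>R: "\<phi> (R $ k) = R $ k" for k
    using inv[of k] R(2) sym_endo_sum[OF \<phi>, of "{}"] by (cases k) auto
  have "Abs_fps (\<lambda>n. \<phi> (q n)) = Abs_fps q"
  proof (rule euler_ode_unique[of _ R])
    show "euler (Abs_fps (\<lambda>n. \<phi> (q n))) = R * Abs_fps (\<lambda>n. \<phi> (q n))"
    proof (rule fps_ext)
      fix n
      have "of_nat n * q n = (\<Sum>i=0..n. R $ i * q (n - i))"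
        using arg_cong[OF ode, of "\<lambda>f. f $ n"] by (simp add: euler_nth fps_mult_nth)
      then have "of_nat n * \<phi> (q n) = \<phi> (\<Sum>i=0..n. R $ i * q (n - i))"
        by (simp flip: sym_endo_of_nat_mult[OF \<phi> q(1)])
      also have "\<dots> = (\<Sum>i=0..n. R $ i * \<phi> (q (n - i)))"
        by (simp add: sym_endo_sum[OF \<phi>] sym_endo_mult[OF \<phi>] Sym_mult q R \<phi>R)
      finally show "euler (Abs_fps (\<lambda>n. \<phi> (q n))) $ n = (R * Abs_fps (\<lambda>n. \<phi> (q n))) $ n"
        by (simp add: euler_nth fps_mult_nth)
    qed
  qed (use ode R(2) q(2) \<phi> in \<open>simp_all add: sym_endo_def\<close>)
  from arg_cong[OF this, of "\<lambda>f. f $ n"] show ?thesis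
    by simp
qed

section \<open>Partitions and their diagrams\<close>

definition cells :: "(nat \<Rightarrow> nat) \<Rightarrow> cell set" where
  "cells f = {(r, c). c < f r}"

text \<open>Weakly decreasing functions of the row index spare all case distinctions on the number
  of rows: adding a strip may open a new row.\<close>

definition par :: "(nat \<Rightarrow> nat) \<Rightarrow> bool" where
  "par f \<longleftrightarrow> antimono f \<and> (\<exists>M. \<forall>i\<ge>M. f i = 0)"

definition psize :: "(nat \<Rightarrow> nat) \<Rightarrow> nat" where
  "psize f = card (cells f)"

definition rows :: "cell set \<Rightarrow> nat \<Rightarrow> nat" where
  "rows S r = card {c. (r, c) \<in> S}"

lemma mem_cells [simp]: "(r, c) \<in> cells f \<longleftrightarrow> c < f r"
  by (simp add: cells_def)

lemma cells_subset_iff: "cells f \<subseteq> cells g \<longleftrightarrow> (\<forall>i. f i \<le> g i)"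
proof
  assume s: "cells f \<subseteq> cells g"
  have "f i \<le> g i" for i
  proof (rule ccontr)
    assume "\<not> f i \<le> g i"
    then have "(i, g i) \<in> cells f" by simp
    with s have "(i, g i) \<in> cells g" ..
    then show False by simp
  qed
  then show "\<forall>i. f i \<le> g i" ..
next
  assume "\<forall>i. f i \<le> g i"
  then show "cells f \<subseteq> cells g"
    by (auto simp: cells_def intro: less_le_trans)
qed

lemma cells_inject: "cells f = cells g \<longleftrightarrow> f = g"
  by (metis cells_subset_iff antisym ext order_refl)

lemma rows_cells [simp]: "rows (cells f) = f"
  by (rule ext) (simp add: rows_def)

lemma cells_bounded: "\<forall>i\<ge>M. f i = 0 \<Longrightarrow> cells f = Sigma {..<M} (\<lambda>i. {..<f i})"
  by (auto simp: cells_def) (metis not_less not_less0)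

lemma psize_eq_sum: "\<forall>i\<ge>M. f i = 0 \<Longrightarrow> psize f = sum f {..<M}"
  by (simp add: psize_def cells_bounded)

lemma par_finite_cells: "par f \<Longrightarrow> finite (cells f)"
  by (auto simp: par_def cells_bounded)

lemma par_antimono: "par f \<Longrightarrow> i \<le> j \<Longrightarrow> f j \<le> f i"
  by (simp add: par_def antimonoD)

lemma par_zero: "par (\<lambda>_. 0)"
  by (simp add: par_def antimono_def)

lemma psize_zero [simp]: "psize (\<lambda>_. 0) = 0"
  by (simp add: psize_def cells_def)

lemma psize_eq_0_iff: "par f \<Longrightarrow> psize f = 0 \<longleftrightarrow> f = (\<lambda>_. 0)"
  using cells_inject[of f "\<lambda>_. 0"] par_finite_cells[of f]
  by (auto simp: psize_def cells_def)

lemma par_common_bound: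
  assumes "finite A" "\<And>f. f \<in> A \<Longrightarrow> par f"
  obtains M where "\<And>f i. f \<in> A \<Longrightarrow> M \<le> i \<Longrightarrow> f i = 0"
proof -
  have "\<exists>M. \<forall>f\<in>A. \<forall>i\<ge>M. f i = 0"
    using assms
  proof (induction A rule: finite_induct)
    case (insert f A)
    then obtain M where "\<forall>f\<in>A. \<forall>i\<ge>M. f i = 0" by auto
    moreover from insert.prems[of f] obtain M' where "\<forall>i\<ge>M'. f i = 0"
      by (auto simp: par_def)
    ultimately show ?case
      by (intro exI[of _ "max M M'"]) auto
  qed auto
  then show ?thesis using that by auto
qed

lemma cells_square:
  assumes "par f"
  shows "cells f \<subseteq> {..<psize f} \<times> {..<psize f}"
proof -
  have "r < psize f \<and> c < psize f" if "c < f r" for r c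
  proof -
    have "(\<lambda>i. (i, 0)) ` {..r} \<subseteq> cells f" "Pair r ` {..c} \<subseteq> cells f"
      using that by (auto dest!: par_antimono[OF assms, of _ r] dest: less_le_trans[of c "f r"])
    then have "card ((\<lambda>i. (i, 0 :: nat)) ` {..r}) \<le> psize f" "card (Pair r ` {..c}) \<le> psize f"
      unfolding psize_def using par_finite_cells[OF assms] by (simp_all add: card_mono)
    then show ?thesis
      by (simp add: card_image inj_on_def)
  qed
  then show ?thesis by auto
qed

lemma finite_par_psize: "finite {f. par f \<and> psize f = n}"
proof (rule finite_imageD)
  show "finite (cells ` {f. par f \<and> psize f = n})"
    by (rule finite_subset[of _ "Pow ({..<n} \<times> {..<n})"]) (auto dest!: cells_square)
  show "inj_on cells {f. par f \<and> psize f = n}"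
    by (simp add: inj_on_def cells_inject)
qed

text \<open>Through this criterion the entries of a tableau up to a bound and the reflections of
  diagrams are recognized as partitions.\<close>

lemma par_rows:
  assumes fin: "finite S"
    and closed: "\<And>r c r' c'. (r, c) \<in> S \<Longrightarrow> r' \<le> r \<Longrightarrow> c' \<le> c \<Longrightarrow> (r', c') \<in> S"
  shows "par (rows S)" "cells (rows S) = S"
proof -
  have finr: "finite {c. (r, c) \<in> S}" for r
    using finite_imageI[OF fin, of snd] by (rule finite_subset[rotated]) force
  have init: "{c. (r, c) \<in> S} = {..<rows S r}" for r
  proof -
    have "\<exists>m. {c. (r, c) \<in> S} = {..<m}"
    proof (cases "{c. (r, c) \<in> S} = {}")
      case True
      then show ?thesis by (intro exI[of _ 0]) simp
    next
      case False
      let ?m = "Max {c. (r, c) \<in> S}"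
      have "?m \<in> {c. (r, c) \<in> S}"
        using False finr Max_in by blast
      then have m: "(r, ?m) \<in> S" by simp
      have "c \<le> ?m" if "(r, c) \<in> S" for c
        using that finr by simp
      moreover have "(r, c) \<in> S" if "c \<le> ?m" for c
        using closed[OF m order_refl that] .
      ultimately have "{c. (r, c) \<in> S} = {..<Suc ?m}"
        unfolding less_Suc_eq_le lessThan_def by blast
      then show ?thesis ..
    qed
    then obtain m where "{c. (r, c) \<in> S} = {..<m}" ..
    then show ?thesis by (simp add: rows_def)
  qed
  have "(r, c) \<in> cells (rows S) \<longleftrightarrow> (r, c) \<in> S" for r c
    using arg_cong[OF init[of r], of "\<lambda>X. c \<in> X"] by simp
  then show "cells (rows S) = S"
    by auto
  obtain M where M: "\<forall>r\<in>fst ` S. r < M"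
    using finite_nat_set_iff_bounded[of "fst ` S"] fin by auto
  have "rows S r = 0" if "M \<le> r" for r
  proof -
    have "{c. (r, c) \<in> S} = {}"
      using that M by force
    then show ?thesis by (simp add: rows_def)
  qed
  moreover have "rows S r' \<le> rows S r" if "r \<le> r'" for r r'
    unfolding rows_def using closed[OF _ that order_refl] finr by (intro card_mono subsetI) simp_all
  ultimately show "par (rows S)"
    by (auto simp: par_def antimono_def)
qed

section \<open>Partitions as lists\<close>

definition row :: "nat list \<Rightarrow> nat \<Rightarrow> nat" where
  "row \<nu> r = (if r < length \<nu> then \<nu> ! r else 0)"

lemma diagram_eq_cells: "diagram \<nu> = cells (row \<nu>)"
  by (auto simp: diagram_def row_def cells_def split: if_splits)

lemma par_row: "is_partition \<nu> \<Longrightarrow> par (row \<nu>)"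
  by (auto simp: is_partition_def par_def antimono_def row_def sorted_wrt_iff_nth_less
      intro!: exI[of _ "length \<nu>"]) (metis le_eq_less_or_eq)

lemma row_inject:
  assumes "is_partition \<mu>" "is_partition \<nu>" "row \<mu> = row \<nu>"
  shows "\<mu> = \<nu>"
proof (rule nth_equalityI)
  have pos: "0 < row \<kappa> i \<longleftrightarrow> i < length \<kappa>" if "is_partition \<kappa>" for \<kappa> i
    using that by (auto simp: row_def is_partition_def)
  have "i < length \<mu> \<longleftrightarrow> i < length \<nu>" for i
    using pos[OF assms(1), of i] pos[OF assms(2), of i] assms(3) by simp
  then show l: "length \<mu> = length \<nu>"
    by (metis less_irrefl linorder_neqE_nat)
  show "\<mu> ! i = \<nu> ! i" if "i < length \<mu>" for i
    using fun_cong[OF assms(3), of i] that l by (simp add: row_def)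
qed

lemma par_is_row:
  assumes "par f"
  obtains \<nu> where "is_partition \<nu>" "row \<nu> = f"
proof -
  define M where "M = (LEAST i. f i = 0)"
  have M0: "f M = 0"
  proof -
    obtain m where "f m = 0"
      using assms by (auto simp: par_def)
    then show ?thesis
      unfolding M_def by (rule LeastI)
  qed
  have zero: "f i = 0 \<longleftrightarrow> M \<le> i" for i
  proof
    show "f i = 0 \<Longrightarrow> M \<le> i"
      unfolding M_def by (rule Least_le)
    show "M \<le> i \<Longrightarrow> f i = 0"
      using par_antimono[OF assms, of M i] M0 by simp
  qed
  have "is_partition (map f [0..<M])"
    unfolding is_partition_def sorted_wrt_iff_nth_less
    using zero by (auto simp: par_antimono[OF assms] simp flip: neq0_conv)
  moreover have "row (map f [0..<M]) = f"
    using zero by (auto simp: row_def fun_eq_iff)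
  ultimately show ?thesis using that by blast
qed

lemma straight_iff: "straight T \<longleftrightarrow> (\<exists>f. par f \<and> dom T = cells f)"
  unfolding straight_def has_shape_def diagram_eq_cells by (metis par_row par_is_row)

lemma straight_rows:
  assumes "straight T"
  shows "par (rows (dom T))" "cells (rows (dom T)) = dom T"
proof -
  obtain f where "par f" "dom T = cells f"
    using assms by (auto simp only: straight_iff)
  then show "par (rows (dom T))" "cells (rows (dom T)) = dom T"
    by (simp_all only: rows_cells)
qed

lemma dom_cells_iff: "dom T = cells f \<Longrightarrow> c < f r \<longleftrightarrow> (\<exists>a. T (r, c) = Some a)"
  by (metis domD domI mem_cells)

lemma shape_eqI:
  assumes "has_shape T \<nu>"
  shows "shape T = \<nu>"
  unfolding shape_def
proof (rule the_equality, rule assms)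
  fix \<mu> assume "has_shape T \<mu>"
  with assms show "\<mu> = \<nu>"
    by (auto simp: has_shape_def diagram_eq_cells cells_inject intro!: row_inject)
qed

definition schur_fun :: "(nat \<Rightarrow> nat) \<Rightarrow> mps" where
  "schur_fun f = Mps (\<lambda>\<alpha>. of_nat (card {T. dom T = cells f \<and> semistandard T \<and>
     (\<forall>i. content T (Suc i) = Poly_Mapping.lookup \<alpha> i)}))"

lemma schur_eq_schur_fun: "is_partition \<nu> \<Longrightarrow> schur \<nu> = schur_fun (row \<nu>)"
  by (simp add: schur_def schur_fun_def has_shape_def diagram_eq_cells)

lemma schur_shape:
  assumes "straight T"
  shows "schur (shape T) = schur_fun (rows (dom T))"
proof -
  obtain \<nu> where "has_shape T \<nu>"
    using assms by (auto simp: straight_def)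
  then show ?thesis
    by (auto simp: shape_eqI has_shape_def schur_eq_schur_fun diagram_eq_cells)
qed

section \<open>Tableaux as chains of horizontal strips\<close>

text \<open>The interlacing form of the condition that no two cells of \<open>\<nu>/\<mu>\<close>
  lie in the same column.\<close>

definition hstrip :: "(nat \<Rightarrow> nat) \<Rightarrow> (nat \<Rightarrow> nat) \<Rightarrow> bool" where
  "hstrip \<mu> \<nu> \<longleftrightarrow> par \<mu> \<and> par \<nu> \<and> (\<forall>i. \<mu> i \<le> \<nu> i \<and> \<nu> (Suc i) \<le> \<mu> i)"

definition hstrip_by :: "nat \<Rightarrow> (nat \<Rightarrow> nat) \<Rightarrow> (nat \<Rightarrow> nat) \<Rightarrow> bool" where
  "hstrip_by n \<mu> \<nu> \<longleftrightarrow> hstrip \<mu> \<nu> \<and> psize \<nu> = psize \<mu> + n"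

lemma psize_mono:
  assumes "par \<nu>" "\<And>i. \<mu> i \<le> \<nu> i"
  shows "psize \<mu> \<le> psize \<nu>"
  unfolding psize_def using assms by (intro card_mono par_finite_cells) (simp_all add: cells_subset_iff)

lemma par_between:
  assumes "par \<nu>" "\<And>i. \<kappa> i \<le> \<nu> i" "\<And>i. \<nu> (Suc i) \<le> \<kappa> i"
  shows "par \<kappa>"
  unfolding par_def
proof
  show "antimono \<kappa>"
    by (rule decseq_SucI) (meson assms(2,3) le_trans)
  show "\<exists>M. \<forall>i\<ge>M. \<kappa> i = 0"
    using assms(1,2) unfolding par_def by (metis le_zero_eq)
qed

lemma finite_hstrip_by_above: "finite {\<nu>. hstrip_by n \<mu> \<nu>}"
  by (rule finite_subset[OF _ finite_par_psize[of "psize \<mu> + n"]]) (auto simp: hstrip_by_def hstrip_def)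

lemma finite_hstrip_below: "finite {\<mu>. hstrip \<mu> \<nu>}"
proof (rule finite_subset)
  show "{\<mu>. hstrip \<mu> \<nu>} \<subseteq> (\<Union>n\<le>psize \<nu>. {f. par f \<and> psize f = n})"
    by (auto simp: hstrip_def psize_mono)
  show "finite (\<Union>n\<le>psize \<nu>. {f. par f \<and> psize f = n})"
    using finite_par_psize by blast
qed

text \<open>The entry \<open>i + 1\<close> occurs \<open>\<alpha> i\<close> times.\<close>

definition tabs :: "nat \<Rightarrow> (nat \<Rightarrow> nat) \<Rightarrow> filling set" where
  "tabs L \<alpha> = {T. straight T \<and> semistandard T \<and> (\<forall>i. content T (Suc i) = (if i < L then \<alpha> i else 0))}"

text \<open>A chain of \<open>L\<close> strips is stored as a function on all natural numbers; the
  last condition makes it unique.\<close>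

definition strip_chains :: "nat \<Rightarrow> (nat \<Rightarrow> nat) \<Rightarrow> (nat \<Rightarrow> nat \<Rightarrow> nat) set" where
  "strip_chains L \<alpha> = {c. c 0 = (\<lambda>_. 0) \<and> (\<forall>k<L. hstrip_by (\<alpha> k) (c k) (c (Suc k))) \<and> (\<forall>k>L. c k = c L)}"

definition level :: "filling \<Rightarrow> nat \<Rightarrow> nat \<Rightarrow> nat" where
  "level T k = rows {p. \<exists>a\<le>k. T p = Some a}"

definition chain_filling :: "nat \<Rightarrow> (nat \<Rightarrow> nat \<Rightarrow> nat) \<Rightarrow> filling" where
  "chain_filling L c = (\<lambda>p. if p \<in> cells (c L) then Some (LEAST k. p \<in> cells (c k)) else None)"

lemma semistandard_pos: "semistandard T \<Longrightarrow> T p = Some a \<Longrightarrow> 0 < a"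
  unfolding semistandard_def by blast

lemma semistandard_row: "semistandard T \<Longrightarrow> T (r, c) = Some a \<Longrightarrow> T (r, c') = Some b \<Longrightarrow> c \<le> c' \<Longrightarrow> a \<le> b"
  unfolding semistandard_def by (metis le_eq_less_or_eq option.inject)

lemma semistandard_col: "semistandard T \<Longrightarrow> T (r, c) = Some a \<Longrightarrow> T (r', c) = Some b \<Longrightarrow> r < r' \<Longrightarrow> a < b"
  unfolding semistandard_def by blast

lemma level_cells:
  assumes "straight T" and ss: "semistandard T"
  shows "par (level T k)" "cells (level T k) = {p. \<exists>a\<le>k. T p = Some a}"
proof -
  obtain f where f: "par f" "dom T = cells f"
    using assms straight_iff by auto
  let ?S = "{p. \<exists>a\<le>k. T p = Some a}"
  have "finite ?S"
    by (rule finite_subset[OF _ par_finite_cells[OF f(1)]]) (auto simp flip: f(2))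
  moreover have "(r', c') \<in> ?S" if "(r, c) \<in> ?S" and le: "r' \<le> r" "c' \<le> c" for r c r' c'
  proof -
    from that obtain a where a: "a \<le> k" "T (r, c) = Some a" by auto
    then have "c < f r" using dom_cells_iff[OF f(2)] by auto
    then have "c' < f r'" "c < f r'"
      using le par_antimono[OF f(1) le(1)] by auto
    then obtain b b' where b: "T (r', c') = Some b" "T (r', c) = Some b'"
      using dom_cells_iff[OF f(2)] by auto
    have "b \<le> b'" using semistandard_row[OF ss b le(2)] .
    also have "b' \<le> a"
      using semistandard_col[OF ss b(2) a(2)] a(2) b(2) le(1) by (cases "r' = r") auto
    finally show ?thesis using a b by auto
  qed
  ultimately have "par (rows ?S) \<and> cells (rows ?S) = ?S"
    using par_rows[of ?S] by blast
  then show "par (level T k)" "cells (level T k) = ?S"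
    by (simp_all add: level_def)
qed

lemma hstrip_level:
  assumes "straight T" and ss: "semistandard T"
  shows "hstrip_by (content T (Suc k)) (level T k) (level T (Suc k))"
proof -
  note lc = level_cells[OF assms]
  obtain f where f: "par f" "dom T = cells f"
    using assms straight_iff by auto
  have "level T k i \<le> level T (Suc k) i" for i
    using lc(2)[of k] lc(2)[of "Suc k"] cells_subset_iff[of "level T k" "level T (Suc k)"] by auto
  moreover have "level T (Suc k) (Suc i) \<le> level T k i" for i
  proof (rule ccontr)
    let ?c = "level T k i"
    assume "\<not> level T (Suc k) (Suc i) \<le> level T k i"
    then have "(Suc i, ?c) \<in> cells (level T (Suc k))" by simp
    then obtain a where a: "a \<le> Suc k" "T (Suc i, ?c) = Some a"
      unfolding lc(2) by auto
    then have "?c < f (Suc i)" using dom_cells_iff[OF f(2)] by auto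
    then have "?c < f i"
      using par_antimono[OF f(1), of i "Suc i"] by simp
    then obtain b where b: "T (i, ?c) = Some b"
      using dom_cells_iff[OF f(2)] by auto
    have "b < a" using semistandard_col[OF ss b a(2)] by simp
    then have "(i, ?c) \<in> cells (level T k)"
      unfolding lc(2) using a b by auto
    then show False by simp
  qed
  moreover have "psize (level T (Suc k)) = psize (level T k) + content T (Suc k)"
  proof -
    have e: "cells (level T (Suc k)) = cells (level T k) \<union> {p. T p = Some (Suc k)}"
      unfolding lc(2) by (auto simp: le_Suc_eq)
    have "finite {p. T p = Some (Suc k)}"
      by (rule finite_subset[OF _ par_finite_cells[OF f(1)]]) (auto simp flip: f(2))
    moreover have "cells (level T k) \<inter> {p. T p = Some (Suc k)} = {}"
      unfolding lc(2) by auto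
    ultimately show ?thesis
      unfolding psize_def content_def e using par_finite_cells[OF lc(1)] by (intro card_Un_disjoint)
  qed
  ultimately show ?thesis
    by (simp add: hstrip_by_def hstrip_def lc(1))
qed

lemma chains_mono:
  assumes "c \<in> strip_chains L \<alpha>" "k \<le> k'"
  shows "cells (c k) \<subseteq> cells (c k')"
proof -
  have step: "cells (c k) \<subseteq> cells (c (Suc k))" for k
  proof (cases "k < L")
    case True
    then show ?thesis using assms(1) by (auto simp: strip_chains_def hstrip_by_def hstrip_def cells_subset_iff)
  next
    case False
    then have "c k = c L" "c (Suc k) = c L"
      using assms(1) by (cases "k = L"; simp add: strip_chains_def)+
    then show ?thesis by simp
  qed
  show ?thesis
    using lift_Suc_mono_le[of "\<lambda>k. cells (c k)"] step assms(2) by blast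
qed

lemma tabs_entry_le:
  assumes "T \<in> tabs L \<alpha>" "T p = Some a"
  shows "a \<le> L"
proof (rule ccontr)
  assume "\<not> a \<le> L"
  then obtain i where i: "a = Suc i" "L \<le> i" by (cases a) auto
  have "content T a = 0"
    using assms i by (auto simp: tabs_def)
  moreover have "finite {p. T p = Some a}"
    using assms(1) by (intro finite_subset[OF _ par_finite_cells[of "rows (dom T)"]])
      (auto simp: tabs_def straight_rows)
  ultimately show False
    unfolding content_def using assms(2) card_0_eq by blast
qed

lemma level_tabs:
  assumes "T \<in> tabs L \<alpha>" "L \<le> k"
  shows "level T k = rows (dom T)"
proof -
  have "{p. \<exists>a\<le>k. T p = Some a} = dom T"
    using tabs_entry_le[OF assms(1)] assms(2) by force
  then show ?thesis by (simp add: level_def)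
qed

lemma level_in_chains:
  assumes "T \<in> tabs L \<alpha>"
  shows "level T \<in> strip_chains L \<alpha>"
proof -
  have T: "straight T" "semistandard T"
    using assms by (auto simp: tabs_def)
  have "{p. \<exists>a\<le>0. T p = Some a} = {}"
    using semistandard_pos[OF T(2)] by force
  then have "level T 0 = (\<lambda>_. 0)"
    by (simp only: level_def) (simp add: rows_def fun_eq_iff)
  moreover have "hstrip_by (\<alpha> k) (level T k) (level T (Suc k))" if "k < L" for k
    using hstrip_level[OF T, of k] assms that by (simp add: tabs_def)
  moreover have "level T k = level T L" if "L < k" for k
    using level_tabs[OF assms, of k] level_tabs[OF assms, of L] that by simp
  ultimately show ?thesis
    by (simp add: strip_chains_def)
qed

lemma chain_filling_level:
  assumes "T \<in> tabs L \<alpha>"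
  shows "chain_filling L (level T) = T"
proof
  fix p
  have T: "straight T" "semistandard T"
    using assms by (auto simp: tabs_def)
  have d: "cells (level T L) = dom T"
    using level_tabs[OF assms order_refl] straight_rows(2)[OF T(1)] by simp
  show "chain_filling L (level T) p = T p"
  proof (cases "T p")
    case None
    then show ?thesis by (auto simp: chain_filling_def d)
  next
    case (Some a)
    have "(LEAST k. p \<in> cells (level T k)) = a"
      unfolding level_cells(2)[OF T] using Some by (intro Least_equality) auto
    then show ?thesis
      using Some by (auto simp: chain_filling_def d)
  qed
qed

lemma
  assumes c: "c \<in> strip_chains L \<alpha>"
  shows chain_filling_in_tabs: "chain_filling L c \<in> tabs L \<alpha>"
    and level_chain_filling: "level (chain_filling L c) = c"
proof -
  let ?T = "chain_filling L c"
  note mono = chains_mono[OF c]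
  have stab: "c k = c L" if "L \<le> k" for k
    using c that by (cases "k = L") (auto simp: strip_chains_def)
  have le_L: "cells (c k) \<subseteq> cells (c L)" for k
    using mono[of k L] stab[of k] by (cases "k \<le> L") auto
  have T_eq: "?T p = Some a \<longleftrightarrow> p \<in> cells (c a) \<and> (\<forall>k<a. p \<notin> cells (c k))" for p a
  proof
    assume "?T p = Some a"
    then have L: "p \<in> cells (c L)" and a: "a = (LEAST k. p \<in> cells (c k))"
      by (simp_all add: chain_filling_def split: if_splits)
    show "p \<in> cells (c a) \<and> (\<forall>k<a. p \<notin> cells (c k))"
      unfolding a using LeastI[of "\<lambda>k. p \<in> cells (c k)", OF L] not_less_Least by blast
  next
    assume a: "p \<in> cells (c a) \<and> (\<forall>k<a. p \<notin> cells (c k))"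
    then have "(LEAST k. p \<in> cells (c k)) = a"
      by (intro Least_equality) (auto intro: leI)
    moreover have "p \<in> cells (c L)"
      using a le_L by blast
    ultimately show "?T p = Some a"
      by (simp add: chain_filling_def)
  qed
  have lev: "{p. \<exists>a\<le>k. ?T p = Some a} = cells (c k)" for k
  proof (intro set_eqI iffI)
    fix p assume "p \<in> {p. \<exists>a\<le>k. ?T p = Some a}"
    then show "p \<in> cells (c k)" using mono T_eq by blast
  next
    fix p assume p: "p \<in> cells (c k)"
    define a where "a = (LEAST k. p \<in> cells (c k))"
    have "p \<in> cells (c a)"
      unfolding a_def by (rule LeastI[of "\<lambda>k. p \<in> cells (c k)", OF p])
    moreover have "\<forall>k<a. p \<notin> cells (c k)" "a \<le> k"
      unfolding a_def using p by (blast dest: not_less_Least, blast intro: Least_le)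
    ultimately
    show "p \<in> {p. \<exists>a\<le>k. ?T p = Some a}" using T_eq by blast
  qed
  then show lev': "level ?T = c"
    by (simp add: level_def fun_eq_iff)
  have strip: "{p. ?T p = Some (Suc k)} = cells (c (Suc k)) - cells (c k)" for k
    using mono[of _ k] T_eq by (auto simp: less_Suc_eq_le)
  have c0: "c 0 = (\<lambda>_. 0)"
    using c by (simp add: strip_chains_def)
  have hsc: "hstrip_by (\<alpha> k) (c k) (c (Suc k))" if "k < L" for k
    using c that by (simp add: strip_chains_def)
  have parc: "par (c k)" for k
  proof (cases "k < L")
    case True
    then show ?thesis using hsc by (auto simp: hstrip_by_def hstrip_def)
  next
    case False
    then show ?thesis
      using stab[of k] c0 par_zero hsc[of "L - 1"] by (cases L) (auto simp: hstrip_by_def hstrip_def)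
  qed
  have dom: "dom ?T = cells (c L)"
    by (auto simp: chain_filling_def split: if_splits)
  have "straight ?T"
    using dom parc straight_iff by blast
  moreover have "semistandard ?T"
    unfolding semistandard_def
  proof (intro conjI allI impI)
    fix p a assume "?T p = Some a"
    then show "0 < a" using T_eq[of p a] c0 by (cases a) (auto simp: cells_def)
  next
    fix r x x' a b
    assume a: "x < x' \<and> ?T (r, x) = Some a \<and> ?T (r, x') = Some b"
    then have "(r, x) \<in> cells (c b)" using T_eq[of "(r, x')" b] by auto
    then show "a \<le> b" using a T_eq[of "(r, x)" a] by (meson not_le)
  next
    fix r r' x a b
    assume a: "r < r' \<and> ?T (r, x) = Some a \<and> ?T (r', x) = Some b"
    then have b: "x < c b r'" using T_eq[of "(r', x)" b] by simp
    then obtain k where k: "b = Suc k" using c0 by (cases b) auto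
    have "c (Suc k) r' \<le> c k r"
    proof (cases "k < L")
      case True
      have "c (Suc k) r' \<le> c (Suc k) (Suc r)"
        using a par_antimono[OF parc] by simp
      also have "\<dots> \<le> c k r" using hsc[OF True] by (simp add: hstrip_by_def hstrip_def)
      finally show ?thesis .
    next
      case False
      then show ?thesis using a k stab[of k] stab[of "Suc k"] par_antimono[OF parc, of r r' L] by simp
    qed
    then have "(r, x) \<in> cells (c k)" using b k by simp
    then have "a \<le> k" using a T_eq[of "(r, x)" a] by (meson not_le)
    then show "a < b" using k by simp
  qed
  moreover have "content ?T (Suc i) = (if i < L then \<alpha> i else 0)" for i
  proof -
    have "content ?T (Suc i) = psize (c (Suc i)) - psize (c i)"
      unfolding content_def strip psize_def using mono[of i "Suc i"] par_finite_cells[OF parc]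
      by (simp add: card_Diff_subset)
    then show ?thesis
      using hsc[of i] stab[of i] stab[of "Suc i"] by (auto simp: hstrip_by_def)
  qed
  ultimately show "?T \<in> tabs L \<alpha>" by (simp add: tabs_def)
qed

text \<open>Columns of a semistandard tableau increase strictly, so equal entries form a horizontal
  strip. Conversely a cell receives the index of the first member of the chain that covers it.\<close>

lemma bij_betw_level: "bij_betw level (tabs L \<alpha>) (strip_chains L \<alpha>)"
  by (rule bij_betw_byWitness[of _ "chain_filling L"])
     (use chain_filling_level level_chain_filling level_in_chains chain_filling_in_tabs in \<open>blast+\<close>)

lemma chains_0: "strip_chains 0 \<alpha> = {\<lambda>_ _. 0}"
proof -
  have "c = (\<lambda>_ _. 0)" if "c 0 = (\<lambda>_. 0)" "\<forall>k>0. c k = c 0" for c :: "nat \<Rightarrow> nat \<Rightarrow> nat"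
  proof
    fix k show "c k = (\<lambda>_. 0)"
      using that by (cases "k = 0") simp_all
  qed
  then have "strip_chains 0 \<alpha> \<subseteq> {\<lambda>_ _. 0}"
    unfolding strip_chains_def by blast
  then show ?thesis
    by (auto simp: strip_chains_def)
qed

lemma chains_Suc_bij:
  "bij_betw (\<lambda>(c, \<nu>) k. if k \<le> L then c k else \<nu>)
     (SIGMA c:strip_chains L \<alpha>. {\<nu>. hstrip_by (\<alpha> L) (c L) \<nu>}) (strip_chains (Suc L) \<alpha>)"
proof (rule bij_betw_byWitness[of _ "\<lambda>c. (\<lambda>k. c (min k L), c (Suc L))"])
  show "\<forall>p\<in>SIGMA c:strip_chains L \<alpha>. {\<nu>. hstrip_by (\<alpha> L) (c L) \<nu>}.
      (\<lambda>c. (\<lambda>k. c (min k L), c (Suc L))) ((\<lambda>(c, \<nu>) k. if k \<le> L then c k else \<nu>) p) = p"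
  proof (intro ballI)
    fix p assume "p \<in> (SIGMA c:strip_chains L \<alpha>. {\<nu>. hstrip_by (\<alpha> L) (c L) \<nu>})"
    then obtain c \<nu> where p: "p = (c, \<nu>)" "\<forall>k>L. c k = c L"
      by (auto simp: strip_chains_def)
    then have "c (min k L) = c k" for k
      by (cases "k \<le> L") (simp_all add: min_def)
    then show "(\<lambda>c. (\<lambda>k. c (min k L), c (Suc L))) ((\<lambda>(c, \<nu>) k. if k \<le> L then c k else \<nu>) p) = p"
      by (simp add: p(1))
  qed
  show "\<forall>c\<in>strip_chains (Suc L) \<alpha>. (\<lambda>(c, \<nu>) k. if k \<le> L then c k else \<nu>) (\<lambda>k. c (min k L), c (Suc L)) = c"
  proof (intro ballI)
    fix c assume "c \<in> strip_chains (Suc L) \<alpha>"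
    then have c: "c k = c (Suc L)" if "Suc L < k" for k
      using that by (simp add: strip_chains_def)
    have "(if k \<le> L then c (min k L) else c (Suc L)) = c k" for k
    proof -
      consider "k \<le> L" | "k = Suc L" | "Suc L < k" by linarith
      then show ?thesis
      proof cases
        case 3
        then show ?thesis using c[of k] by simp
      qed simp_all
    qed
    then show "(\<lambda>(c, \<nu>) k. if k \<le> L then c k else \<nu>) (\<lambda>k. c (min k L), c (Suc L)) = c"
      unfolding prod.case by (rule ext)
  qed
  show "(\<lambda>(c, \<nu>) k. if k \<le> L then c k else \<nu>) ` (SIGMA c:strip_chains L \<alpha>. {\<nu>. hstrip_by (\<alpha> L) (c L) \<nu>}) \<subseteq> strip_chains (Suc L) \<alpha>"
    by (auto simp: strip_chains_def less_Suc_eq)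
  show "(\<lambda>c. (\<lambda>k. c (min k L), c (Suc L))) ` strip_chains (Suc L) \<alpha> \<subseteq> (SIGMA c:strip_chains L \<alpha>. {\<nu>. hstrip_by (\<alpha> L) (c L) \<nu>})"
  proof (intro image_subsetI SigmaI CollectI)
    fix c assume c: "c \<in> strip_chains (Suc L) \<alpha>"
    then have hstrip_by: "hstrip_by (\<alpha> k) (c k) (c (Suc k))" if "k \<le> L" for k
      using that by (simp add: strip_chains_def)
    have "c 0 = (\<lambda>_. 0)"
      using c by (simp add: strip_chains_def)
    then show "(\<lambda>k. c (min k L)) \<in> strip_chains L \<alpha>"
      using hstrip_by by (auto simp: strip_chains_def min_absorb1 min_absorb2)
    show "hstrip_by (\<alpha> L) (c (min L L)) (c (Suc L))"
      using hstrip_by by simp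
  qed
qed

lemma finite_chains: "finite (strip_chains L \<alpha>)"
proof (induction L)
  case (Suc L)
  have "finite (SIGMA c:strip_chains L \<alpha>. {\<nu>. hstrip_by (\<alpha> L) (c L) \<nu>})"
    by (rule finite_SigmaI) (simp_all add: Suc finite_hstrip_by_above)
  then show ?case
    by (simp only: bij_betw_finite[OF chains_Suc_bij[of L \<alpha>]])
qed (simp add: chains_0)

lemma sum_chains_Suc:
  "sum G (strip_chains (Suc L) \<alpha>) =
     (\<Sum>c\<in>strip_chains L \<alpha>. \<Sum>\<nu> | hstrip_by (\<alpha> L) (c L) \<nu>. G (\<lambda>k. if k \<le> L then c k else \<nu>))"
proof -
  have "(\<Sum>c\<in>strip_chains L \<alpha>. \<Sum>\<nu> | hstrip_by (\<alpha> L) (c L) \<nu>. G (\<lambda>k. if k \<le> L then c k else \<nu>)) =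
      (\<Sum>(c, \<nu>)\<in>(SIGMA c:strip_chains L \<alpha>. {\<nu>. hstrip_by (\<alpha> L) (c L) \<nu>}). G (\<lambda>k. if k \<le> L then c k else \<nu>))"
    by (rule sum.Sigma) (simp_all add: finite_chains finite_hstrip_by_above)
  then show ?thesis
    unfolding sum.reindex_bij_betw[OF chains_Suc_bij[of L \<alpha>], of G, symmetric]
    by (simp only: case_prod_unfold)
qed

section \<open>Schur polynomials and complete homogeneous polynomials\<close>

definition xpow :: "nat \<Rightarrow> nat \<Rightarrow> mps" where
  "xpow N k = Mps (\<lambda>\<alpha>. if \<alpha> = Poly_Mapping.single N k then 1 else 0)"

lemma single_diff_eq_iff:
  assumes "k \<le> Poly_Mapping.lookup \<alpha> i"
  shows "\<alpha> - Poly_Mapping.single i k = \<beta> \<longleftrightarrow> \<alpha> = Poly_Mapping.single i k + (\<beta> :: nat \<Rightarrow>\<^sub>0 nat)"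
  using add_diff_single[OF assms] by auto

lemma mcoeff_xpow_mult:
  "mcoeff (xpow N k * g) \<alpha> =
    (if k \<le> Poly_Mapping.lookup \<alpha> N then mcoeff g (\<alpha> - Poly_Mapping.single N k) else 0)"
proof -
  let ?p = "(Poly_Mapping.single N k, \<alpha> - Poly_Mapping.single N k)"
  have "mcoeff (xpow N k * g) \<alpha> =
      (\<Sum>p\<in>splits \<alpha>. if p = ?p then mcoeff g (\<alpha> - Poly_Mapping.single N k) else 0)"
    unfolding mcoeff_mult
    by (rule sum.cong) (auto simp: xpow_def splits_def split: if_splits)
  also have "\<dots> = (if ?p \<in> splits \<alpha> then mcoeff g (\<alpha> - Poly_Mapping.single N k) else 0)"
    by (simp add: sum.delta)
  also have "?p \<in> splits \<alpha> \<longleftrightarrow> k \<le> Poly_Mapping.lookup \<alpha> N"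
  proof
    assume "?p \<in> splits \<alpha>"
    then have "Poly_Mapping.single N k + (\<alpha> - Poly_Mapping.single N k) = \<alpha>"
      by (simp add: splits_def)
    from arg_cong[OF this, of "\<lambda>\<beta>. Poly_Mapping.lookup \<beta> N"]
    show "k \<le> Poly_Mapping.lookup \<alpha> N"
      by (simp add: lookup_add)
  qed (simp add: splits_def add_diff_single)
  finally show ?thesis .
qed

lemma xpow_add: "xpow N (a + b) = xpow N a * xpow N b"
proof (rule mps_eqI)
  fix \<alpha>
  show "mcoeff (xpow N (a + b)) \<alpha> = mcoeff (xpow N a * xpow N b) \<alpha>"
    unfolding mcoeff_xpow_mult unfolding xpow_def mcoeff_Mps
  proof (cases "a \<le> Poly_Mapping.lookup \<alpha> N")
    case True
    then show "(if \<alpha> = Poly_Mapping.single N (a + b) then 1 else 0) =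
        (if a \<le> Poly_Mapping.lookup \<alpha> N then
          if \<alpha> - Poly_Mapping.single N a = Poly_Mapping.single N b then 1 else 0 else 0 :: rat)"
      by (simp add: single_diff_eq_iff single_add)
  next
    case False
    then have "\<alpha> \<noteq> Poly_Mapping.single N (a + b)"
      by auto
    then show "(if \<alpha> = Poly_Mapping.single N (a + b) then 1 else 0) =
        (if a \<le> Poly_Mapping.lookup \<alpha> N then
          if \<alpha> - Poly_Mapping.single N a = Poly_Mapping.single N b then 1 else 0 else 0 :: rat)"
      using False by simp
  qed
qed

lemma xpow_0: "xpow N 0 = 1"
  by (rule mps_eqI) (simp add: xpow_def mcoeff_one)

lemma keys_diff_single_iff:
  fixes \<alpha> :: "nat \<Rightarrow>\<^sub>0 nat"
  assumes "k \<le> Poly_Mapping.lookup \<alpha> N"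
  shows "Poly_Mapping.keys (\<alpha> - Poly_Mapping.single N k) \<subseteq> {..<N} \<longleftrightarrow>
    Poly_Mapping.keys \<alpha> \<subseteq> {..<Suc N} \<and> Poly_Mapping.lookup \<alpha> N = k"
proof -
  have l: "Poly_Mapping.lookup (\<alpha> - Poly_Mapping.single N k) i =
      (if i = N then Poly_Mapping.lookup \<alpha> N - k else Poly_Mapping.lookup \<alpha> i)" for i
    by (simp add: lookup_minus lookup_single when_def)
  show ?thesis
    unfolding subset_iff in_keys_iff l lessThan_iff less_Suc_eq
  proof (intro iffI conjI allI impI)
    assume a: "\<forall>t. (if t = N then Poly_Mapping.lookup \<alpha> N - k else Poly_Mapping.lookup \<alpha> t) \<noteq> 0 \<longrightarrow> t < N"
    show "Poly_Mapping.lookup \<alpha> N = k"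
      using spec[OF a, of N] assms by simp
    show "t < N \<or> t = N" if "Poly_Mapping.lookup \<alpha> t \<noteq> 0" for t
      using spec[OF a, of t] that by (cases "t = N") simp_all
  next
    fix t assume a: "(\<forall>t. Poly_Mapping.lookup \<alpha> t \<noteq> 0 \<longrightarrow> t < N \<or> t = N) \<and> Poly_Mapping.lookup \<alpha> N = k"
      and b: "(if t = N then Poly_Mapping.lookup \<alpha> N - k else Poly_Mapping.lookup \<alpha> t) \<noteq> 0"
    have "t \<noteq> N"
      using b conjunct2[OF a] by (cases "t = N") simp_all
    then show "t < N"
      using b spec[OF conjunct1[OF a], of t] by simp
  qed
qed

lemma mcoeff_xpow_mult_restricted:
  assumes g: "\<And>\<alpha>. \<not> Poly_Mapping.keys \<alpha> \<subseteq> {..<N} \<Longrightarrow> mcoeff g \<alpha> = 0"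
  shows "mcoeff (xpow N k * g) \<alpha> = (if Poly_Mapping.lookup \<alpha> N = k
    then mcoeff g (\<alpha> - Poly_Mapping.single N (Poly_Mapping.lookup \<alpha> N)) else 0)"
proof (cases "k < Poly_Mapping.lookup \<alpha> N")
  case True
  then have "mcoeff g (\<alpha> - Poly_Mapping.single N k) = 0"
    by (intro g) (simp add: keys_diff_single_iff)
  then show ?thesis
    using True by (simp add: mcoeff_xpow_mult)
next
  case False
  then show ?thesis
    by (auto simp: mcoeff_xpow_mult)
qed

text \<open>The branching rule: the cells with the largest entry \<open>N + 1\<close> form a
  horizontal strip.\<close>

primrec schur_poly :: "nat \<Rightarrow> (nat \<Rightarrow> nat) \<Rightarrow> mps" where
  "schur_poly 0 f = (if f = (\<lambda>_. 0) then 1 else 0)"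
| "schur_poly (Suc N) f = (\<Sum>\<mu> | hstrip \<mu> f. xpow N (psize f - psize \<mu>) * schur_poly N \<mu>)"

primrec complete_poly :: "nat \<Rightarrow> nat \<Rightarrow> mps" where
  "complete_poly 0 n = (if n = 0 then 1 else 0)"
| "complete_poly (Suc N) n = (\<Sum>k\<le>n. xpow N k * complete_poly N (n - k))"

lemma hstrip_psize_le: "hstrip \<mu> \<nu> \<Longrightarrow> psize \<mu> \<le> psize \<nu>"
  by (simp add: hstrip_def psize_mono)

lemma chains_cong: "(\<And>k. k < L \<Longrightarrow> \<alpha> k = \<beta> k) \<Longrightarrow> strip_chains L \<alpha> = strip_chains L \<beta>"
  by (simp add: strip_chains_def)

lemma finite_hstrip_by_below: "finite {\<mu>. hstrip_by n \<mu> \<nu>}"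
  by (rule finite_subset[OF _ finite_hstrip_below[of \<nu>]]) (auto simp: hstrip_by_def)

lemma card_chains_ending_Suc:
  "card {c \<in> strip_chains (Suc N) \<alpha>. c (Suc N) = f} =
     (\<Sum>\<mu> | hstrip_by (\<alpha> N) \<mu> f. card {c \<in> strip_chains N \<alpha>. c N = \<mu>})"
proof -
  have "card {c \<in> strip_chains (Suc N) \<alpha>. c (Suc N) = f} = (\<Sum>c\<in>strip_chains (Suc N) \<alpha>. if c (Suc N) = f then 1 else 0)"
    using finite_chains by (simp add: sum.If_cases Int_def)
  also have "\<dots> = (\<Sum>c\<in>strip_chains N \<alpha>. \<Sum>\<nu> | hstrip_by (\<alpha> N) (c N) \<nu>. if \<nu> = f then 1 else 0)"
    unfolding sum_chains_Suc by simp
  also have "\<dots> = (\<Sum>c\<in>strip_chains N \<alpha>. if hstrip_by (\<alpha> N) (c N) f then 1 else 0)"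
    using finite_hstrip_by_above by (intro sum.cong) (auto simp: sum.delta)
  also have "\<dots> = (\<Sum>c\<in>strip_chains N \<alpha>. \<Sum>\<mu> | hstrip_by (\<alpha> N) \<mu> f. if c N = \<mu> then 1 else 0)"
    using finite_hstrip_by_below by (intro sum.cong) (auto simp: sum.delta)
  also have "\<dots> = (\<Sum>\<mu> | hstrip_by (\<alpha> N) \<mu> f. \<Sum>c\<in>strip_chains N \<alpha>. if c N = \<mu> then 1 else 0)"
    by (rule sum.swap)
  also have "\<dots> = (\<Sum>\<mu> | hstrip_by (\<alpha> N) \<mu> f. card {c \<in> strip_chains N \<alpha>. c N = \<mu>})"
    using finite_chains by (simp add: sum.If_cases Int_def)
  finally show ?thesis .
qed

text \<open>The recursion for \<open>schur_poly\<close> is the one for the number of chains by their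
  last strip.\<close>

lemma mcoeff_schur_poly:
  "mcoeff (schur_poly N f) \<alpha> = (if Poly_Mapping.keys \<alpha> \<subseteq> {..<N}
     then of_nat (card {c \<in> strip_chains N (Poly_Mapping.lookup \<alpha>). c N = f}) else 0)"
proof (induction N arbitrary: f \<alpha>)
  case 0
  have "card {c \<in> {\<lambda>_ _. 0}. c 0 = f} = (if f = (\<lambda>_. 0) then 1 else 0)"
    by (auto simp: Collect_conv_if)
  then show ?case
    unfolding chains_0 by (simp only: schur_poly.simps) (auto simp: mcoeff_one)
next
  case (Suc N)
  let ?a = "Poly_Mapping.lookup \<alpha> N"
  let ?\<alpha> = "\<alpha> - Poly_Mapping.single N ?a"
  have keys: "Poly_Mapping.keys ?\<alpha> \<subseteq> {..<N} \<longleftrightarrow> Poly_Mapping.keys \<alpha> \<subseteq> {..<Suc N}"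
    using keys_diff_single_iff[of ?a \<alpha> N] by simp
  have "mcoeff (schur_poly (Suc N) f) \<alpha> = (\<Sum>\<mu> | hstrip \<mu> f. mcoeff (xpow N (psize f - psize \<mu>) * schur_poly N \<mu>) \<alpha>)"
    by (simp add: mcoeff_sum)
  also have "\<dots> = (\<Sum>\<mu> | hstrip \<mu> f. if ?a = psize f - psize \<mu> then mcoeff (schur_poly N \<mu>) ?\<alpha> else 0)"
    by (rule sum.cong[OF refl], rule mcoeff_xpow_mult_restricted) (simp add: Suc.IH)
  also have "\<dots> = (\<Sum>\<mu> | hstrip_by ?a \<mu> f. mcoeff (schur_poly N \<mu>) ?\<alpha>)"
    by (rule sum.mono_neutral_cong_right) (auto simp: hstrip_by_def finite_hstrip_below dest: hstrip_psize_le)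
  also have "\<dots> = (if Poly_Mapping.keys \<alpha> \<subseteq> {..<Suc N}
     then \<Sum>\<mu> | hstrip_by ?a \<mu> f. of_nat (card {c \<in> strip_chains N (Poly_Mapping.lookup ?\<alpha>). c N = \<mu>}) else 0)"
    unfolding Suc.IH keys by simp
  also have "strip_chains N (Poly_Mapping.lookup ?\<alpha>) = strip_chains N (Poly_Mapping.lookup \<alpha>)"
    by (rule chains_cong) (simp add: lookup_minus lookup_single when_def)
  finally show ?case
    unfolding card_chains_ending_Suc by simp
qed

lemma mcoeff_schur_fun:
  assumes "par f" and \<alpha>: "Poly_Mapping.keys \<alpha> \<subseteq> {..<N}"
  shows "mcoeff (schur_fun f) \<alpha> = mcoeff (schur_poly N f) \<alpha>"
proof -
  let ?a = "Poly_Mapping.lookup \<alpha>"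
  let ?A = "{T. dom T = cells f \<and> semistandard T \<and> (\<forall>i. content T (Suc i) = ?a i)}"
  have a: "(if i < N then ?a i else 0) = ?a i" for i
  proof (cases "i < N")
    case False
    then have "i \<notin> Poly_Mapping.keys \<alpha>" using \<alpha> by auto
    then show ?thesis using False by (simp only: in_keys_iff) simp
  qed simp
  have "T \<in> ?A \<longleftrightarrow> T \<in> tabs N ?a \<and> level T N = f" for T
  proof
    assume T: "T \<in> ?A"
    then have "straight T" "semistandard T" "\<forall>i. content T (Suc i) = ?a i"
      using assms(1) straight_iff by blast+
    then have "T \<in> tabs N ?a"
      unfolding tabs_def a by blast
    moreover have "rows (dom T) = f" using T by simp
    ultimately show "T \<in> tabs N ?a \<and> level T N = f"
      using level_tabs[of T N ?a N] by simp
  next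
    assume T: "T \<in> tabs N ?a \<and> level T N = f"
    then have "dom T = cells f"
      using level_tabs[of T N ?a N] straight_rows(2)[of T] by (simp add: tabs_def)
    then show "T \<in> ?A"
      using T unfolding tabs_def a by blast
  qed
  then have A: "?A = {T \<in> tabs N ?a. level T N = f}"
    by (intro set_eqI) (simp only: mem_Collect_eq)
  have bij: "bij_betw level {T \<in> tabs N ?a. level T N = f} {c \<in> strip_chains N ?a. c N = f}"
  proof (rule bij_betw_subset[OF bij_betw_level])
    show "level ` {T \<in> tabs N ?a. level T N = f} = {c \<in> strip_chains N ?a. c N = f}"
      unfolding bij_betw_imp_surj_on[OF bij_betw_level, symmetric] by blast
  qed blast
  have "card ?A = card {c \<in> strip_chains N ?a. c N = f}"
    unfolding A by (rule bij_betw_same_card[OF bij])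
  then show ?thesis
    using \<alpha> by (simp add: mcoeff_schur_poly schur_fun_def)
qed

lemma mcoeff_complete_poly:
  "mcoeff (complete_poly N n) \<alpha> = (if Poly_Mapping.keys \<alpha> \<subseteq> {..<N} \<and> mdeg \<alpha> = n then 1 else 0)"
proof (induction N arbitrary: n \<alpha>)
  case 0
  then show ?case by (auto simp: mcoeff_one)
next
  case (Suc N)
  let ?a = "Poly_Mapping.lookup \<alpha> N"
  let ?\<alpha> = "\<alpha> - Poly_Mapping.single N ?a"
  have keys: "Poly_Mapping.keys ?\<alpha> \<subseteq> {..<N} \<longleftrightarrow> Poly_Mapping.keys \<alpha> \<subseteq> {..<Suc N}"
    using keys_diff_single_iff[of ?a \<alpha> N] by simp
  have deg: "mdeg \<alpha> = ?a + mdeg ?\<alpha>"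
    using arg_cong[OF add_diff_single[of ?a \<alpha> N], of mdeg] by (simp add: mdeg_add)
  have "mcoeff (complete_poly (Suc N) n) \<alpha> = (\<Sum>k\<le>n. mcoeff (xpow N k * complete_poly N (n - k)) \<alpha>)"
    by (simp add: mcoeff_sum)
  also have "\<dots> = (\<Sum>k\<le>n. if ?a = k then mcoeff (complete_poly N (n - k)) ?\<alpha> else 0)"
    by (rule sum.cong[OF refl], rule mcoeff_xpow_mult_restricted) (simp add: Suc.IH)
  also have "\<dots> = (if ?a \<le> n then mcoeff (complete_poly N (n - ?a)) ?\<alpha> else 0)"
    by (simp add: sum.delta')
  finally show ?case
    unfolding Suc.IH keys deg by auto
qed

lemma finite_keys_bound:
  obtains N where "Poly_Mapping.keys (\<alpha> :: nat \<Rightarrow>\<^sub>0 nat) \<subseteq> {..<N}"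
  using finite_nat_set_iff_bounded[of "Poly_Mapping.keys \<alpha>"] by auto

section \<open>The Pieri rule\<close>

text \<open>For fixed \<open>\<mu>\<close> and \<open>\<kappa>\<close>, the row
  \<open>\<nu>\<^bsub>i+1\<^esub>\<close> of a common upper neighbour and the row
  \<open>\<rho>\<^sub>i\<close> of a common lower neighbour range over the same interval, from the
  maximum of \<open>\<mu>\<^bsub>i+1\<^esub>\<close>, \<open>\<kappa>\<^bsub>i+1\<^esub>\<close> to
  the minimum of \<open>\<mu>\<^sub>i\<close>, \<open>\<kappa>\<^sub>i\<close>. Reversing this
  interval relates upper and lower neighbours; only the excess \<open>k\<close> of
  \<open>\<nu>\<^sub>0\<close> over its least possible value has no counterpart.\<close>

definition reflect :: "(nat \<Rightarrow> nat) \<Rightarrow> (nat \<Rightarrow> nat) \<Rightarrow> (nat \<Rightarrow> nat) \<Rightarrow> nat \<Rightarrow> nat" where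
  "reflect \<mu> \<kappa> \<nu> i = min (\<mu> i) (\<kappa> i) + max (\<mu> (Suc i)) (\<kappa> (Suc i)) - \<nu> (Suc i)"

definition unreflect :: "(nat \<Rightarrow> nat) \<Rightarrow> (nat \<Rightarrow> nat) \<Rightarrow> nat \<Rightarrow> (nat \<Rightarrow> nat) \<Rightarrow> nat \<Rightarrow> nat" where
  "unreflect \<mu> \<kappa> k \<rho> i = (case i of 0 \<Rightarrow> k + max (\<mu> 0) (\<kappa> 0)
     | Suc j \<Rightarrow> min (\<mu> j) (\<kappa> j) + max (\<mu> (Suc j)) (\<kappa> (Suc j)) - \<rho> j)"

lemma hstripI_below:
  assumes "par \<nu>" "\<And>i. \<mu> i \<le> \<nu> i" "\<And>i. \<nu> (Suc i) \<le> \<mu> i"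
  shows "hstrip \<mu> \<nu>"
  using assms par_between[OF assms] by (simp add: hstrip_def)

lemma hstripI_above:
  assumes "par \<mu>" "\<And>i. \<mu> i \<le> \<nu> i" "\<And>i. \<nu> (Suc i) \<le> \<mu> i"
  shows "hstrip \<mu> \<nu>"
proof -
  have "antimono \<nu>"
    by (rule decseq_SucI) (meson assms(2,3) le_trans)
  moreover obtain M where "\<forall>i\<ge>M. \<mu> i = 0"
    using assms(1) by (auto simp: par_def)
  then have "\<nu> i = 0" if "Suc M \<le> i" for i
    using that assms(3)[of "i - 1"] by (cases i) auto
  ultimately have "par \<nu>"
    unfolding par_def by blast
  then show ?thesis
    using assms by (simp add: hstrip_def)
qed

text \<open>Minimum and maximum of two numbers add up to their sum, so the hypotheses telescope to a
  balance of sizes.\<close>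

lemma interlacing_cell_sum:
  assumes "par \<mu>" "par \<kappa>" "par \<nu>" "par \<rho>"
    and "\<And>i. \<nu> (Suc i) + \<rho> i = min (\<mu> i) (\<kappa> i) + max (\<mu> (Suc i)) (\<kappa> (Suc i))"
    and "\<nu> 0 = k + max (\<mu> 0) (\<kappa> 0)"
  shows "psize \<nu> + psize \<rho> = k + psize \<mu> + psize \<kappa>"
proof -
  obtain M where M: "\<And>f i. f \<in> {\<mu>, \<kappa>, \<nu>, \<rho>} \<Longrightarrow> M \<le> i \<Longrightarrow> f i = 0"
    using par_common_bound[of "{\<mu>, \<kappa>, \<nu>, \<rho>}"] assms by auto
  have s: "psize f = sum f {..<Suc M}" "psize f = sum f {..<M}" if "f \<in> {\<mu>, \<kappa>, \<nu>, \<rho>}" for f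
    using M[OF that] by (auto intro!: psize_eq_sum)
  have "psize \<nu> + psize \<rho> = \<nu> 0 + (\<Sum>i<M. \<nu> (Suc i) + \<rho> i)"
    using s(1)[of \<nu>] s(2)[of \<rho>] by (simp add: sum.lessThan_Suc_shift sum.distrib del: sum.lessThan_Suc)
  also have "\<dots> = k + (\<Sum>i<M. min (\<mu> i) (\<kappa> i)) + (\<Sum>i<Suc M. max (\<mu> i) (\<kappa> i))"
    unfolding assms(5,6) by (simp add: sum.lessThan_Suc_shift sum.distrib del: sum.lessThan_Suc)
  also have "(\<Sum>i<Suc M. max (\<mu> i) (\<kappa> i)) = (\<Sum>i<M. max (\<mu> i) (\<kappa> i))"
    using M[of \<mu> M] M[of \<kappa> M] by simp
  also have "k + (\<Sum>i<M. min (\<mu> i) (\<kappa> i)) + (\<Sum>i<M. max (\<mu> i) (\<kappa> i)) = k + (\<Sum>i<M. \<mu> i + \<kappa> i)"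
    by (simp flip: sum.distrib add: min_def max_def) (auto intro!: sum.cong)
  also have "\<dots> = k + psize \<mu> + psize \<kappa>"
    using s(2)[of \<mu>] s(2)[of \<kappa>] by (simp add: sum.distrib)
  finally show ?thesis .
qed

lemma
  assumes "hstrip \<mu> \<nu>" "hstrip \<kappa> \<nu>"
  shows hstrip_reflect: "hstrip (reflect \<mu> \<kappa> \<nu>) \<mu>" "hstrip (reflect \<mu> \<kappa> \<nu>) \<kappa>"
    and unreflect_reflect: "unreflect \<mu> \<kappa> (\<nu> 0 - max (\<mu> 0) (\<kappa> 0)) (reflect \<mu> \<kappa> \<nu>) = \<nu>"
    and psize_reflect: "psize \<nu> + psize (reflect \<mu> \<kappa> \<nu>) =
      (\<nu> 0 - max (\<mu> 0) (\<kappa> 0)) + psize \<mu> + psize \<kappa>"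
proof -
  have b: "max (\<mu> i) (\<kappa> i) \<le> \<nu> i" "\<nu> (Suc i) \<le> min (\<mu> i) (\<kappa> i)" for i
    using assms by (auto simp: hstrip_def)
  have p: "par \<mu>" "par \<kappa>" "par \<nu>"
    using assms by (auto simp: hstrip_def)
  have r: "reflect \<mu> \<kappa> \<nu> i \<le> min (\<mu> i) (\<kappa> i)" "max (\<mu> (Suc i)) (\<kappa> (Suc i)) \<le> reflect \<mu> \<kappa> \<nu> i" for i
    using b(1)[of "Suc i"] b(2)[of i] unfolding reflect_def by linarith+
  show h: "hstrip (reflect \<mu> \<kappa> \<nu>) \<mu>" "hstrip (reflect \<mu> \<kappa> \<nu>) \<kappa>"
    using r p by (auto intro!: hstripI_below)
  show "unreflect \<mu> \<kappa> (\<nu> 0 - max (\<mu> 0) (\<kappa> 0)) (reflect \<mu> \<kappa> \<nu>) = \<nu>"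
  proof
    fix i show "unreflect \<mu> \<kappa> (\<nu> 0 - max (\<mu> 0) (\<kappa> 0)) (reflect \<mu> \<kappa> \<nu>) i = \<nu> i"
    proof (cases i)
      case 0
      then show ?thesis using b(1)[of 0] by (simp add: unreflect_def)
    next
      case (Suc j)
      then show ?thesis
        using b(1)[of "Suc j"] b(2)[of j] unfolding Suc unreflect_def reflect_def nat.case by linarith
    qed
  qed
  show "psize \<nu> + psize (reflect \<mu> \<kappa> \<nu>) = (\<nu> 0 - max (\<mu> 0) (\<kappa> 0)) + psize \<mu> + psize \<kappa>"
  proof (rule interlacing_cell_sum)
    show "par (reflect \<mu> \<kappa> \<nu>)" using h by (simp add: hstrip_def)
    show "\<nu> (Suc i) + reflect \<mu> \<kappa> \<nu> i = min (\<mu> i) (\<kappa> i) + max (\<mu> (Suc i)) (\<kappa> (Suc i))" for i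
      using b(1)[of "Suc i"] b(2)[of i] unfolding reflect_def by linarith
    show "\<nu> 0 = \<nu> 0 - max (\<mu> 0) (\<kappa> 0) + max (\<mu> 0) (\<kappa> 0)"
      using b(1)[of 0] by simp
  qed (use p in auto)
qed

lemma
  assumes "hstrip \<rho> \<mu>" "hstrip \<rho> \<kappa>"
  shows hstrip_unreflect: "hstrip \<mu> (unreflect \<mu> \<kappa> k \<rho>)" "hstrip \<kappa> (unreflect \<mu> \<kappa> k \<rho>)"
    and reflect_unreflect: "reflect \<mu> \<kappa> (unreflect \<mu> \<kappa> k \<rho>) = \<rho>"
    and unreflect_0: "unreflect \<mu> \<kappa> k \<rho> 0 = k + max (\<mu> 0) (\<kappa> 0)"
proof -
  have b: "max (\<mu> (Suc i)) (\<kappa> (Suc i)) \<le> \<rho> i" "\<rho> i \<le> min (\<mu> i) (\<kappa> i)" for i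
    using assms by (auto simp: hstrip_def)
  have p: "par \<mu>" "par \<kappa>"
    using assms by (auto simp: hstrip_def)
  have r: "unreflect \<mu> \<kappa> k \<rho> (Suc i) \<le> min (\<mu> i) (\<kappa> i)"
      "max (\<mu> (Suc i)) (\<kappa> (Suc i)) \<le> unreflect \<mu> \<kappa> k \<rho> (Suc i)" for i
    using b(1)[of i] b(2)[of i] unfolding unreflect_def nat.case by linarith+
  show z: "unreflect \<mu> \<kappa> k \<rho> 0 = k + max (\<mu> 0) (\<kappa> 0)"
    by (simp add: unreflect_def)
  have r': "max (\<mu> i) (\<kappa> i) \<le> unreflect \<mu> \<kappa> k \<rho> i" for i
    using r(2) z by (cases i) auto
  show "hstrip \<mu> (unreflect \<mu> \<kappa> k \<rho>)" "hstrip \<kappa> (unreflect \<mu> \<kappa> k \<rho>)"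
    using r(1) r' p by (auto intro!: hstripI_above)
  show "reflect \<mu> \<kappa> (unreflect \<mu> \<kappa> k \<rho>) = \<rho>"
  proof
    fix i show "reflect \<mu> \<kappa> (unreflect \<mu> \<kappa> k \<rho>) i = \<rho> i"
      using b(1)[of i] b(2)[of i] unfolding unreflect_def reflect_def nat.case by linarith
  qed
qed

lemma psize_eq_imp_eq: "par \<nu> \<Longrightarrow> (\<And>i. \<mu> i \<le> \<nu> i) \<Longrightarrow> psize \<mu> = psize \<nu> \<Longrightarrow> \<mu> = \<nu>"
  using card_subset_eq[OF par_finite_cells[of \<nu>], of "cells \<mu>"]
  by (simp add: psize_def cells_subset_iff cells_inject)

text \<open>By induction on the number of variables. Separating the powers of the last variable
  leaves on one side a removal of a strip followed by an addition, and on the other side an addition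
  followed by a removal. The reflection of interlacing rows exchanges the two, and its free
  parameter \<open>k\<close> accounts for the last variable in the complete homogeneous factor.\<close>

lemma pieri_schur_poly:
  assumes "par \<mu>"
  shows "schur_poly N \<mu> * complete_poly N n = (\<Sum>\<nu> | hstrip_by n \<mu> \<nu>. schur_poly N \<nu>)"
  using assms
proof (induction N arbitrary: \<mu> n)
  case 0
  have "hstrip_by n \<mu> (\<lambda>_. 0) \<longleftrightarrow> \<mu> = (\<lambda>_. 0) \<and> n = 0"
    using psize_eq_0_iff[OF 0] by (auto simp: hstrip_by_def hstrip_def par_zero)
  then show ?case
    using finite_hstrip_by_above[of n \<mu>] by (simp add: sum.delta)
next
  case (Suc N)
  let ?x = "xpow N" and ?s = "schur_poly N"
  let ?A = "SIGMA \<nu>:{\<nu>. hstrip_by n \<mu> \<nu>}. {\<kappa>. hstrip \<kappa> \<nu>}"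
  let ?B = "SIGMA \<rho>:{\<rho>. hstrip \<rho> \<mu>}. SIGMA k:{..n}. {\<kappa>. hstrip_by (n - k) \<rho> \<kappa>}"
  have "schur_poly (Suc N) \<mu> * complete_poly (Suc N) n =
      (\<Sum>\<rho> | hstrip \<rho> \<mu>. \<Sum>k\<le>n. ?x (psize \<mu> - psize \<rho> + k) * (?s \<rho> * complete_poly N (n - k)))"
    unfolding schur_poly.simps complete_poly.simps sum_product
    by (intro sum.cong refl) (simp add: xpow_add ac_simps)
  also have "\<dots> = (\<Sum>\<rho> | hstrip \<rho> \<mu>. \<Sum>k\<le>n. \<Sum>\<kappa> | hstrip_by (n - k) \<rho> \<kappa>. ?x (psize \<mu> - psize \<rho> + k) * ?s \<kappa>)"
  proof (intro sum.cong refl)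
    fix \<rho> k assume "\<rho> \<in> {\<rho>. hstrip \<rho> \<mu>}"
    then have "par \<rho>" by (simp add: hstrip_def)
    from Suc.IH[OF this] show "?x (psize \<mu> - psize \<rho> + k) * (?s \<rho> * complete_poly N (n - k)) =
        (\<Sum>\<kappa> | hstrip_by (n - k) \<rho> \<kappa>. ?x (psize \<mu> - psize \<rho> + k) * ?s \<kappa>)"
      by (simp add: sum_distrib_left)
  qed
  also have "\<dots> = (\<Sum>\<rho> | hstrip \<rho> \<mu>. \<Sum>(k, \<kappa>)\<in>(SIGMA k:{..n}. {\<kappa>. hstrip_by (n - k) \<rho> \<kappa>}). ?x (psize \<mu> - psize \<rho> + k) * ?s \<kappa>)"
    by (intro sum.cong refl sum.Sigma) (simp_all add: finite_hstrip_by_above)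
  also have "\<dots> = (\<Sum>(\<rho>, k, \<kappa>)\<in>?B. ?x (psize \<mu> - psize \<rho> + k) * ?s \<kappa>)"
    by (rule sum.Sigma) (simp_all add: finite_hstrip_by_above finite_hstrip_below)
  also have "\<dots> = (\<Sum>(\<nu>, \<kappa>)\<in>?A. ?x (psize \<nu> - psize \<kappa>) * ?s \<kappa>)"
  proof (rule sum.reindex_bij_witness[of _
        "\<lambda>(\<nu>, \<kappa>). (reflect \<mu> \<kappa> \<nu>, \<nu> 0 - max (\<mu> 0) (\<kappa> 0), \<kappa>)" "\<lambda>(\<rho>, k, \<kappa>). (unreflect \<mu> \<kappa> k \<rho>, \<kappa>)"])
    fix b assume "b \<in> ?B"
    then obtain \<rho> k \<kappa> where b: "b = (\<rho>, k, \<kappa>)" "hstrip \<rho> \<mu>" "k \<le> n" "hstrip \<rho> \<kappa>" "psize \<kappa> = psize \<rho> + (n - k)"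
      by (auto simp: hstrip_by_def)
    note u = hstrip_unreflect[OF b(2,4), of k] reflect_unreflect[OF b(2,4), of k] unreflect_0[OF b(2,4), of k]
    have "psize (unreflect \<mu> \<kappa> k \<rho>) + psize \<rho> = k + psize \<mu> + psize \<kappa>"
      using psize_reflect[OF u(1,2)] by (simp add: u)
    then have sz: "psize (unreflect \<mu> \<kappa> k \<rho>) = psize \<mu> + n"
        "psize (unreflect \<mu> \<kappa> k \<rho>) - psize \<kappa> = psize \<mu> - psize \<rho> + k"
      using b(3,5) hstrip_psize_le[OF b(2)] by auto
    show "(\<lambda>(\<rho>, k, \<kappa>). (unreflect \<mu> \<kappa> k \<rho>, \<kappa>)) b \<in> ?A"
      using u sz by (simp add: b(1) hstrip_by_def)
    show "(\<lambda>(\<nu>, \<kappa>). (reflect \<mu> \<kappa> \<nu>, \<nu> 0 - max (\<mu> 0) (\<kappa> 0), \<kappa>)) ((\<lambda>(\<rho>, k, \<kappa>). (unreflect \<mu> \<kappa> k \<rho>, \<kappa>)) b) = b"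
      using u by (simp add: b(1))
    show "(case (\<lambda>(\<rho>, k, \<kappa>). (unreflect \<mu> \<kappa> k \<rho>, \<kappa>)) b of (\<nu>, \<kappa>) \<Rightarrow> ?x (psize \<nu> - psize \<kappa>) * ?s \<kappa>) =
        (case b of (\<rho>, k, \<kappa>) \<Rightarrow> ?x (psize \<mu> - psize \<rho> + k) * ?s \<kappa>)"
      unfolding b(1) prod.case sz(2) by (rule refl)
  next
    fix a assume "a \<in> ?A"
    then obtain \<nu> \<kappa> where a: "a = (\<nu>, \<kappa>)" "hstrip \<mu> \<nu>" "psize \<nu> = psize \<mu> + n" "hstrip \<kappa> \<nu>"
      by (auto simp: hstrip_by_def)
    note u = hstrip_reflect[OF a(2,4)] unreflect_reflect[OF a(2,4)] psize_reflect[OF a(2,4)]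
    show "(\<lambda>(\<rho>, k, \<kappa>). (unreflect \<mu> \<kappa> k \<rho>, \<kappa>)) ((\<lambda>(\<nu>, \<kappa>). (reflect \<mu> \<kappa> \<nu>, \<nu> 0 - max (\<mu> 0) (\<kappa> 0), \<kappa>)) a) = a"
      using u by (simp add: a(1))
    show "(\<lambda>(\<nu>, \<kappa>). (reflect \<mu> \<kappa> \<nu>, \<nu> 0 - max (\<mu> 0) (\<kappa> 0), \<kappa>)) a \<in> ?B"
      using u(1,2,4) a(3) hstrip_psize_le[OF u(2)] by (simp add: a(1) hstrip_by_def)
  qed
  also have "\<dots> = (\<Sum>\<nu> | hstrip_by n \<mu> \<nu>. \<Sum>\<kappa> | hstrip \<kappa> \<nu>. ?x (psize \<nu> - psize \<kappa>) * ?s \<kappa>)"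
    by (rule sum.Sigma[symmetric]) (simp_all add: finite_hstrip_by_above finite_hstrip_below)
  finally show ?case by simp
qed

text \<open>The coefficient at a monomial only involves finitely many variables.\<close>

lemma pieri:
  assumes "par \<mu>"
  shows "schur_fun \<mu> * hsym n = (\<Sum>\<nu> | hstrip_by n \<mu> \<nu>. schur_fun \<nu>)"
proof (rule mps_eqI)
  fix \<alpha> :: "nat \<Rightarrow>\<^sub>0 nat"
  obtain N where N: "Poly_Mapping.keys \<alpha> \<subseteq> {..<N}"
    using finite_keys_bound[of \<alpha>] by blast
  have sub: "Poly_Mapping.keys \<beta> \<subseteq> {..<N}" "Poly_Mapping.keys \<gamma> \<subseteq> {..<N}" if "(\<beta>, \<gamma>) \<in> splits \<alpha>" for \<beta> \<gamma>
  proof -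
    have "\<alpha> = \<beta> + \<gamma>" using that by (simp add: splits_def)
    then have "Poly_Mapping.keys \<beta> \<subseteq> Poly_Mapping.keys \<alpha>" "Poly_Mapping.keys \<gamma> \<subseteq> Poly_Mapping.keys \<alpha>"
      unfolding subset_iff in_keys_iff by (simp_all add: lookup_add)
    then show "Poly_Mapping.keys \<beta> \<subseteq> {..<N}" "Poly_Mapping.keys \<gamma> \<subseteq> {..<N}"
      using N by blast+
  qed
  have "mcoeff (schur_fun \<mu> * hsym n) \<alpha> = mcoeff (schur_poly N \<mu> * complete_poly N n) \<alpha>"
    unfolding mcoeff_mult
  proof (intro sum.cong refl, clarsimp)
    fix \<beta> \<gamma> assume "(\<beta>, \<gamma>) \<in> splits \<alpha>"
    note s = sub[OF this]
    show "mcoeff (schur_fun \<mu>) \<beta> * mcoeff (hsym n) \<gamma> = mcoeff (schur_poly N \<mu>) \<beta> * mcoeff (complete_poly N n) \<gamma>"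
      using s(2) by (simp add: mcoeff_schur_fun[OF assms s(1)] mcoeff_complete_poly hsym_def)
  qed
  also have "\<dots> = (\<Sum>\<nu> | hstrip_by n \<mu> \<nu>. mcoeff (schur_fun \<nu>) \<alpha>)"
    unfolding pieri_schur_poly[OF assms] mcoeff_sum
    using N by (intro sum.cong refl) (simp add: mcoeff_schur_fun hstrip_by_def hstrip_def)
  finally show "mcoeff (schur_fun \<mu> * hsym n) \<alpha> = mcoeff (\<Sum>\<nu> | hstrip_by n \<mu> \<nu>. schur_fun \<nu>) \<alpha>"
    by (simp add: mcoeff_sum)
qed

lemma schur_fun_zero: "schur_fun (\<lambda>_. 0) = 1"
proof (rule mps_eqI)
  fix \<alpha> :: "nat \<Rightarrow>\<^sub>0 nat"
  obtain N where N: "Poly_Mapping.keys \<alpha> \<subseteq> {..<N}"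
    using finite_keys_bound[of \<alpha>] by blast
  have "schur_poly N (\<lambda>_. 0) = 1"
  proof (induction N)
    case (Suc N)
    have "{\<mu>. hstrip \<mu> (\<lambda>_. 0)} = {\<lambda>_. 0}"
      by (auto simp: hstrip_def par_zero)
    then show ?case using Suc by (simp add: xpow_0)
  qed simp
  then show "mcoeff (schur_fun (\<lambda>_. 0)) \<alpha> = mcoeff 1 \<alpha>"
    by (simp add: mcoeff_schur_fun[OF par_zero N])
qed

section \<open>The dual Pieri rule\<close>

definition vstrip :: "(nat \<Rightarrow> nat) \<Rightarrow> (nat \<Rightarrow> nat) \<Rightarrow> bool" where
  "vstrip \<mu> \<nu> \<longleftrightarrow> par \<mu> \<and> par \<nu> \<and> (\<forall>i. \<mu> i \<le> \<nu> i \<and> \<nu> i \<le> Suc (\<mu> i))"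

definition vstrip_by :: "nat \<Rightarrow> (nat \<Rightarrow> nat) \<Rightarrow> (nat \<Rightarrow> nat) \<Rightarrow> bool" where
  "vstrip_by n \<mu> \<nu> \<longleftrightarrow> vstrip \<mu> \<nu> \<and> psize \<nu> = psize \<mu> + n"

lemma vstrip_psize_le: "vstrip \<mu> \<nu> \<Longrightarrow> psize \<mu> \<le> psize \<nu>"
  by (simp add: vstrip_def psize_mono)

text \<open>Both sides sum over the paths
  \<open>\<mu> \<rightarrow> \<kappa> \<rightarrow> \<nu>\<close> in which \<open>m\<close> cells
  are added, with the parity of the first step as sign; the right-hand side collects them by their
  end.\<close>

lemma two_step_sum:
  fixes F :: "(nat \<Rightarrow> nat) \<Rightarrow> 'b :: comm_ring_1"
  assumes R1: "\<And>\<kappa>. R1 \<kappa> \<Longrightarrow> par \<kappa> \<and> psize \<mu> \<le> psize \<kappa>"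
    and R2: "\<And>\<kappa> \<nu>. R2 \<kappa> \<nu> \<Longrightarrow> par \<nu> \<and> psize \<kappa> \<le> psize \<nu>"
  shows "(\<Sum>i\<le>m. (-1) ^ i * (\<Sum>\<kappa> | R1 \<kappa> \<and> psize \<kappa> = psize \<mu> + i.
        \<Sum>\<nu> | R2 \<kappa> \<nu> \<and> psize \<nu> = psize \<kappa> + (m - i). F \<nu>)) =
    (\<Sum>\<nu> | par \<nu> \<and> psize \<nu> = psize \<mu> + m.
        (\<Sum>\<kappa> | R1 \<kappa> \<and> R2 \<kappa> \<nu>. (-1) ^ (psize \<kappa> - psize \<mu>)) * F \<nu>)"
proof -
  let ?K = "{\<kappa>. R1 \<kappa> \<and> psize \<kappa> \<le> psize \<mu> + m}"
  let ?U = "{\<nu>. par \<nu> \<and> psize \<nu> = psize \<mu> + m}"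
  define G where "G \<kappa> = (\<Sum>\<nu>\<in>?U. if R2 \<kappa> \<nu> then F \<nu> else 0)" for \<kappa>
  have finU: "finite ?U"
    by (rule finite_par_psize)
  have finK: "finite ?K"
  proof (rule finite_subset)
    show "?K \<subseteq> (\<Union>n\<le>psize \<mu> + m. {f. par f \<and> psize f = n})"
    proof
      fix \<kappa> assume "\<kappa> \<in> ?K"
      then show "\<kappa> \<in> (\<Union>n\<le>psize \<mu> + m. {f. par f \<and> psize f = n})"
        using R1[of \<kappa>] by simp
    qed
    show "finite (\<Union>n\<le>psize \<mu> + m. {f. par f \<and> psize f = n})"
      using finite_par_psize by blast
  qed
  have G: "(\<Sum>\<nu> | R2 \<kappa> \<nu> \<and> psize \<nu> = psize \<kappa> + (m - i). F \<nu>) = G \<kappa>"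
    if "psize \<kappa> = psize \<mu> + i" "i \<le> m" for \<kappa> i
  proof -
    have "{\<nu>. R2 \<kappa> \<nu> \<and> psize \<nu> = psize \<kappa> + (m - i)} = {\<nu> \<in> ?U. R2 \<kappa> \<nu>}"
    proof (intro set_eqI)
      fix \<nu> show "\<nu> \<in> {\<nu>. R2 \<kappa> \<nu> \<and> psize \<nu> = psize \<kappa> + (m - i)} \<longleftrightarrow> \<nu> \<in> {\<nu> \<in> ?U. R2 \<kappa> \<nu>}"
        using R2[of \<kappa> \<nu>] that by auto
    qed
    then show ?thesis
      unfolding G_def sum.inter_filter[OF finU, symmetric] by simp
  qed
  have "(\<Sum>i\<le>m. (-1) ^ i * (\<Sum>\<kappa> | R1 \<kappa> \<and> psize \<kappa> = psize \<mu> + i.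
        \<Sum>\<nu> | R2 \<kappa> \<nu> \<and> psize \<nu> = psize \<kappa> + (m - i). F \<nu>)) =
      (\<Sum>i\<le>m. \<Sum>\<kappa>\<in>?K. if psize \<kappa> = psize \<mu> + i then (-1) ^ i * G \<kappa> else 0)"
  proof (rule sum.cong[OF refl])
    fix i assume i: "i \<in> {..m}"
    have "(\<Sum>\<kappa> | R1 \<kappa> \<and> psize \<kappa> = psize \<mu> + i.
        \<Sum>\<nu> | R2 \<kappa> \<nu> \<and> psize \<nu> = psize \<kappa> + (m - i). F \<nu>) =
        (\<Sum>\<kappa> | \<kappa> \<in> ?K \<and> psize \<kappa> = psize \<mu> + i. G \<kappa>)"
    proof (rule sum.cong)
      show "{\<kappa>. R1 \<kappa> \<and> psize \<kappa> = psize \<mu> + i} = {\<kappa>. \<kappa> \<in> ?K \<and> psize \<kappa> = psize \<mu> + i}"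
      proof -
        have "psize \<kappa> \<le> psize \<mu> + m" if "psize \<kappa> = psize \<mu> + i" for \<kappa>
          using that i by simp
        then show ?thesis by blast
      qed
    next
      fix \<kappa> assume "\<kappa> \<in> {\<kappa>. \<kappa> \<in> ?K \<and> psize \<kappa> = psize \<mu> + i}"
      then show "(\<Sum>\<nu> | R2 \<kappa> \<nu> \<and> psize \<nu> = psize \<kappa> + (m - i). F \<nu>) = G \<kappa>"
        using i by (intro G[of \<kappa> i]) simp_all
    qed
    then show "(-1) ^ i * (\<Sum>\<kappa> | R1 \<kappa> \<and> psize \<kappa> = psize \<mu> + i.
        \<Sum>\<nu> | R2 \<kappa> \<nu> \<and> psize \<nu> = psize \<kappa> + (m - i). F \<nu>) = 
        (\<Sum>\<kappa>\<in>?K. if psize \<kappa> = psize \<mu> + i then (-1) ^ i * G \<kappa> else 0)"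
      by (simp only: sum_distrib_left sum.inter_filter[OF finK] if_distrib[of "\<lambda>x. _ * x"] mult_zero_right)
  qed
  also have "\<dots> = (\<Sum>\<kappa>\<in>?K. \<Sum>i\<le>m. if psize \<kappa> = psize \<mu> + i then (-1) ^ i * G \<kappa> else 0)"
    by (rule sum.swap)
  also have "\<dots> = (\<Sum>\<kappa>\<in>?K. (-1) ^ (psize \<kappa> - psize \<mu>) * G \<kappa>)"
  proof (rule sum.cong[OF refl])
    fix \<kappa> assume "\<kappa> \<in> ?K"
    then have k: "psize \<mu> \<le> psize \<kappa>" "psize \<kappa> - psize \<mu> \<le> m"
      using R1 by auto
    then have "(\<Sum>i\<le>m. if psize \<kappa> = psize \<mu> + i then (-1) ^ i * G \<kappa> else 0) =
        (\<Sum>i\<le>m. if psize \<kappa> - psize \<mu> = i then (-1) ^ i * G \<kappa> else 0)"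
      by (intro sum.cong) auto
    also have "\<dots> = (-1) ^ (psize \<kappa> - psize \<mu>) * G \<kappa>"
      using k by (simp add: sum.delta')
    finally show "(\<Sum>i\<le>m. if psize \<kappa> = psize \<mu> + i then (-1) ^ i * G \<kappa> else 0) = (-1) ^ (psize \<kappa> - psize \<mu>) * G \<kappa>" .
  qed
  also have "\<dots> = (\<Sum>\<kappa>\<in>?K. \<Sum>\<nu>\<in>?U. if R2 \<kappa> \<nu> then (-1) ^ (psize \<kappa> - psize \<mu>) * F \<nu> else 0)"
    unfolding G_def sum_distrib_left by (intro sum.cong refl) simp
  also have "\<dots> = (\<Sum>\<nu>\<in>?U. \<Sum>\<kappa>\<in>?K. if R2 \<kappa> \<nu> then (-1) ^ (psize \<kappa> - psize \<mu>) * F \<nu> else 0)"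
    by (rule sum.swap)
  also have "\<dots> = (\<Sum>\<nu>\<in>?U. \<Sum>\<kappa> | R1 \<kappa> \<and> R2 \<kappa> \<nu>. (-1) ^ (psize \<kappa> - psize \<mu>) * F \<nu>)"
  proof (rule sum.cong[OF refl])
    fix \<nu> assume \<nu>: "\<nu> \<in> ?U"
    have "{\<kappa> \<in> ?K. R2 \<kappa> \<nu>} = {\<kappa>. R1 \<kappa> \<and> R2 \<kappa> \<nu>}"
      using \<nu> R2[of _ \<nu>] by fastforce
    then show "(\<Sum>\<kappa>\<in>?K. if R2 \<kappa> \<nu> then (-1) ^ (psize \<kappa> - psize \<mu>) * F \<nu> else 0) =
        (\<Sum>\<kappa> | R1 \<kappa> \<and> R2 \<kappa> \<nu>. (-1) ^ (psize \<kappa> - psize \<mu>) * F \<nu>)"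
      unfolding sum.inter_filter[OF finK, symmetric] by simp
  qed
  finally show ?thesis
    by (simp only: sum_distrib_right)
qed

lemma psize_fun_upd_Suc:
  assumes "par f"
  shows "psize (f(m := Suc (f m))) = Suc (psize f)"
proof -
  have "cells (f(m := Suc (f m))) = insert (m, f m) (cells f)"
    by (auto simp: cells_def split: if_splits)
  then show ?thesis
    using par_finite_cells[OF assms] by (simp add: psize_def)
qed

text \<open>Let \<open>m\<close> be the topmost row in which \<open>\<mu>\<close> and
  \<open>\<nu>\<close> differ. The last cell of \<open>\<nu>\<close> in this row may be added in the
  first step or in the second, regardless of all other cells: for the first step it matters that it
  does not lie below an added cell, which holds since
  \<open>\<nu>\<^sub>m \<le> \<nu>\<^bsub>m-1\<^esub> = \<mu>\<^bsub>m-1\<^esub>\<close>. Changing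
  this choice reverses the sign.\<close>

lemma hstrip_vstrip_cancel:
  assumes "par \<mu>" "\<mu> \<noteq> \<nu>"
  shows "(\<Sum>\<kappa> | hstrip \<mu> \<kappa> \<and> vstrip \<kappa> \<nu>. (-1) ^ (psize \<kappa> - psize \<mu>)) = (0 :: int)"
proof (cases "\<exists>\<kappa>. hstrip \<mu> \<kappa> \<and> vstrip \<kappa> \<nu>")
  case False
  then have "{\<kappa>. hstrip \<mu> \<kappa> \<and> vstrip \<kappa> \<nu>} = {}" by blast
  then show ?thesis by (simp only: sum.empty)
next
  case True
  then have le: "\<mu> i \<le> \<nu> i" and par\<nu>: "par \<nu>" for i
    by (auto simp: hstrip_def vstrip_def intro: le_trans)
  with assms(2) have ex: "\<exists>i. \<mu> i < \<nu> i"
    by (metis ext le_eq_less_or_eq)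
  define m where "m = (LEAST i. \<mu> i < \<nu> i)"
  have m: "\<mu> m < \<nu> m"
    unfolding m_def by (rule LeastI_ex[OF ex])
  have below: "\<nu> i = \<mu> i" if "i < m" for i
    using not_less_Least[of i "\<lambda>i. \<mu> i < \<nu> i"] that le[of i] unfolding m_def by simp
  define h where "h \<kappa> = \<kappa>(m := if \<kappa> m = \<nu> m then \<nu> m - 1 else \<nu> m)" for \<kappa> :: "nat \<Rightarrow> nat"
  have *: "(hstrip \<mu> (h \<kappa>) \<and> vstrip (h \<kappa>) \<nu>) \<and> h (h \<kappa>) = \<kappa> \<and>
      (-1) ^ (psize (h \<kappa>) - psize \<mu>) = - ((-1) ^ (psize \<kappa> - psize \<mu>) :: int)"
    if \<kappa>: "hstrip \<mu> \<kappa> \<and> vstrip \<kappa> \<nu>" for \<kappa>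
  proof -
    have k: "\<mu> i \<le> \<kappa> i" "\<kappa> (Suc i) \<le> \<mu> i" "\<kappa> i \<le> \<nu> i" "\<nu> i \<le> Suc (\<kappa> i)" for i
      using \<kappa> by (auto simp: hstrip_def vstrip_def)
    have km: "\<kappa> m = \<nu> m \<or> \<kappa> m = \<nu> m - 1"
      using k(3,4)[of m] by linarith
    have hk: "\<mu> i \<le> h \<kappa> i" "h \<kappa> i \<le> \<nu> i" "\<nu> i \<le> Suc (h \<kappa> i)" for i
      using k[of i] m by (auto simp: h_def)
    have hk2: "h \<kappa> (Suc i) \<le> \<mu> i" for i
    proof (cases "Suc i = m")
      case True
      have "h \<kappa> (Suc i) \<le> \<nu> (Suc i)" by (rule hk(2))
      also have "\<dots> \<le> \<nu> i" using par_antimono[OF par\<nu>, of i "Suc i"] by simp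
      also have "\<dots> = \<mu> i" using below[of i] True by simp
      finally show ?thesis .
    next
      case False
      then show ?thesis using k(2)[of i] by (simp add: h_def)
    qed
    have strip: "hstrip \<mu> (h \<kappa>)"
      using assms(1) hk(1) hk2 by (rule hstripI_above)
    then have "vstrip (h \<kappa>) \<nu>"
      using par\<nu> hk by (simp add: vstrip_def hstrip_def)
    moreover have "h (h \<kappa>) = \<kappa>"
      using km m by (auto simp: h_def fun_eq_iff)
    moreover have "(-1) ^ (psize (h \<kappa>) - psize \<mu>) = - ((-1) ^ (psize \<kappa> - psize \<mu>) :: int)"
    proof (cases "\<kappa> m = \<nu> m")
      case True
      have "\<kappa> = (h \<kappa>)(m := Suc (h \<kappa> m))"
        using True m by (auto simp: h_def fun_eq_iff)
      then have "psize \<kappa> = Suc (psize (h \<kappa>))"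
        using psize_fun_upd_Suc[of "h \<kappa>" m] strip by (simp add: hstrip_def)
      then show ?thesis
        using hstrip_psize_le[OF strip] by (simp add: Suc_diff_le)
    next
      case False
      have "h \<kappa> = \<kappa>(m := Suc (\<kappa> m))"
        using False km m by (auto simp: h_def fun_eq_iff)
      then have "psize (h \<kappa>) = Suc (psize \<kappa>)"
        using psize_fun_upd_Suc[of \<kappa> m] \<kappa> by (simp add: hstrip_def)
      then show ?thesis
        using hstrip_psize_le[of \<mu> \<kappa>] \<kappa> by (simp add: Suc_diff_le)
    qed
    ultimately show ?thesis using strip by blast
  qed
  show ?thesis
    by (rule sum_sign_reversing_involution[where h = h]) (use * in \<open>simp_all only: mem_Collect_eq\<close>)
qed

lemma esym_0: "esym 0 = 1"
  by (rule mps_eqI) (auto simp: esym_def mcoeff_one mdeg_eq_0_iff)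

lemma hsym_0: "hsym 0 = 1"
  by (rule mps_eqI) (auto simp: hsym_def mcoeff_one mdeg_eq_0_iff)

lemma alternating_hsym_esym:
  assumes "0 < n"
  shows "(\<Sum>i\<le>n. (-1) ^ i * (hsym i * esym (n - i))) = 0"
proof -
  have "alternate (1 :: mps fps) = 1"
    by (rule fps_ext) (simp add: alternate_nth)
  then have "alternate hgen * egen = 1"
    using arg_cong[OF hgen_mult_alternate_egen, of alternate] by (simp add: alternate_mult alternate_alternate)
  from arg_cong[OF this, of "\<lambda>f. fps_nth f n"] show ?thesis
    using assms by (simp add: fps_mult_nth alternate_nth hgen_def egen_def atMost_atLeast0 mult.assoc)
qed

text \<open>By induction on \<open>n\<close>, solving the relation between the
  \<open>h\<^sub>i\<close> and the \<open>e\<^bsub>n-i\<^esub>\<close> for \<open>e\<^sub>n\<close>.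
  In the other terms the Pieri rule and the induction hypothesis add a horizontal and then a
  vertical strip; the signed sum of all these paths vanishes, and so the missing paths, those with
  empty horizontal strip, give the product with \<open>e\<^sub>n\<close>.\<close>

lemma dual_pieri:
  assumes "par \<mu>"
  shows "schur_fun \<mu> * esym n = (\<Sum>\<nu> | vstrip_by n \<mu> \<nu>. schur_fun \<nu>)"
  using assms
proof (induction n arbitrary: \<mu> rule: less_induct)
  case (less n)
  show ?case
  proof (cases "n = 0")
    case True
    have "{\<nu>. vstrip_by 0 \<mu> \<nu>} = {\<mu>}"
    proof -
      have "vstrip_by 0 \<mu> \<mu>"
        using less.prems by (simp add: vstrip_by_def vstrip_def)
      moreover have "\<nu> = \<mu>" if "vstrip_by 0 \<mu> \<nu>" for \<nu>
        using that psize_eq_imp_eq[of \<nu> \<mu>] by (auto simp: vstrip_by_def vstrip_def)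
      ultimately show ?thesis by blast
    qed
    then show ?thesis
      using True by (simp add: esym_0)
  next
    case False
    define T where "T i = (-1) ^ i * (\<Sum>\<kappa> | hstrip_by i \<mu> \<kappa>. \<Sum>\<nu> | vstrip_by (n - i) \<kappa> \<nu>. schur_fun \<nu>)" for i
    have "(\<Sum>i\<le>n. T i) = (\<Sum>\<nu> | par \<nu> \<and> psize \<nu> = psize \<mu> + n.
        (\<Sum>\<kappa> | hstrip \<mu> \<kappa> \<and> vstrip \<kappa> \<nu>. (-1) ^ (psize \<kappa> - psize \<mu>)) * schur_fun \<nu>)"
      unfolding T_def hstrip_by_def vstrip_by_def
      by (rule two_step_sum) (auto simp: hstrip_psize_le vstrip_psize_le, auto simp: hstrip_def vstrip_def)
    also have "\<dots> = 0"
    proof (rule sum.neutral, rule ballI)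
      fix \<nu> assume "\<nu> \<in> {\<nu>. par \<nu> \<and> psize \<nu> = psize \<mu> + n}"
      then have "\<mu> \<noteq> \<nu>" using False by auto
      from hstrip_vstrip_cancel[OF less.prems this]
      have "(\<Sum>\<kappa> | hstrip \<mu> \<kappa> \<and> vstrip \<kappa> \<nu>. (-1) ^ (psize \<kappa> - psize \<mu>)) = (0 :: mps)"
        by (auto dest!: arg_cong[where f = "of_int :: int \<Rightarrow> mps"])
      then show "(\<Sum>\<kappa> | hstrip \<mu> \<kappa> \<and> vstrip \<kappa> \<nu>. (-1) ^ (psize \<kappa> - psize \<mu>)) * schur_fun \<nu> = 0"
        by simp
    qed
    finally have T: "(\<Sum>i\<in>{1..n}. T i) = - T 0"
      by (simp add: atMost_atLeast0 sum.atLeast_Suc_atMost eq_neg_iff_add_eq_0 add.commute)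
    have step: "(-1) ^ i * (schur_fun \<mu> * (hsym i * esym (n - i))) = T i" if "i \<in> {1..n}" for i
    proof -
      have "schur_fun \<mu> * (hsym i * esym (n - i)) = (\<Sum>\<kappa> | hstrip_by i \<mu> \<kappa>. schur_fun \<kappa>) * esym (n - i)"
        by (simp add: mult.assoc[symmetric] pieri[OF less.prems])
      also have "\<dots> = (\<Sum>\<kappa> | hstrip_by i \<mu> \<kappa>. schur_fun \<kappa> * esym (n - i))"
        by (rule sum_distrib_right)
      also have "\<dots> = (\<Sum>\<kappa> | hstrip_by i \<mu> \<kappa>. \<Sum>\<nu> | vstrip_by (n - i) \<kappa> \<nu>. schur_fun \<nu>)"
        using that False by (intro sum.cong refl less.IH) (auto simp: hstrip_by_def hstrip_def)
      finally show ?thesis by (simp add: T_def)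
    qed
    have "0 = schur_fun \<mu> * (\<Sum>i\<le>n. (-1) ^ i * (hsym i * esym (n - i)))"
      using False by (simp add: alternating_hsym_esym)
    also have "\<dots> = (\<Sum>i\<le>n. (-1) ^ i * (schur_fun \<mu> * (hsym i * esym (n - i))))"
      by (simp add: sum_distrib_left mult.left_commute)
    also have "\<dots> = schur_fun \<mu> * esym n + (\<Sum>i\<in>{1..n}. (-1) ^ i * (schur_fun \<mu> * (hsym i * esym (n - i))))"
      by (simp add: atMost_atLeast0 sum.atLeast_Suc_atMost hsym_0)
    also have "\<dots> = schur_fun \<mu> * esym n + (\<Sum>i\<in>{1..n}. T i)"
      by (simp only: step cong: sum.cong)
    finally have T0: "schur_fun \<mu> * esym n = T 0"
      unfolding T by simp
    have "{\<kappa>. hstrip_by 0 \<mu> \<kappa>} = {\<mu>}"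
    proof -
      have "hstrip_by 0 \<mu> \<mu>"
        using less.prems par_antimono[OF less.prems] by (simp add: hstrip_by_def hstrip_def)
      moreover have "\<kappa> = \<mu>" if "hstrip_by 0 \<mu> \<kappa>" for \<kappa>
        using that psize_eq_imp_eq[of \<kappa> \<mu>] by (auto simp: hstrip_by_def hstrip_def)
      ultimately show ?thesis by blast
    qed
    then have "T 0 = (\<Sum>\<nu> | vstrip_by n \<mu> \<nu>. schur_fun \<nu>)"
      by (simp add: T_def)
    with T0 show ?thesis by simp
  qed
qed

section \<open>Conjugate partitions\<close>

definition conj_par :: "(nat \<Rightarrow> nat) \<Rightarrow> nat \<Rightarrow> nat" where
  "conj_par f = rows (prod.swap ` cells f)"

lemma
  assumes "par f"
  shows par_conj_par: "par (conj_par f)" and cells_conj_par: "cells (conj_par f) = prod.swap ` cells f"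
proof -
  have "(r', c') \<in> prod.swap ` cells f" if "(r, c) \<in> prod.swap ` cells f" "r' \<le> r" "c' \<le> c" for r c r' c'
  proof -
    have "r < f c" using that(1) by auto
    then have "r' < f c'" using that(2) par_antimono[OF assms that(3)] by simp
    then show ?thesis by force
  qed
  with par_rows[of "prod.swap ` cells f"] par_finite_cells[OF assms]
  show "par (conj_par f)" "cells (conj_par f) = prod.swap ` cells f"
    unfolding conj_par_def by blast+
qed

lemma conj_par_less_iff: "par f \<Longrightarrow> c < conj_par f r \<longleftrightarrow> r < f c"
  using cells_conj_par[of f] mem_cells[of r c "conj_par f"] by force

lemma conj_par_conj_par: "par f \<Longrightarrow> conj_par (conj_par f) = f"
  by (simp add: conj_par_def[of "conj_par f"] cells_conj_par image_image)

lemma psize_conj_par: "par f \<Longrightarrow> psize (conj_par f) = psize f"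
  by (simp add: psize_def cells_conj_par card_image)

lemma vstrip_by_conj_par_iff:
  assumes "par \<mu>" "par \<nu>"
  shows "vstrip_by n (conj_par \<mu>) (conj_par \<nu>) \<longleftrightarrow> hstrip_by n \<mu> \<nu>"
proof -
  have "(\<forall>i. conj_par \<mu> i \<le> conj_par \<nu> i) \<longleftrightarrow> (\<forall>i. \<mu> i \<le> \<nu> i)"
    by (simp flip: cells_subset_iff add: cells_conj_par assms inj_image_subset_iff)
  moreover have "(\<forall>c. conj_par \<nu> c \<le> Suc (conj_par \<mu> c)) \<longleftrightarrow> (\<forall>i. \<nu> (Suc i) \<le> \<mu> i)"
  proof (intro iffI allI)
    fix i assume a: "\<forall>c. conj_par \<nu> c \<le> Suc (conj_par \<mu> c)"
    show "\<nu> (Suc i) \<le> \<mu> i"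
    proof (rule ccontr)
      assume "\<not> \<nu> (Suc i) \<le> \<mu> i"
      then have "Suc i < conj_par \<nu> (\<mu> i)"
        by (simp add: conj_par_less_iff assms)
      then have "i < conj_par \<mu> (\<mu> i)"
        using spec[OF a, of "\<mu> i"] by linarith
      then show False by (simp add: conj_par_less_iff assms)
    qed
  next
    fix c assume a: "\<forall>i. \<nu> (Suc i) \<le> \<mu> i"
    show "conj_par \<nu> c \<le> Suc (conj_par \<mu> c)"
    proof (rule ccontr)
      assume "\<not> conj_par \<nu> c \<le> Suc (conj_par \<mu> c)"
      then have "c < \<nu> (Suc (conj_par \<mu> c))"
        by (simp flip: conj_par_less_iff[OF assms(2)])
      then have "c < \<mu> (conj_par \<mu> c)"
        using spec[OF a, of "conj_par \<mu> c"] by linarith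
      then show False by (simp flip: conj_par_less_iff[OF assms(1)])
    qed
  qed
  ultimately show ?thesis
    using assms par_conj_par psize_conj_par by (auto simp: vstrip_by_def vstrip_def hstrip_by_def hstrip_def)
qed

lemma dual_pieri_conjugate:
  assumes "par \<mu>"
  shows "schur_fun (conj_par \<mu>) * esym n = (\<Sum>\<nu> | hstrip_by n \<mu> \<nu>. schur_fun (conj_par \<nu>))"
proof -
  have "(\<Sum>\<nu> | vstrip_by n (conj_par \<mu>) \<nu>. schur_fun \<nu>) = (\<Sum>\<nu> | hstrip_by n \<mu> \<nu>. schur_fun (conj_par \<nu>))"
  proof (rule sum.reindex_bij_witness[of _ conj_par conj_par])
    fix \<nu> assume "\<nu> \<in> {\<nu>. vstrip_by n (conj_par \<mu>) \<nu>}"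
    then have v: "vstrip_by n (conj_par \<mu>) \<nu>" "par \<nu>" by (auto simp: vstrip_by_def vstrip_def)
    then show "conj_par (conj_par \<nu>) = \<nu>" "schur_fun (conj_par (conj_par \<nu>)) = schur_fun \<nu>"
      by (simp_all add: conj_par_conj_par)
    show "conj_par \<nu> \<in> {\<nu>. hstrip_by n \<mu> \<nu>}"
      using v vstrip_by_conj_par_iff[OF assms par_conj_par[OF v(2)], of n] by (simp add: conj_par_conj_par)
  next
    fix \<nu> assume "\<nu> \<in> {\<nu>. hstrip_by n \<mu> \<nu>}"
    then have v: "hstrip_by n \<mu> \<nu>" "par \<nu>" by (auto simp: hstrip_by_def hstrip_def)
    then show "conj_par (conj_par \<nu>) = \<nu>" by (simp add: conj_par_conj_par)
    show "conj_par \<nu> \<in> {\<nu>. vstrip_by n (conj_par \<mu>) \<nu>}"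
      using v vstrip_by_conj_par_iff[OF assms v(2)] by simp
  qed
  then show ?thesis
    by (simp add: dual_pieri par_conj_par assms)
qed

section \<open>Bracketed pairs in fillings with two letters\<close>

text \<open>Let \<open>A\<close> be the cells with the smaller and \<open>B\<close> the cells with
  the larger of two letters. Read the rows from bottom to top, each from left to right, and take the
  larger letter as an opening and the smaller one as a closing bracket. The number of matched pairs
  is the number of closing brackets minus the largest excess of closing over opening brackets in an
  initial part of the word. This excess is largest after the smaller letters of some row
  \<open>r\<close>, or for the empty initial part, and thus the number of pairs is the minimum of
  \<open>stat A B\<close>.\<close>

definition stat :: "cell set \<Rightarrow> cell set \<Rightarrow> nat \<Rightarrow> nat" where
  "stat A B r = card {p \<in> A. fst p < r} + card {p \<in> B. r < fst p}"

definition bracket :: "cell set \<Rightarrow> cell set \<Rightarrow> nat" where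
  "bracket A B = (INF r. stat A B r)"

lemma bracket_le: "bracket A B \<le> stat A B r"
  unfolding bracket_def by (rule cINF_lower) auto

lemma bracket_attained: "\<exists>r. stat A B r = bracket A B"
proof -
  have "bracket A B \<in> range (stat A B)"
    unfolding bracket_def by (rule Inf_nat_def1) simp
  then show ?thesis by auto
qed

lemma bracket_eqI:
  assumes "\<And>r. j \<le> stat A B r" "stat A B m = j"
  shows "bracket A B = j"
  using bracket_le[of A B m] bracket_attained[of A B] assms by (metis le_antisym)

lemma stat_0:
  assumes "finite B"
  shows "stat A B 0 + card {p \<in> B. fst p = 0} = card B"
proof -
  have "B = {p \<in> B. 0 < fst p} \<union> {p \<in> B. fst p = 0}" by auto
  then have "card B = card ({p \<in> B. 0 < fst p} \<union> {p \<in> B. fst p = 0})" by simp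
  also have "\<dots> = card {p \<in> B. 0 < fst p} + card {p \<in> B. fst p = 0}"
    using assms by (intro card_Un_disjoint) auto
  finally show ?thesis by (simp add: stat_def)
qed

lemma stat_Suc:
  assumes "finite A" "finite B"
  shows "stat A B (Suc r) + card {p \<in> B. fst p = Suc r} = stat A B r + card {p \<in> A. fst p = r}"
proof -
  have "{p \<in> B. r < fst p} = {p \<in> B. Suc r < fst p} \<union> {p \<in> B. fst p = Suc r}"
    "{p \<in> A. fst p < Suc r} = {p \<in> A. fst p < r} \<union> {p \<in> A. fst p = r}" by auto
  then have "card {p \<in> B. r < fst p} = card ({p \<in> B. Suc r < fst p} \<union> {p \<in> B. fst p = Suc r})"
    "card {p \<in> A. fst p < Suc r} = card ({p \<in> A. fst p < r} \<union> {p \<in> A. fst p = r})" by simp_all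
  moreover have "card ({p \<in> B. Suc r < fst p} \<union> {p \<in> B. fst p = Suc r}) =
      card {p \<in> B. Suc r < fst p} + card {p \<in> B. fst p = Suc r}"
    using assms by (intro card_Un_disjoint) auto
  moreover have "card ({p \<in> A. fst p < r} \<union> {p \<in> A. fst p = r}) =
      card {p \<in> A. fst p < r} + card {p \<in> A. fst p = r}"
    using assms by (intro card_Un_disjoint) auto
  ultimately show ?thesis by (simp add: stat_def)
qed

lemma bracket_le_card:
  assumes "finite A" "finite B"
  shows "bracket A B \<le> card A" "bracket A B \<le> card B"
proof -
  show "bracket A B \<le> card B"
    using stat_0[OF assms(2), of A] bracket_le[of A B 0] by linarith
  obtain M where M: "\<forall>r\<in>fst ` B. r < M"
    using finite_nat_set_iff_bounded[of "fst ` B"] assms by auto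
  then have e: "{p \<in> B. M < fst p} = {}" by force
  have "stat A B M = card {p \<in> A. fst p < M}" unfolding stat_def e by simp
  also have "\<dots> \<le> card A" using assms by (intro card_mono) auto
  finally show "bracket A B \<le> card A"
    using bracket_le[of A B M] by linarith
qed

section \<open>Strings of two-letter fillings of a skew shape\<close>

definition cstat :: "(nat \<Rightarrow> nat) \<Rightarrow> (nat \<Rightarrow> nat) \<Rightarrow> (nat \<Rightarrow> nat) \<Rightarrow> nat \<Rightarrow> nat" where
  "cstat \<mu> \<nu> \<kappa> = stat (cells \<kappa> - cells \<mu>) (cells \<nu> - cells \<kappa>)"

definition cbracket :: "(nat \<Rightarrow> nat) \<Rightarrow> (nat \<Rightarrow> nat) \<Rightarrow> (nat \<Rightarrow> nat) \<Rightarrow> nat" where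
  "cbracket \<mu> \<nu> \<kappa> = bracket (cells \<kappa> - cells \<mu>) (cells \<nu> - cells \<kappa>)"

definition strips_between :: "(nat \<Rightarrow> nat) \<Rightarrow> (nat \<Rightarrow> nat) \<Rightarrow> (nat \<Rightarrow> nat) set" where
  "strips_between \<mu> \<nu> = {\<kappa>. hstrip \<mu> \<kappa> \<and> hstrip \<kappa> \<nu>}"

lemma card_cells_row: "card {p \<in> cells g - cells f. fst p = r} = g r - f r"
proof -
  have "{p \<in> cells g - cells f. fst p = r} = Pair r ` {f r..<g r}"
    by (auto simp: cells_def)
  then show ?thesis
    by (simp add: card_image inj_on_def)
qed

lemma strips_betweenD:
  assumes "\<kappa> \<in> strips_between \<mu> \<nu>"
  shows "par \<mu>" "par \<kappa>" "par \<nu>" "\<mu> i \<le> \<kappa> i" "\<kappa> i \<le> \<nu> i" "\<kappa> (Suc i) \<le> \<mu> i" "\<nu> (Suc i) \<le> \<kappa> i"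
  using assms by (auto simp: strips_between_def hstrip_def)

lemma strips_betweenI:
  assumes "par \<mu>" "par \<nu>" "\<And>i. \<mu> i \<le> \<kappa> i" "\<And>i. \<kappa> i \<le> \<nu> i" "\<And>i. \<kappa> (Suc i) \<le> \<mu> i" "\<And>i. \<nu> (Suc i) \<le> \<kappa> i"
  shows "\<kappa> \<in> strips_between \<mu> \<nu>"
  using assms by (auto simp: strips_between_def intro!: hstripI_above[of \<mu> \<kappa>] hstripI_below[of \<nu> \<kappa>])

lemma card_skew: "par \<kappa> \<Longrightarrow> (\<And>i. \<mu> i \<le> \<kappa> i) \<Longrightarrow> card (cells \<kappa> - cells \<mu>) = psize \<kappa> - psize \<mu>"
  using finite_subset[OF _ par_finite_cells[of \<kappa>], of "cells \<mu>"]
  by (simp add: card_Diff_subset cells_subset_iff psize_def)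

lemma
  assumes "\<kappa> \<in> strips_between \<mu> \<nu>"
  shows cstat_0: "cstat \<mu> \<nu> \<kappa> 0 + (\<nu> 0 - \<kappa> 0) = psize \<nu> - psize \<kappa>"
    and cstat_Suc: "cstat \<mu> \<nu> \<kappa> (Suc r) + (\<nu> (Suc r) - \<kappa> (Suc r)) = cstat \<mu> \<nu> \<kappa> r + (\<kappa> r - \<mu> r)"
    and cbracket_le_sizes: "cbracket \<mu> \<nu> \<kappa> \<le> psize \<kappa> - psize \<mu>" "cbracket \<mu> \<nu> \<kappa> \<le> psize \<nu> - psize \<kappa>"
proof -
  note b = strips_betweenD[OF assms]
  have fin: "finite (cells \<kappa> - cells \<mu>)" "finite (cells \<nu> - cells \<kappa>)"
    using b(2,3) par_finite_cells by auto
  show "cstat \<mu> \<nu> \<kappa> 0 + (\<nu> 0 - \<kappa> 0) = psize \<nu> - psize \<kappa>"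
    using stat_0[OF fin(2), of "cells \<kappa> - cells \<mu>"]
    unfolding cstat_def card_cells_row card_skew[OF b(3,5)] .
  show "cstat \<mu> \<nu> \<kappa> (Suc r) + (\<nu> (Suc r) - \<kappa> (Suc r)) = cstat \<mu> \<nu> \<kappa> r + (\<kappa> r - \<mu> r)"
    using stat_Suc[OF fin, of r] unfolding cstat_def card_cells_row .
  show "cbracket \<mu> \<nu> \<kappa> \<le> psize \<kappa> - psize \<mu>" "cbracket \<mu> \<nu> \<kappa> \<le> psize \<nu> - psize \<kappa>"
    using bracket_le_card[OF fin] b by (simp_all add: cbracket_def card_skew)
qed

lemma strips_between_psize:
  assumes "\<kappa> \<in> strips_between \<mu> \<nu>"
  shows "psize \<mu> \<le> psize \<kappa>" "psize \<kappa> \<le> psize \<nu>"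
  using assms by (auto simp: strips_between_def hstrip_psize_le)

text \<open>Enlarging \<open>\<kappa>\<close> by a cell in row \<open>m\<close> turns a larger
  letter in that row into a smaller one.\<close>

lemma cstat_shift:
  assumes k: "\<kappa> \<in> strips_between \<mu> \<nu>" and k': "\<kappa>' \<in> strips_between \<mu> \<nu>" and eq: "\<kappa>' = \<kappa>(m := Suc (\<kappa> m))"
  shows "int (cstat \<mu> \<nu> \<kappa>' r) =
    int (cstat \<mu> \<nu> \<kappa> r) + (if m < r then 1 else 0) - (if r < m then 1 else 0)"
proof (induction r)
  have ps: "psize \<kappa>' = Suc (psize \<kappa>)"
    unfolding eq using strips_betweenD(2)[OF k] by (rule psize_fun_upd_Suc)
  have le: "\<kappa> i \<le> \<nu> i" "\<kappa>' i \<le> \<nu> i" "\<mu> i \<le> \<kappa> i" "\<mu> i \<le> \<kappa>' i" for i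
    using strips_betweenD(4,5)[OF k, of i] strips_betweenD(4,5)[OF k', of i] by auto
  have eq': "int (\<kappa>' i) = int (\<kappa> i) + (if i = m then 1 else 0)" for i
    by (simp add: eq)
  {
    case 0
    have "int (cstat \<mu> \<nu> \<kappa> 0) = int (psize \<nu>) - int (psize \<kappa>) - (int (\<nu> 0) - int (\<kappa> 0))"
      using cstat_0[OF k] strips_between_psize[OF k] le[of 0] by linarith
    moreover have "int (cstat \<mu> \<nu> \<kappa>' 0) = int (psize \<nu>) - int (psize \<kappa>') - (int (\<nu> 0) - int (\<kappa>' 0))"
      using cstat_0[OF k'] strips_between_psize[OF k'] le[of 0] by linarith
    ultimately show ?case
      using ps eq'[of 0] by (cases "m = 0") simp_all
  next
    case (Suc r)
    have "int (cstat \<mu> \<nu> \<kappa> (Suc r)) = int (cstat \<mu> \<nu> \<kappa> r) + (int (\<kappa> r) - int (\<mu> r)) - (int (\<nu> (Suc r)) - int (\<kappa> (Suc r)))"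
      using cstat_Suc[OF k, of r] le[of r] le[of "Suc r"] by linarith
    moreover have "int (cstat \<mu> \<nu> \<kappa>' (Suc r)) = int (cstat \<mu> \<nu> \<kappa>' r) + (int (\<kappa>' r) - int (\<mu> r)) - (int (\<nu> (Suc r)) - int (\<kappa>' (Suc r)))"
      using cstat_Suc[OF k', of r] le[of r] le[of "Suc r"] by linarith
    ultimately show ?case
      using Suc.IH eq'[of r] eq'[of "Suc r"] by (auto split: if_splits)
  }
qed

definition level_set :: "(nat \<Rightarrow> nat) \<Rightarrow> (nat \<Rightarrow> nat) \<Rightarrow> nat \<Rightarrow> nat \<Rightarrow> (nat \<Rightarrow> nat) set" where
  "level_set \<mu> \<nu> a j = {\<kappa> \<in> strips_between \<mu> \<nu>. psize \<kappa> = psize \<mu> + a \<and> cbracket \<mu> \<nu> \<kappa> = j}"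

text \<open>The lowering and raising operators of an \<open>sl\<^sub>2\<close>-crystal:
  \<open>raise_strip\<close> replaces an unmatched larger letter by a smaller one, in the topmost
  row where the minimum of the statistic is attained; \<open>lower_strip\<close> undoes this in the
  bottommost such row.\<close>

definition raise_strip :: "(nat \<Rightarrow> nat) \<Rightarrow> (nat \<Rightarrow> nat) \<Rightarrow> (nat \<Rightarrow> nat) \<Rightarrow> nat \<Rightarrow> nat" where
  "raise_strip \<mu> \<nu> \<kappa> = (let m = (LEAST r. cstat \<mu> \<nu> \<kappa> r = cbracket \<mu> \<nu> \<kappa>) in \<kappa>(m := Suc (\<kappa> m)))"

definition lower_strip :: "(nat \<Rightarrow> nat) \<Rightarrow> (nat \<Rightarrow> nat) \<Rightarrow> (nat \<Rightarrow> nat) \<Rightarrow> nat \<Rightarrow> nat" where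
  "lower_strip \<mu> \<nu> \<kappa> = (let m = (GREATEST r. cstat \<mu> \<nu> \<kappa> r = cbracket \<mu> \<nu> \<kappa>) in \<kappa>(m := \<kappa> m - 1))"

lemma cbracket_le: "cbracket \<mu> \<nu> \<kappa> \<le> cstat \<mu> \<nu> \<kappa> r"
  unfolding cbracket_def cstat_def by (rule bracket_le)

lemma cbracket_attained: "\<exists>r. cstat \<mu> \<nu> \<kappa> r = cbracket \<mu> \<nu> \<kappa>"
  unfolding cbracket_def cstat_def by (rule bracket_attained)

lemma cbracket_eqI: "(\<And>r. j \<le> cstat \<mu> \<nu> \<kappa> r) \<Longrightarrow> cstat \<mu> \<nu> \<kappa> m = j \<Longrightarrow> cbracket \<mu> \<nu> \<kappa> = j"
  unfolding cbracket_def cstat_def by (rule bracket_eqI)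

text \<open>Above the topmost minimizer \<open>m\<close> the statistic exceeds \<open>j\<close>, so
  it can afford to drop by one there; below \<open>m\<close> it grows. Hence the minimum is still
  \<open>j\<close> and now \<open>m\<close> is its bottommost minimizer.\<close>

lemma raise_strip_props:
  assumes "\<kappa> \<in> level_set \<mu> \<nu> a j" "psize \<mu> + a + j < psize \<nu>"
  shows "raise_strip \<mu> \<nu> \<kappa> \<in> level_set \<mu> \<nu> (Suc a) j" "lower_strip \<mu> \<nu> (raise_strip \<mu> \<nu> \<kappa>) = \<kappa>"
proof -
  have k: "\<kappa> \<in> strips_between \<mu> \<nu>" "psize \<kappa> = psize \<mu> + a" and j: "cbracket \<mu> \<nu> \<kappa> = j"
    using assms(1) by (auto simp: level_set_def)
  note b = strips_betweenD[OF k(1)]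
  define m where "m = (LEAST r. cstat \<mu> \<nu> \<kappa> r = cbracket \<mu> \<nu> \<kappa>)"
  define \<kappa>' where "\<kappa>' = \<kappa>(m := Suc (\<kappa> m))"
  have r: "raise_strip \<mu> \<nu> \<kappa> = \<kappa>'"
    by (simp add: raise_strip_def m_def \<kappa>'_def Let_def)
  have m: "cstat \<mu> \<nu> \<kappa> m = j"
    unfolding m_def using LeastI_ex[OF cbracket_attained[of \<mu> \<nu> \<kappa>]] j by simp
  have ge: "j \<le> cstat \<mu> \<nu> \<kappa> r" for r
    using cbracket_le[of \<mu> \<nu> \<kappa> r] j by simp
  have before: "j < cstat \<mu> \<nu> \<kappa> r" if "r < m" for r
    using not_less_Least[of r "\<lambda>r. cstat \<mu> \<nu> \<kappa> r = cbracket \<mu> \<nu> \<kappa>"] that ge[of r] j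
    unfolding m_def by simp
  \<comment> \<open>The value at the row above \<open>m\<close> is larger, so row \<open>m\<close> has more larger letters than the row above
    has smaller ones; at least one of them does not lie below a smaller letter.  In the top row,
    \<open>j\<close> is less than the number of all larger letters, so that some stand in this row.\<close>
  have room: "\<kappa> m < \<nu> m \<and> (\<forall>i. m = Suc i \<longrightarrow> \<kappa> m < \<mu> i)"
  proof (cases m)
    case 0
    then show ?thesis
      using cstat_0[OF k(1)] m assms(2) k(2) by auto
  next
    case (Suc i)
    have "cstat \<mu> \<nu> \<kappa> m + (\<nu> m - \<kappa> m) = cstat \<mu> \<nu> \<kappa> i + (\<kappa> i - \<mu> i)"
      using cstat_Suc[OF k(1), of i] Suc by simp
    then have "\<kappa> i - \<mu> i < \<nu> m - \<kappa> m"
      using before[of i] m Suc by simp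
    moreover have "\<nu> m \<le> \<kappa> i" "\<mu> i \<le> \<kappa> i" "\<kappa> m \<le> \<nu> m"
      using b(4)[of i] b(5)[of m] b(7)[of i] Suc by auto
    ultimately show ?thesis
      using Suc by auto
  qed
  have k': "\<kappa>' \<in> strips_between \<mu> \<nu>"
  proof (rule strips_betweenI[OF b(1,3)])
    fix i
    show "\<mu> i \<le> \<kappa>' i" "\<nu> (Suc i) \<le> \<kappa>' i"
      using b(4,7)[of i] by (auto simp: \<kappa>'_def)
    show "\<kappa>' i \<le> \<nu> i"
      using room b(5)[of i] by (auto simp: \<kappa>'_def)
    show "\<kappa>' (Suc i) \<le> \<mu> i"
      using room b(6)[of i] by (auto simp: \<kappa>'_def)
  qed
  have shift: "int (cstat \<mu> \<nu> \<kappa>' r) = int (cstat \<mu> \<nu> \<kappa> r) + (if m < r then 1 else 0) - (if r < m then 1 else 0)" for r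
    by (rule cstat_shift[OF k(1) k' \<kappa>'_def])
  have m': "cstat \<mu> \<nu> \<kappa>' m = j"
    using shift[of m] m by simp
  have after: "j < cstat \<mu> \<nu> \<kappa>' r" if "m < r" for r
    using shift[of r] ge[of r] that by simp
  have ge': "j \<le> cstat \<mu> \<nu> \<kappa>' r" for r
    using after[of r] m' shift[of r] before[of r] by (cases r m rule: linorder_cases) auto
  have j': "cbracket \<mu> \<nu> \<kappa>' = j"
    using ge' m' by (rule cbracket_eqI)
  have "psize \<kappa>' = Suc (psize \<kappa>)"
    unfolding \<kappa>'_def by (rule psize_fun_upd_Suc[OF b(2)])
  then show "raise_strip \<mu> \<nu> \<kappa> \<in> level_set \<mu> \<nu> (Suc a) j"
    using k' j' k(2) by (simp add: r level_set_def)
  have "(GREATEST r. cstat \<mu> \<nu> \<kappa>' r = j) = m"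
  proof (rule Greatest_equality[of _ m])
    show "y \<le> m" if "cstat \<mu> \<nu> \<kappa>' y = j" for y
      using after[of y] that by (cases "m < y") auto
  qed (rule m')
  then show "lower_strip \<mu> \<nu> (raise_strip \<mu> \<nu> \<kappa>) = \<kappa>"
    unfolding r lower_strip_def j' Let_def by (simp add: \<kappa>'_def)
qed

text \<open>The mirror image of the previous argument. A bottommost minimizer exists because far
  below the statistic is constantly the number of smaller letters, which exceeds \<open>j\<close>.\<close>

lemma lower_strip_props:
  assumes "\<kappa> \<in> level_set \<mu> \<nu> (Suc a) j" "j \<le> a"
  shows "lower_strip \<mu> \<nu> \<kappa> \<in> level_set \<mu> \<nu> a j" "raise_strip \<mu> \<nu> (lower_strip \<mu> \<nu> \<kappa>) = \<kappa>"
proof -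
  have k: "\<kappa> \<in> strips_between \<mu> \<nu>" "psize \<kappa> = psize \<mu> + Suc a" and j: "cbracket \<mu> \<nu> \<kappa> = j"
    using assms(1) by (auto simp: level_set_def)
  note b = strips_betweenD[OF k(1)]
  let ?P = "\<lambda>r. cstat \<mu> \<nu> \<kappa> r = cbracket \<mu> \<nu> \<kappa>"
  define m where "m = (GREATEST r. ?P r)"
  define \<kappa>' where "\<kappa>' = \<kappa>(m := \<kappa> m - 1)"
  have l: "lower_strip \<mu> \<nu> \<kappa> = \<kappa>'"
    by (simp add: lower_strip_def m_def \<kappa>'_def Let_def)
  obtain M where M: "\<And>i. M \<le> i \<Longrightarrow> \<kappa> i = 0"
    using b(2) by (auto simp: par_def)
  have large: "j < cstat \<mu> \<nu> \<kappa> r" if "M \<le> r" for r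
  proof -
    have "{p \<in> cells \<kappa> - cells \<mu>. fst p < r} = cells \<kappa> - cells \<mu>"
    proof -
      have "fst p < r" if "p \<in> cells \<kappa>" for p
        using that M[of "fst p"] \<open>M \<le> r\<close> by (cases p) (force simp: not_less[symmetric])
      then show ?thesis by blast
    qed
    then have "Suc a \<le> cstat \<mu> \<nu> \<kappa> r"
      using card_skew[OF b(2,4)] k(2) by (simp add: cstat_def stat_def)
    then show ?thesis using assms(2) by simp
  qed
  have bound: "r \<le> M" if "?P r" for r
    using large[of r] that j by (cases "M \<le> r") auto
  have m: "cstat \<mu> \<nu> \<kappa> m = j"
  proof -
    obtain r where "?P r" using cbracket_attained by blast
    from GreatestI_nat[of ?P, OF this] bound show ?thesis
      unfolding m_def j by blast
  qed
  have ge: "j \<le> cstat \<mu> \<nu> \<kappa> r" for r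
    using cbracket_le[of \<mu> \<nu> \<kappa> r] j by simp
  have after: "j < cstat \<mu> \<nu> \<kappa> r" if "m < r" for r
  proof (rule ccontr)
    assume "\<not> j < cstat \<mu> \<nu> \<kappa> r"
    then have "?P r" using ge[of r] j by simp
    then have "r \<le> m"
      unfolding m_def by (rule Greatest_le_nat) (use bound in blast)
    with that show False by simp
  qed
  \<comment> \<open>Row \<open>m\<close> has more smaller letters than the row below has larger ones.\<close>
  have room: "\<mu> m < \<kappa> m \<and> \<nu> (Suc m) < \<kappa> m"
  proof -
    have "cstat \<mu> \<nu> \<kappa> (Suc m) + (\<nu> (Suc m) - \<kappa> (Suc m)) = j + (\<kappa> m - \<mu> m)"
      using cstat_Suc[OF k(1), of m] m by simp
    then have "\<nu> (Suc m) - \<kappa> (Suc m) < \<kappa> m - \<mu> m"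
      using after[of "Suc m"] by simp
    moreover have "\<kappa> (Suc m) \<le> \<mu> m" "\<kappa> (Suc m) \<le> \<nu> (Suc m)"
      using b(6)[of m] b(5)[of "Suc m"] by auto
    ultimately show ?thesis by auto
  qed
  have k': "\<kappa>' \<in> strips_between \<mu> \<nu>"
  proof (rule strips_betweenI[OF b(1,3)])
    fix i
    show "\<mu> i \<le> \<kappa>' i" "\<nu> (Suc i) \<le> \<kappa>' i"
      using b(4,7)[of i] room by (auto simp: \<kappa>'_def)
    show "\<kappa>' i \<le> \<nu> i" "\<kappa>' (Suc i) \<le> \<mu> i"
      using b(5,6)[of i] by (auto simp: \<kappa>'_def)
  qed
  have k'': "\<kappa>'(m := Suc (\<kappa>' m)) = \<kappa>"
    using room by (auto simp: \<kappa>'_def)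
  have shift: "int (cstat \<mu> \<nu> \<kappa> r) = int (cstat \<mu> \<nu> \<kappa>' r) + (if m < r then 1 else 0) - (if r < m then 1 else 0)" for r
    by (rule cstat_shift[OF k' k(1) k''[symmetric]])
  have m': "cstat \<mu> \<nu> \<kappa>' m = j"
    using shift[of m] m by simp
  have before: "j < cstat \<mu> \<nu> \<kappa>' r" if "r < m" for r
    using shift[of r] ge[of r] that by simp
  have ge': "j \<le> cstat \<mu> \<nu> \<kappa>' r" for r
    using before[of r] m' shift[of r] after[of r] by (cases r m rule: linorder_cases) auto
  have j': "cbracket \<mu> \<nu> \<kappa>' = j"
    using ge' m' by (rule cbracket_eqI)
  have "psize \<kappa> = Suc (psize \<kappa>')"
    using psize_fun_upd_Suc[OF strips_betweenD(2)[OF k'], of m] unfolding k'' .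
  then show "lower_strip \<mu> \<nu> \<kappa> \<in> level_set \<mu> \<nu> a j"
    using k' j' k(2) by (simp add: l level_set_def)
  have "(LEAST r. cstat \<mu> \<nu> \<kappa>' r = j) = m"
  proof (rule Least_equality[of _ m])
    show "m \<le> y" if "cstat \<mu> \<nu> \<kappa>' y = j" for y
      using before[of y] that by (cases "y < m") auto
  qed (rule m')
  then show "raise_strip \<mu> \<nu> (lower_strip \<mu> \<nu> \<kappa>) = \<kappa>"
    unfolding l raise_strip_def j' Let_def by (simp add: k'')
qed

lemma card_level_set_Suc:
  assumes "j \<le> a" "psize \<mu> + a + j < psize \<nu>"
  shows "card (level_set \<mu> \<nu> a j) = card (level_set \<mu> \<nu> (Suc a) j)"
proof (rule bij_betw_same_card)
  show "bij_betw (raise_strip \<mu> \<nu>) (level_set \<mu> \<nu> a j) (level_set \<mu> \<nu> (Suc a) j)"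
    by (rule bij_betw_byWitness[of _ "lower_strip \<mu> \<nu>"])
       (use raise_strip_props[OF _ assms(2)] lower_strip_props[OF _ assms(1)] in blast)+
qed

lemma card_level_set_const:
  assumes "j \<le> a" "a \<le> a'" "psize \<mu> + a' + j \<le> psize \<nu>"
  shows "card (level_set \<mu> \<nu> a j) = card (level_set \<mu> \<nu> a' j)"
  using assms(2,3)
proof (induction a' rule: dec_induct)
  case (step i)
  then show ?case
    using card_level_set_Suc[of j i \<mu> \<nu>] assms(1) by simp
qed simp

lemma level_set_empty:
  assumes "a < j \<or> psize \<nu> < psize \<mu> + a + j"
  shows "level_set \<mu> \<nu> a j = {}"
proof -
  have False if "\<kappa> \<in> level_set \<mu> \<nu> a j" for \<kappa>
  proof -
    have k: "\<kappa> \<in> strips_between \<mu> \<nu>" "psize \<kappa> = psize \<mu> + a" "cbracket \<mu> \<nu> \<kappa> = j"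
      using that by (auto simp: level_set_def)
    show False
      using cbracket_le_sizes[OF k(1)] strips_between_psize[OF k(1)] k assms by auto
  qed
  then show ?thesis by blast
qed

lemma alternating_sum: "(\<Sum>a=j..j + 2 * k. (-1) ^ a) = ((-1) ^ j :: 'a :: comm_ring_1)"
  by (induction k) simp_all

lemma finite_strips_between: "finite (strips_between \<mu> \<nu>)"
  by (rule finite_subset[OF _ finite_hstrip_below[of \<nu>]]) (auto simp: strips_between_def)

text \<open>Fillings with \<open>j\<close> pairs exist only for
  \<open>j \<le> a \<le> 2 n - j\<close>, and for each of these \<open>a\<close> there are equally
  many. The alternating sum over this odd number of values is \<open>(-1)\<^sup>j\<close>, times the
  number of fillings with \<open>a = n\<close>.\<close>

lemma signed_sum_strips_between:
  assumes "psize \<nu> = psize \<mu> + 2 * n"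
  shows "(\<Sum>\<kappa>\<in>strips_between \<mu> \<nu>. (-1) ^ (psize \<kappa> - psize \<mu>)) =
    (\<Sum>\<kappa> | \<kappa> \<in> strips_between \<mu> \<nu> \<and> psize \<kappa> = psize \<mu> + n. (-1) ^ cbracket \<mu> \<nu> \<kappa> :: 'a :: comm_ring_1)"
proof -
  let ?Z = "strips_between \<mu> \<nu>" and ?c = "\<lambda>a j. of_nat (card (level_set \<mu> \<nu> a j)) :: 'a"
  let ?g = "\<lambda>\<kappa>. (cbracket \<mu> \<nu> \<kappa>, psize \<kappa> - psize \<mu>)"
  have sz: "psize \<mu> \<le> psize \<kappa>" "psize \<kappa> - psize \<mu> \<le> 2 * n" "cbracket \<mu> \<nu> \<kappa> \<le> 2 * n" if "\<kappa> \<in> ?Z" for \<kappa>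
    using strips_between_psize[OF that] cbracket_le_sizes[OF that] assms by auto
  have "(\<Sum>\<kappa>\<in>?Z. (-1) ^ (psize \<kappa> - psize \<mu>)) =
      (\<Sum>y\<in>{..2 * n} \<times> {..2 * n}. \<Sum>\<kappa> | \<kappa> \<in> ?Z \<and> ?g \<kappa> = y. (-1) ^ (psize \<kappa> - psize \<mu>) :: 'a)"
    by (rule sum.group[symmetric]) (use sz finite_strips_between in auto)
  also have "\<dots> = (\<Sum>y\<in>{..2 * n} \<times> {..2 * n}. ?c (snd y) (fst y) * (-1) ^ snd y)"
  proof (rule sum.cong[OF refl])
    fix y :: "nat \<times> nat"
    have "{\<kappa>. \<kappa> \<in> ?Z \<and> ?g \<kappa> = y} = level_set \<mu> \<nu> (snd y) (fst y)"
      using sz by (cases y) (force simp: level_set_def)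
    then show "(\<Sum>\<kappa> | \<kappa> \<in> ?Z \<and> ?g \<kappa> = y. (-1) ^ (psize \<kappa> - psize \<mu>) :: 'a) = ?c (snd y) (fst y) * (-1) ^ snd y"
      by (simp add: level_set_def)
  qed
  also have "\<dots> = (\<Sum>j\<le>2 * n. \<Sum>a\<le>2 * n. ?c a j * (-1) ^ a)"
    by (simp add: sum.cartesian_product case_prod_unfold)
  also have "\<dots> = (\<Sum>j\<le>2 * n. ?c n j * (-1) ^ j)"
  proof (rule sum.cong[OF refl])
    fix j assume "j \<in> {..2 * n}"
    show "(\<Sum>a\<le>2 * n. ?c a j * (-1) ^ a) = ?c n j * (-1) ^ j"
    proof (cases "j \<le> n")
      case True
      have "(\<Sum>a\<le>2 * n. ?c a j * (-1) ^ a) = (\<Sum>a=j..2 * n - j. ?c n j * (-1) ^ a)"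
      proof (rule sum.mono_neutral_cong_right)
        show "\<forall>a\<in>{..2 * n} - {j..2 * n - j}. ?c a j * (-1) ^ a = 0"
        proof
          fix a assume "a \<in> {..2 * n} - {j..2 * n - j}"
          then have "a < j \<or> psize \<nu> < psize \<mu> + a + j"
            using assms by auto
          from level_set_empty[OF this] show "?c a j * (-1) ^ a = 0" by simp
        qed
        fix a assume a: "a \<in> {j..2 * n - j}"
        have "card (level_set \<mu> \<nu> a j) = card (level_set \<mu> \<nu> n j)"
        proof (cases "a \<le> n")
          case True
          then show ?thesis
            using a \<open>j \<le> n\<close> assms by (intro card_level_set_const) auto
        next
          case False
          then show ?thesis
            using a \<open>j \<le> n\<close> assms by (intro card_level_set_const[symmetric]) auto
        qed
        then show "?c a j * (-1) ^ a = ?c n j * (-1) ^ a" by simp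
      qed auto
      also have "\<dots> = ?c n j * (\<Sum>a=j..j + 2 * (n - j). (-1) ^ a)"
      proof -
        have "2 * n - j = j + 2 * (n - j)" using True by simp
        then show ?thesis by (simp only: sum_distrib_left)
      qed
      finally show ?thesis
        by (simp only: alternating_sum)
    next
      case False
      have "level_set \<mu> \<nu> a j = {}" for a
        by (rule level_set_empty) (use False assms in linarith)
      then show ?thesis by simp
    qed
  qed
  also have "\<dots> = (\<Sum>j\<le>2 * n. \<Sum>\<kappa> | \<kappa> \<in> {\<kappa> \<in> ?Z. psize \<kappa> = psize \<mu> + n} \<and> cbracket \<mu> \<nu> \<kappa> = j. (-1) ^ cbracket \<mu> \<nu> \<kappa>)"
  proof (rule sum.cong[OF refl])
    fix j
    have "{\<kappa>. \<kappa> \<in> {\<kappa> \<in> ?Z. psize \<kappa> = psize \<mu> + n} \<and> cbracket \<mu> \<nu> \<kappa> = j} = level_set \<mu> \<nu> n j"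
      by (auto simp: level_set_def)
    then show "?c n j * (-1) ^ j = (\<Sum>\<kappa> | \<kappa> \<in> {\<kappa> \<in> ?Z. psize \<kappa> = psize \<mu> + n} \<and> cbracket \<mu> \<nu> \<kappa> = j. (-1) ^ cbracket \<mu> \<nu> \<kappa>)"
      by (simp add: level_set_def)
  qed
  also have "\<dots> = (\<Sum>\<kappa>\<in>{\<kappa> \<in> ?Z. psize \<kappa> = psize \<mu> + n}. (-1) ^ cbracket \<mu> \<nu> \<kappa>)"
    by (rule sum.group) (use sz finite_strips_between in auto)
  finally show ?thesis .
qed

section \<open>Sums over chains of horizontal strips\<close>

lemma par_chain:
  assumes "c \<in> strip_chains L \<alpha>" "k \<le> L"
  shows "par (c k)"
proof (cases k)
  case 0
  then show ?thesis using assms(1) by (simp add: strip_chains_def par_zero)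
next
  case (Suc k')
  then have "hstrip_by (\<alpha> k') (c k') (c (Suc k'))"
    using assms by (simp add: strip_chains_def)
  then show ?thesis using Suc by (simp add: hstrip_by_def hstrip_def)
qed

lemma pieri_chains:
  assumes "\<sigma> (\<lambda>_. 0) = 1" and pieri: "\<And>\<mu> n. par \<mu> \<Longrightarrow> \<sigma> \<mu> * q n = (\<Sum>\<nu> | hstrip_by n \<mu> \<nu>. \<sigma> \<nu>)"
  shows "(\<Sum>c\<in>strip_chains L \<alpha>. \<sigma> (c L)) = (\<Prod>i<L. q (\<alpha> i) :: mps)"
proof (induction L)
  case 0
  then show ?case by (simp add: chains_0 assms(1))
next
  case (Suc L)
  have "(\<Sum>c\<in>strip_chains (Suc L) \<alpha>. \<sigma> (c (Suc L))) = (\<Sum>c\<in>strip_chains L \<alpha>. \<Sum>\<nu> | hstrip_by (\<alpha> L) (c L) \<nu>. \<sigma> \<nu>)"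
    unfolding sum_chains_Suc by simp
  also have "\<dots> = (\<Sum>c\<in>strip_chains L \<alpha>. \<sigma> (c L) * q (\<alpha> L))"
    using par_chain[of _ L \<alpha> L] pieri by (intro sum.cong refl) simp
  also have "\<dots> = (\<Prod>i<Suc L. q (\<alpha> i))"
    by (simp add: Suc flip: sum_distrib_right)
  finally show ?case .
qed

text \<open>The summands of \<open>signed_square\<close> give all two-step paths with the parity of
  the first step as sign; cancellation within strings leaves those with two steps of equal size.\<close>

lemma pieri_signed_square:
  assumes pieri: "\<And>\<mu> n. par \<mu> \<Longrightarrow> \<sigma> \<mu> * q n = (\<Sum>\<nu> | hstrip_by n \<mu> \<nu>. \<sigma> \<nu>)" and "par \<mu>"
  shows "\<sigma> \<mu> * signed_square q n =
    (\<Sum>\<kappa> | hstrip_by n \<mu> \<kappa>. \<Sum>\<nu> | hstrip_by n \<kappa> \<nu>. (-1) ^ cbracket \<mu> \<nu> \<kappa> * \<sigma> \<nu>)"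
proof -
  let ?U = "{\<nu>. par \<nu> \<and> psize \<nu> = psize \<mu> + 2 * n}"
  have two: "\<sigma> \<mu> * (q a * q b) = (\<Sum>\<kappa> | hstrip_by a \<mu> \<kappa>. \<Sum>\<nu> | hstrip_by b \<kappa> \<nu>. \<sigma> \<nu>)" for a b
  proof -
    have "\<sigma> \<mu> * (q a * q b) = (\<Sum>\<kappa> | hstrip_by a \<mu> \<kappa>. \<sigma> \<kappa>) * q b"
      by (simp only: mult.assoc[symmetric] pieri[OF assms(2)])
    also have "\<dots> = (\<Sum>\<kappa> | hstrip_by a \<mu> \<kappa>. \<sigma> \<kappa> * q b)"
      by (rule sum_distrib_right)
    also have "\<dots> = (\<Sum>\<kappa> | hstrip_by a \<mu> \<kappa>. \<Sum>\<nu> | hstrip_by b \<kappa> \<nu>. \<sigma> \<nu>)"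
      by (intro sum.cong refl pieri) (simp add: hstrip_by_def hstrip_def)
    finally show ?thesis .
  qed
  have "\<sigma> \<mu> * signed_square q n = (\<Sum>a\<le>2 * n. (-1) ^ a * (\<sigma> \<mu> * (q a * q (2 * n - a))))"
    by (simp only: signed_square_def sum_distrib_left mult.left_commute)
  also have "\<dots> = (\<Sum>a\<le>2 * n. (-1) ^ a * (\<Sum>\<kappa> | hstrip \<mu> \<kappa> \<and> psize \<kappa> = psize \<mu> + a.
      \<Sum>\<nu> | hstrip \<kappa> \<nu> \<and> psize \<nu> = psize \<kappa> + (2 * n - a). \<sigma> \<nu>))"
    unfolding two hstrip_by_def ..
  also have "\<dots> = (\<Sum>\<nu>\<in>?U. (\<Sum>\<kappa> | hstrip \<mu> \<kappa> \<and> hstrip \<kappa> \<nu>. (-1) ^ (psize \<kappa> - psize \<mu>)) * \<sigma> \<nu>)"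
    by (rule two_step_sum) (simp_all add: hstrip_psize_le, simp_all add: hstrip_def)
  also have "\<dots> = (\<Sum>\<nu>\<in>?U. \<Sum>\<kappa> | \<kappa> \<in> {\<kappa>. hstrip_by n \<mu> \<kappa>} \<and> hstrip_by n \<kappa> \<nu>. (-1) ^ cbracket \<mu> \<nu> \<kappa> * \<sigma> \<nu>)"
  proof (rule sum.cong[OF refl])
    fix \<nu> assume \<nu>: "\<nu> \<in> ?U"
    then have "{\<kappa>. \<kappa> \<in> strips_between \<mu> \<nu> \<and> psize \<kappa> = psize \<mu> + n} = {\<kappa>. \<kappa> \<in> {\<kappa>. hstrip_by n \<mu> \<kappa>} \<and> hstrip_by n \<kappa> \<nu>}"
      by (auto simp: strips_between_def hstrip_by_def)
    with signed_sum_strips_between[of \<nu> \<mu> n] \<nu>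
    have "(\<Sum>\<kappa>\<in>strips_between \<mu> \<nu>. (-1) ^ (psize \<kappa> - psize \<mu>)) =
        (\<Sum>\<kappa> | \<kappa> \<in> {\<kappa>. hstrip_by n \<mu> \<kappa>} \<and> hstrip_by n \<kappa> \<nu>. (-1) ^ cbracket \<mu> \<nu> \<kappa> :: mps)" by simp
    then show "(\<Sum>\<kappa> | hstrip \<mu> \<kappa> \<and> hstrip \<kappa> \<nu>. (-1) ^ (psize \<kappa> - psize \<mu>)) * \<sigma> \<nu> =
        (\<Sum>\<kappa> | \<kappa> \<in> {\<kappa>. hstrip_by n \<mu> \<kappa>} \<and> hstrip_by n \<kappa> \<nu>. (-1) ^ cbracket \<mu> \<nu> \<kappa> * \<sigma> \<nu>)"
      unfolding strips_between_def by (simp only: sum_distrib_right)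
  qed
  also have "\<dots> = (\<Sum>\<kappa> | hstrip_by n \<mu> \<kappa>. \<Sum>\<nu> | \<nu> \<in> ?U \<and> hstrip_by n \<kappa> \<nu>. (-1) ^ cbracket \<mu> \<nu> \<kappa> * \<sigma> \<nu>)"
    by (rule sum.swap_restrict) (simp_all add: finite_par_psize finite_hstrip_by_above)
  also have "\<dots> = (\<Sum>\<kappa> | hstrip_by n \<mu> \<kappa>. \<Sum>\<nu> | hstrip_by n \<kappa> \<nu>. (-1) ^ cbracket \<mu> \<nu> \<kappa> * \<sigma> \<nu>)"
    by (intro sum.cong refl) (auto simp: hstrip_by_def hstrip_def)
  finally show ?thesis .
qed

text \<open>The sign of a tableau in terms of its chain, in which each pair of consecutive strips
  contributes its number of bracketed pairs.\<close>

definition chain_sign :: "nat \<Rightarrow> (nat \<Rightarrow> nat \<Rightarrow> nat) \<Rightarrow> int" where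
  "chain_sign L c = (\<Prod>i<L. (-1) ^ cbracket (c (2 * i)) (c (2 * i + 2)) (c (2 * i + 1)))"

lemma pieri_signed_chains:
  assumes "\<sigma> (\<lambda>_. 0) = 1" and pieri: "\<And>\<mu> n. par \<mu> \<Longrightarrow> \<sigma> \<mu> * q n = (\<Sum>\<nu> | hstrip_by n \<mu> \<nu>. \<sigma> \<nu>)"
    and "\<And>i. i < L \<Longrightarrow> \<alpha> (2 * i) = l i" "\<And>i. i < L \<Longrightarrow> \<alpha> (2 * i + 1) = l i"
  shows "(\<Sum>c\<in>strip_chains (2 * L) \<alpha>. of_int (chain_sign L c) * \<sigma> (c (2 * L))) = (\<Prod>i<L. signed_square q (l i) :: mps)"
  using assms(3,4)
proof (induction L)
  case 0
  then show ?case by (simp add: chains_0 assms(1) chain_sign_def)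
next
  case (Suc L)
  let ?N = "2 * L" and ?n = "l L"
  let ?ext = "\<lambda>c \<kappa> \<nu> k. if k \<le> Suc ?N then if k \<le> ?N then c k else \<kappa> else \<nu>"
  have \<alpha>: "\<alpha> ?N = ?n" "\<alpha> (Suc ?N) = ?n"
    using Suc.prems[of L] by simp_all
  have sign: "chain_sign (Suc L) (?ext c \<kappa> \<nu>) = chain_sign L c * (-1) ^ cbracket (c ?N) \<nu> \<kappa>" for c \<kappa> \<nu>
  proof -
    have "chain_sign L (?ext c \<kappa> \<nu>) = chain_sign L c"
      unfolding chain_sign_def by (rule prod.cong) auto
    then show ?thesis
      by (simp add: chain_sign_def)
  qed
  have "(\<Sum>c\<in>strip_chains (2 * Suc L) \<alpha>. of_int (chain_sign (Suc L) c) * \<sigma> (c (2 * Suc L))) =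
      (\<Sum>c\<in>strip_chains (Suc (Suc ?N)) \<alpha>. of_int (chain_sign (Suc L) c) * \<sigma> (c (Suc (Suc ?N))))"
    by simp
  also have "\<dots> = (\<Sum>c\<in>strip_chains ?N \<alpha>. \<Sum>\<kappa> | hstrip_by ?n (c ?N) \<kappa>. \<Sum>\<nu> | hstrip_by ?n \<kappa> \<nu>.
      of_int (chain_sign (Suc L) (?ext c \<kappa> \<nu>)) * \<sigma> \<nu>)"
    unfolding sum_chains_Suc \<alpha> by simp
  also have "\<dots> = (\<Sum>c\<in>strip_chains ?N \<alpha>. of_int (chain_sign L c) *
      (\<Sum>\<kappa> | hstrip_by ?n (c ?N) \<kappa>. \<Sum>\<nu> | hstrip_by ?n \<kappa> \<nu>. (-1) ^ cbracket (c ?N) \<nu> \<kappa> * \<sigma> \<nu>))"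
    unfolding sign sum_distrib_left by (intro sum.cong refl) simp
  also have "\<dots> = (\<Sum>c\<in>strip_chains ?N \<alpha>. of_int (chain_sign L c) * (\<sigma> (c ?N) * signed_square q ?n))"
  proof (intro sum.cong refl)
    fix c assume "c \<in> strip_chains ?N \<alpha>"
    then have "par (c ?N)" by (rule par_chain) simp
    then show "of_int (chain_sign L c) * (\<Sum>\<kappa> | hstrip_by ?n (c ?N) \<kappa>. \<Sum>\<nu> | hstrip_by ?n \<kappa> \<nu>. (-1) ^ cbracket (c ?N) \<nu> \<kappa> * \<sigma> \<nu>) =
        of_int (chain_sign L c) * (\<sigma> (c ?N) * signed_square q ?n)"
      using pieri_signed_square[of \<sigma> q "c ?N" ?n] pieri by simp
  qed
  also have "\<dots> = (\<Sum>c\<in>strip_chains ?N \<alpha>. of_int (chain_sign L c) * \<sigma> (c ?N)) * signed_square q ?n"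
    by (simp only: sum_distrib_right mult.assoc)
  also have "(\<Sum>c\<in>strip_chains ?N \<alpha>. of_int (chain_sign L c) * \<sigma> (c ?N)) = (\<Prod>i<L. signed_square q (l i))"
    using Suc.prems by (intro Suc.IH) auto
  finally show ?case by simp
qed

section \<open>Slides in semistandard tableaux with a hole\<close>

definition entries :: "nat \<Rightarrow> filling \<Rightarrow> cell set" where
  "entries k T = {p. T p = Some k}"

text \<open>The state in the middle of a slide: a semistandard filling of \<open>f/g\<close> with a
  hole at \<open>p\<close>.\<close>

definition punctured :: "(nat \<Rightarrow> nat) \<Rightarrow> (nat \<Rightarrow> nat) \<Rightarrow> cell \<Rightarrow> filling \<Rightarrow> bool" where
  "punctured f g p T \<longleftrightarrow> par f \<and> par g \<and> (\<forall>i. g i \<le> f i) \<and> p \<in> cells f \<and> p \<notin> cells g \<and>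
     dom T = cells f - cells g - {p} \<and> semistandard T"

lemma semistandard_delete: "semistandard T \<Longrightarrow> semistandard (T(q := None))"
  unfolding semistandard_def by (auto split: if_splits)

lemma semistandard_insert:
  assumes T: "semistandard T" and "0 < b"
    and "\<And>c' a. c' < c \<Longrightarrow> T (r, c') = Some a \<Longrightarrow> a \<le> b"
    and "\<And>c' a. c < c' \<Longrightarrow> T (r, c') = Some a \<Longrightarrow> b \<le> a"
    and "\<And>r' a. r' < r \<Longrightarrow> T (r', c) = Some a \<Longrightarrow> a < b"
    and "\<And>r' a. r < r' \<Longrightarrow> T (r', c) = Some a \<Longrightarrow> b < a"
  shows "semistandard (T((r, c) := Some b))"
  unfolding semistandard_def
proof (intro conjI allI impI)
  fix p a assume "(T((r, c) := Some b)) p = Some a"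
  then show "0 < a"
    using assms(2) semistandard_pos[OF T, of p a] by (cases "p = (r, c)") auto
next
  fix r1 c1 c2 x y
  assume "c1 < c2 \<and> (T((r, c) := Some b)) (r1, c1) = Some x \<and> (T((r, c) := Some b)) (r1, c2) = Some y"
  then show "x \<le> y"
    using assms(3)[of c1 x] assms(4)[of c2 y] semistandard_row[OF T, of r1 c1 x c2 y]
    by (cases "(r1, c1) = (r, c)"; cases "(r1, c2) = (r, c)") auto
next
  fix r1 r2 c1 x y
  assume "r1 < r2 \<and> (T((r, c) := Some b)) (r1, c1) = Some x \<and> (T((r, c) := Some b)) (r2, c1) = Some y"
  then show "x < y"
    using assms(5)[of r1 x] assms(6)[of r2 y] semistandard_col[OF T, of r1 c1 x r2 y]
    by (cases "(r1, c1) = (r, c)"; cases "(r2, c1) = (r, c)") auto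
qed

lemma puncturedD:
  assumes "punctured f g p T"
  shows "par f" "par g" "\<And>i. g i \<le> f i" "p \<in> cells f" "p \<notin> cells g" "semistandard T"
    "dom T = cells f - cells g - {p}"
  using assms by (auto simp: punctured_def)

lemma punctured_entry_iff:
  assumes "punctured f g p T"
  shows "(\<exists>a. T (r, c) = Some a) \<longleftrightarrow> c < f r \<and> \<not> c < g r \<and> (r, c) \<noteq> p"
proof -
  have "(\<exists>a. T (r, c) = Some a) \<longleftrightarrow> (r, c) \<in> dom T" by (simp add: dom_def)
  then show ?thesis
    unfolding puncturedD(7)[OF assms] by simp
qed

text \<open>Below every entry to the left of the hole stands an entry of row \<open>r + 1\<close>,
  which is larger than it and at most the entry moving up. So the rows stay weakly increasing.\<close>

lemma punctured_down:
  assumes P: "punctured f g (r, c) T" and b: "T (Suc r, c) = Some b"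
    and le: "\<forall>a. T (r, Suc c) = Some a \<longrightarrow> b \<le> a"
  shows "punctured f g (Suc r, c) (T((r, c) := Some b, (Suc r, c) := None))"
proof -
  note d = puncturedD[OF P] and e = punctured_entry_iff[OF P]
  let ?S = "T((Suc r, c) := None)"
  have below: "c < f (Suc r)" "\<not> c < g (Suc r)"
    using e[of "Suc r" c] b by auto
  have hole: "c < f r" "\<not> c < g r" using d(4,5) by auto
  have g: "g (Suc r) \<le> g r" by (rule par_antimono[OF d(2)]) simp
  have "semistandard (?S((r, c) := Some b))"
  proof (rule semistandard_insert)
    show "semistandard ?S" by (rule semistandard_delete[OF d(6)])
    show "0 < b" by (rule semistandard_pos[OF d(6) b])
    fix c' a assume c': "c' < c" and "?S (r, c') = Some a"
    then have a: "T (r, c') = Some a" by simp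
    then have "\<not> c' < g r" using e[of r c'] by auto
    then obtain a' where a': "T (Suc r, c') = Some a'"
      using e[of "Suc r" c'] c' below(1) g by auto
    have "a < a'" by (rule semistandard_col[OF d(6) a a']) simp
    also have "a' \<le> b" by (rule semistandard_row[OF d(6) a' b]) (use c' in simp)
    finally show "a \<le> b" by simp
  next
    fix c' a assume c': "c < c'" and "?S (r, c') = Some a"
    then have a: "T (r, c') = Some a" by simp
    then have "c' < f r" using e[of r c'] by auto
    then obtain a0 where a0: "T (r, Suc c) = Some a0"
      using e[of r "Suc c"] c' hole by auto
    have "b \<le> a0" using le a0 by blast
    also have "a0 \<le> a" by (rule semistandard_row[OF d(6) a0 a]) (use c' in simp)
    finally show "b \<le> a" .
  next
    fix r' a assume r': "r' < r" and "?S (r', c) = Some a"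
    then have a: "T (r', c) = Some a" by simp
    show "a < b" by (rule semistandard_col[OF d(6) a b]) (use r' in simp)
  next
    fix r' a assume r': "r < r'" and "?S (r', c) = Some a"
    then have a: "T (r', c) = Some a" "Suc r < r'" by (auto split: if_splits)
    show "b < a" by (rule semistandard_col[OF d(6) b a(1)]) (rule a(2))
  qed
  moreover have "?S((r, c) := Some b) = T((r, c) := Some b, (Suc r, c) := None)"
    by (rule fun_upd_twist) simp
  moreover have "dom (T((r, c) := Some b, (Suc r, c) := None)) = cells f - cells g - {(Suc r, c)}"
    using d(4,5) by (simp add: d(7)) auto
  ultimately show ?thesis
    using d below by (simp add: punctured_def)
qed

text \<open>Every entry above the hole has a neighbour to its right, which is at least as large and
  stands above the entry moving left. So the columns stay strictly increasing.\<close>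

lemma punctured_right:
  assumes P: "punctured f g (r, c) T" and a: "T (r, Suc c) = Some a"
    and less: "\<forall>b. T (Suc r, c) = Some b \<longrightarrow> a < b"
  shows "punctured f g (r, Suc c) (T((r, c) := Some a, (r, Suc c) := None))"
proof -
  note d = puncturedD[OF P] and e = punctured_entry_iff[OF P]
  let ?S = "T((r, Suc c) := None)"
  have nxt: "Suc c < f r" "\<not> Suc c < g r"
    using e[of r "Suc c"] a by auto
  have hole: "c < f r" "\<not> c < g r" using d(4,5) by auto
  have "semistandard (?S((r, c) := Some a))"
  proof (rule semistandard_insert)
    show "semistandard ?S" by (rule semistandard_delete[OF d(6)])
    show "0 < a" by (rule semistandard_pos[OF d(6) a])
    fix c' x assume c': "c' < c" and "?S (r, c') = Some x"
    then have x: "T (r, c') = Some x" by simp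
    show "x \<le> a" by (rule semistandard_row[OF d(6) x a]) (use c' in simp)
  next
    fix c' x assume c': "c < c'" and "?S (r, c') = Some x"
    then have x: "T (r, c') = Some x" by (auto split: if_splits)
    show "a \<le> x" by (rule semistandard_row[OF d(6) a x]) (use c' in simp)
  next
    fix r' x assume r': "r' < r" and "?S (r', c) = Some x"
    then have x: "T (r', c) = Some x" by simp
    then have "\<not> c < g r'" using e[of r' c] by auto
    then obtain y where y: "T (r', Suc c) = Some y"
      using e[of r' "Suc c"] r' nxt(1) par_antimono[OF d(1), of r' r] by auto
    have "x \<le> y" by (rule semistandard_row[OF d(6) x y]) simp
    also have "y < a" by (rule semistandard_col[OF d(6) y a r'])
    finally show "x < a" .
  next
    fix r' x assume r': "r < r'" and "?S (r', c) = Some x"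
    then have x: "T (r', c) = Some x" by simp
    then have "c < f r'" using e[of r' c] by auto
    then obtain y where y: "T (Suc r, c) = Some y"
      using e[of "Suc r" c] r' hole par_antimono[OF d(1), of "Suc r" r'] par_antimono[OF d(2), of r "Suc r"] by auto
    have "a < y" using less y by blast
    also have "y \<le> x"
      using semistandard_col[OF d(6) y x] r' x y by (cases "r' = Suc r") auto
    finally show "a < x" .
  qed
  moreover have "?S((r, c) := Some a) = T((r, c) := Some a, (r, Suc c) := None)"
    by (rule fun_upd_twist) simp
  moreover have "dom (T((r, c) := Some a, (r, Suc c) := None)) = cells f - cells g - {(r, Suc c)}"
    using d(4,5) by (simp add: d(7)) auto
  ultimately show ?thesis
    using d nxt by (simp add: punctured_def)
qed

lemma par_remove_corner:
  assumes "par f" "f r = Suc c" "f (Suc r) \<le> c"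
  shows "par (f(r := c))" "cells (f(r := c)) = cells f - {(r, c)}"
proof -
  let ?f = "f(r := c)"
  have "antimono ?f"
  proof (rule decseq_SucI)
    fix i show "?f (Suc i) \<le> ?f i"
      using par_antimono[OF assms(1), of i "Suc i"] assms(2,3) by auto
  qed
  moreover obtain M where "\<forall>i\<ge>M. f i = 0"
    using assms(1) by (auto simp: par_def)
  then have "\<forall>i\<ge>M. ?f i = 0" using assms(2) by auto
  ultimately show "par ?f" unfolding par_def by blast
  show "cells ?f = cells f - {(r, c)}"
    using assms(2) by (auto simp: cells_def split: if_splits)
qed

lemma punctured_stop:
  assumes P: "punctured f g (r, c) T" and "T (r, Suc c) = None" "T (Suc r, c) = None"
  shows "\<exists>f'. par f' \<and> (\<forall>i. g i \<le> f' i) \<and> dom T = cells f' - cells g"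
proof -
  note d = puncturedD[OF P] and e = punctured_entry_iff[OF P]
  have hole: "c < f r" "g r \<le> c" using d(4,5) by auto
  have fr: "f r = Suc c"
    using e[of r "Suc c"] assms(2) hole by auto
  have "g (Suc r) \<le> c"
    using par_antimono[OF d(2), of r "Suc r"] hole by simp
  then have fSr: "f (Suc r) \<le> c"
    using e[of "Suc r" c] assms(3) by auto
  note f' = par_remove_corner[OF d(1) fr fSr]
  have "dom T = cells (f(r := c)) - cells g"
    using d(7) unfolding f'(2) by blast
  moreover have "g i \<le> (f(r := c)) i" for i
    using d(3)[of i] hole by simp
  ultimately show ?thesis using f'(1) by blast
qed

section \<open>Bracketed pairs are invariant under slides\<close>

definition two_valued :: "nat \<Rightarrow> filling \<Rightarrow> bool" where
  "two_valued k T \<longleftrightarrow> (\<forall>p a. T p = Some a \<longrightarrow> a = k \<or> a = Suc k)"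

lemma finite_entries: "finite (dom T) \<Longrightarrow> finite (entries k T)"
  by (rule finite_subset[of _ "dom T"]) (auto simp: entries_def)

lemma entries_move:
  assumes "T p = None" "T q = Some b"
  shows "entries k (T(p := Some b, q := None)) = (if k = b then insert p (entries k T - {q}) else entries k T)"
proof -
  have "p \<noteq> q" using assms by auto
  then show ?thesis using assms by (auto simp: entries_def)
qed

lemma card_move:
  assumes "finite X" "q \<in> X" "p \<notin> X"
  shows "card {x \<in> insert p (X - {q}). P x} + (if P q then 1 else 0) = card {x \<in> X. P x} + (if P p then 1 else 0)"
proof -
  let ?Y = "{x \<in> X - {q}. P x}"
  have fin: "finite ?Y" using assms(1) by simp
  have "{x \<in> X. P x} = (if P q then insert q ?Y else ?Y)"
    using assms(2) by auto
  then have 1: "card {x \<in> X. P x} = card ?Y + (if P q then 1 else 0)"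
    using fin by simp
  have "{x \<in> insert p (X - {q}). P x} = (if P p then insert p ?Y else ?Y)"
    using assms(3) by auto
  then have 2: "card {x \<in> insert p (X - {q}). P x} = card ?Y + (if P p then 1 else 0)"
    using fin assms(3) by simp
  show ?thesis unfolding 1 2 by simp
qed

text \<open>Moves that stay within a row do not affect the statistic; a move by one row changes a
  single value.\<close>

lemma stat_move_left:
  assumes "finite A" "q \<in> A" "p \<notin> A"
  shows "stat (insert p (A - {q})) B s + (if fst q < s then 1 else 0) = stat A B s + (if fst p < s then 1 else 0)"
  using card_move[OF assms, of "\<lambda>x. fst x < s"] by (simp add: stat_def)

lemma stat_move_right:
  assumes "finite B" "q \<in> B" "p \<notin> B"
  shows "stat A (insert p (B - {q})) s + (if s < fst q then 1 else 0) = stat A B s + (if s < fst p then 1 else 0)"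
  using card_move[OF assms, of "\<lambda>x. s < fst x"] by (simp add: stat_def)

lemma bracket_cong: "(\<And>s. stat A B s = stat A' B' s) \<Longrightarrow> bracket A B = bracket A' B'"
  by (simp add: bracket_def)

text \<open>Raising one value of a function does not change its minimum if some other value was at
  most as large.\<close>

lemma bracket_bump:
  assumes "\<And>s. stat A' B' s = stat A B s + (if s = m then 1 else 0)" "stat A B l \<le> stat A B m" "l \<noteq> m"
  shows "bracket A' B' = bracket A B"
proof -
  obtain s where s: "stat A B s = bracket A B" using bracket_attained by blast
  define s' where "s' = (if s = m then l else s)"
  have "stat A B s' = bracket A B"
    using s assms(2) bracket_le[of A B l] by (auto simp: s'_def)
  moreover have "s' \<noteq> m" using assms(3) by (simp add: s'_def)
  ultimately have "stat A' B' s' = bracket A B" using assms(1) by simp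
  then show ?thesis
    by (intro bracket_eqI[of _ _ _ s']) (simp_all add: assms(1) bracket_le trans_le_add1)
qed

lemma bracket_move_right_cell:
  assumes "finite (dom T)" "T (r, c) = None" "T (r, Suc c) = Some a"
  shows "bracket (entries k (T((r, c) := Some a, (r, Suc c) := None)))
      (entries (Suc k) (T((r, c) := Some a, (r, Suc c) := None))) = bracket (entries k T) (entries (Suc k) T)"
proof (rule bracket_cong)
  fix s
  have in_entries: "(r, Suc c) \<in> entries a T" "(r, c) \<notin> entries a T"
    using assms by (auto simp: entries_def)
  show "stat (entries k (T((r, c) := Some a, (r, Suc c) := None)))
      (entries (Suc k) (T((r, c) := Some a, (r, Suc c) := None))) s = stat (entries k T) (entries (Suc k) T) s"
    unfolding entries_move[OF assms(2,3)]
    using stat_move_left[OF finite_entries[OF assms(1)] in_entries, of "entries (Suc k) T" s]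
      stat_move_right[OF finite_entries[OF assms(1)] in_entries, of "entries k T" s]
    by (cases "k = a"; cases "Suc k = a") (auto split: if_splits)
qed

text \<open>If a smaller letter moves up from row \<open>r + 1\<close> to row \<open>r\<close>, then
  only the value at \<open>r + 1\<close> increases. Every larger letter in row \<open>r + 1\<close>
  lies to the right of the moving one and hence below a smaller letter in row \<open>r\<close>, so
  the value at \<open>r\<close> was at most as large. If a larger letter moves up, then only the
  value at \<open>r\<close> decreases. All smaller letters in row \<open>r\<close> are to the left
  of the hole, with larger letters below them in addition to the moving one, so the value at
  \<open>r + 1\<close> is at most the new value at \<open>r\<close>.\<close>

lemma bracket_move_down_cell:
  assumes P: "punctured f g (r, c) T" and b: "T (Suc r, c) = Some b"
    and le: "\<forall>a. T (r, Suc c) = Some a \<longrightarrow> b \<le> a" and two: "two_valued k T"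
  shows "bracket (entries k (T((r, c) := Some b, (Suc r, c) := None)))
      (entries (Suc k) (T((r, c) := Some b, (Suc r, c) := None))) = bracket (entries k T) (entries (Suc k) T)"
proof -
  note d = puncturedD[OF P] and e = punctured_entry_iff[OF P]
  let ?A = "entries k T" and ?B = "entries (Suc k) T"
  have fin: "finite (dom T)"
    using par_finite_cells[OF d(1)] by (simp add: d(7))
  note finE = finite_entries[OF fin]
  have hole: "c < f r" "\<not> c < g r" using d(4,5) by auto
  have below: "c < f (Suc r)" using e[of "Suc r" c] b by auto
  have none: "T (r, c) = None"
    using e[of r c] by (cases "T (r, c)") auto
  have mem: "(Suc r, c) \<in> entries b T" "(r, c) \<notin> entries b T"
    using b none by (auto simp: entries_def)
  note recur = stat_Suc[OF finE finE, of k "Suc k" r]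
  let ?Ar = "{p \<in> ?A. fst p = r}" and ?Br = "{p \<in> ?B. fst p = Suc r}"
  consider "b = k" | "b = Suc k" using two b by (auto simp: two_valued_def)
  then show ?thesis
  proof cases
    case 1
    have "card ?Br \<le> card ?Ar"
    proof (rule card_inj_on_le)
      show "inj_on (\<lambda>p. (r, snd p)) ?Br"
        by (auto simp: inj_on_def)
      show "finite ?Ar" using finE by simp
      show "(\<lambda>p. (r, snd p)) ` ?Br \<subseteq> ?Ar"
      proof
        fix p assume "p \<in> (\<lambda>p. (r, snd p)) ` ?Br"
        then obtain c' where p: "p = (r, c')" and c': "T (Suc r, c') = Some (Suc k)"
          by (auto simp: entries_def)
        have "c < c'"
        proof (rule ccontr)
          assume "\<not> c < c'"
          then have "Suc k \<le> b" using semistandard_row[OF d(6) c' b] by simp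
          then show False using 1 by simp
        qed
        moreover have "c' < f (Suc r)" using e[of "Suc r" c'] c' by auto
        ultimately obtain a where a: "T (r, c') = Some a"
          using e[of r c'] hole par_antimono[OF d(1), of r "Suc r"] by auto
        have "a < Suc k" by (rule semistandard_col[OF d(6) a c']) simp
        then have "a = k" using two a by (auto simp: two_valued_def)
        then show "p \<in> ?Ar" using a p by (simp add: entries_def)
      qed
    qed
    then have le_stat: "stat ?A ?B r \<le> stat ?A ?B (Suc r)" using recur by linarith
    have "stat (insert (r, c) (?A - {(Suc r, c)})) ?B s = stat ?A ?B s + (if s = Suc r then 1 else 0)" for s
      using stat_move_left[OF finE mem[unfolded 1], of ?B s]
      by (cases s "Suc r" rule: linorder_cases) auto
    from bracket_bump[OF this le_stat] show ?thesis
      unfolding entries_move[OF none b] using 1 by simp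
  next
    case 2
    have "card (insert (r, c) ?Ar) \<le> card ?Br"
    proof (rule card_inj_on_le)
      show "inj_on (\<lambda>p. (Suc r, snd p)) (insert (r, c) ?Ar)"
        by (auto simp: inj_on_def)
      show "finite ?Br" using finE by simp
      show "(\<lambda>p. (Suc r, snd p)) ` insert (r, c) ?Ar \<subseteq> ?Br"
      proof
        fix p assume "p \<in> (\<lambda>p. (Suc r, snd p)) ` insert (r, c) ?Ar"
        then consider "p = (Suc r, c)" | c' where "p = (Suc r, c')" "T (r, c') = Some k"
          by (auto simp: entries_def)
        then show "p \<in> ?Br"
        proof cases
          case 1
          then show ?thesis using b 2 by (simp add: entries_def)
        next
          case (2 c')
          have "c' < c"
          proof (rule ccontr)
            assume "\<not> c' < c"
            then have "c < c'" using 2 none by (cases "c = c'") auto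
            moreover have "c' < f r" using e[of r c'] 2 by auto
            ultimately obtain a0 where a0: "T (r, Suc c) = Some a0"
              using e[of r "Suc c"] hole by auto
            then have "b \<le> a0" using le by blast
            also have "a0 \<le> k"
              by (rule semistandard_row[OF d(6) a0 2(2)]) (use \<open>c < c'\<close> in simp)
            finally show False using \<open>b = Suc k\<close> by simp
          qed
          moreover have "\<not> c' < g r" using e[of r c'] 2 by auto
          ultimately obtain a where a: "T (Suc r, c') = Some a"
            using e[of "Suc r" c'] below par_antimono[OF d(2), of r "Suc r"] by auto
          have "k < a" by (rule semistandard_col[OF d(6) 2(2) a]) simp
          then have "a = Suc k" using two a by (auto simp: two_valued_def)
          then show ?thesis using a 2 by (simp add: entries_def)
        qed
      qed
    qed
    moreover have "(r, c) \<notin> ?Ar" using none by (simp add: entries_def)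
    ultimately have "Suc (card ?Ar) \<le> card ?Br" using finE by simp
    then have lt: "Suc (stat ?A ?B (Suc r)) \<le> stat ?A ?B r" using recur by linarith
    let ?B' = "insert (r, c) (?B - {(Suc r, c)})"
    have st: "stat ?A ?B s = stat ?A ?B' s + (if s = r then 1 else 0)" for s
      using stat_move_right[OF finE mem[unfolded 2], of ?A s]
      by (cases s r rule: linorder_cases) auto
    have "stat ?A ?B' (Suc r) \<le> stat ?A ?B' r"
      using lt st[of r] st[of "Suc r"] by simp
    from bracket_bump[OF st this] show ?thesis
      unfolding entries_move[OF none b] using 2 by simp
  qed
qed

section \<open>Rectification of tableaux with two letters\<close>

definition skew :: "(nat \<Rightarrow> nat) \<Rightarrow> (nat \<Rightarrow> nat) \<Rightarrow> filling \<Rightarrow> bool" where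
  "skew f g T \<longleftrightarrow> par f \<and> par g \<and> (\<forall>i. g i \<le> f i) \<and> dom T = cells f - cells g \<and> semistandard T"

definition same_statistics :: "nat \<Rightarrow> filling \<Rightarrow> filling \<Rightarrow> bool" where
  "same_statistics k T U \<longleftrightarrow> two_valued k U \<and> card (entries k U) = card (entries k T) \<and>
     card (entries (Suc k) U) = card (entries (Suc k) T) \<and>
     bracket (entries k U) (entries (Suc k) U) = bracket (entries k T) (entries (Suc k) T)"

lemma two_valued_move:
  assumes "two_valued k T" "T q = Some b"
  shows "two_valued k (T(p := Some b, q := None))"
  unfolding two_valued_def
proof (intro allI impI)
  fix x a assume "(T(p := Some b, q := None)) x = Some a"
  then have "T x = Some a \<or> a = b" by (auto split: if_splits)
  then show "a = k \<or> a = Suc k"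
    using assms unfolding two_valued_def by blast
qed

lemma card_entries_move:
  assumes "finite (dom T)" "T p = None" "T q = Some b"
  shows "card (entries k (T(p := Some b, q := None))) = card (entries k T)"
proof -
  have "q \<in> entries b T" "p \<notin> entries b T"
    using assms by (auto simp: entries_def)
  from card_move[OF finite_entries[OF assms(1)] this, of "\<lambda>_. True"]
  have "card (insert p (entries b T - {q})) = card (entries b T)"
    by (simp only: simp_thms if_True Collect_mem_eq add_right_cancel)
  then show ?thesis by (simp add: entries_move[OF assms(2,3)])
qed

lemma punctured_finite: "punctured f g p T \<Longrightarrow> finite (dom T)"
  by (simp add: puncturedD(7) puncturedD(1) par_finite_cells)

lemma punctured_hole: "punctured f g p T \<Longrightarrow> T p = None"
  using puncturedD(7)[of f g p T] by (cases "T p") auto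

lemma slide_invariant:
  assumes "slide p T U" "punctured f g p T" "two_valued k T"
  shows "(\<exists>f'. skew f' g U) \<and> same_statistics k T U"
  using assms
proof (induction rule: slide.induct)
  case (stop T r c)
  then show ?case
    using punctured_stop[OF stop.prems(1) stop.hyps] puncturedD[OF stop.prems(1)]
    by (auto simp: skew_def same_statistics_def)
next
  case (down T r c b U)
  let ?T = "T((r, c) := Some b, (Suc r, c) := None)"
  note P = down.prems(1)
  have "(\<exists>f'. skew f' g U) \<and> same_statistics k ?T U"
    by (rule down.IH[OF punctured_down[OF P down.hyps(1,2)] two_valued_move[OF down.prems(2) down.hyps(1)]])
  moreover have "bracket (entries k ?T) (entries (Suc k) ?T) = bracket (entries k T) (entries (Suc k) T)"
    by (rule bracket_move_down_cell[OF P down.hyps(1,2) down.prems(2)])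
  moreover have "card (entries i ?T) = card (entries i T)" for i
    by (rule card_entries_move[OF punctured_finite[OF P] punctured_hole[OF P] down.hyps(1)])
  ultimately show ?case
    by (simp add: same_statistics_def)
next
  case (right T r c a U)
  let ?T = "T((r, c) := Some a, (r, Suc c) := None)"
  note P = right.prems(1)
  have "(\<exists>f'. skew f' g U) \<and> same_statistics k ?T U"
    by (rule right.IH[OF punctured_right[OF P right.hyps(1,2)] two_valued_move[OF right.prems(2) right.hyps(1)]])
  moreover have "bracket (entries k ?T) (entries (Suc k) ?T) = bracket (entries k T) (entries (Suc k) T)"
    by (rule bracket_move_right_cell[OF punctured_finite[OF P] punctured_hole[OF P] right.hyps(1)])
  moreover have "card (entries i ?T) = card (entries i T)" for i
    by (rule card_entries_move[OF punctured_finite[OF P] punctured_hole[OF P] right.hyps(1)])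
  ultimately show ?case
    by (simp add: same_statistics_def)
qed

text \<open>The hole moves down or to the right within the diagram of \<open>f\<close>, so the slide
  ends.\<close>

lemma slide_exists:
  assumes "punctured f g p T"
  shows "\<exists>U. slide p T U"
  using assms
proof (induction "2 * psize f - (fst p + snd p)" arbitrary: p T rule: less_induct)
  case less
  obtain r c where p: "p = (r, c)" by force
  have room: "r < psize f" "c < psize f"
    using subsetD[OF cells_square[OF puncturedD(1)[OF less.prems]] puncturedD(4)[OF less.prems]] p by auto
  show ?case
  proof (cases "\<exists>b. T (Suc r, c) = Some b \<and> (\<forall>a. T (r, Suc c) = Some a \<longrightarrow> b \<le> a)")
    case True
    then obtain b where b: "T (Suc r, c) = Some b" "\<forall>a. T (r, Suc c) = Some a \<longrightarrow> b \<le> a" by blast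
    have "\<exists>U. slide (Suc r, c) (T((r, c) := Some b, (Suc r, c) := None)) U"
      by (rule less.hyps[OF _ punctured_down[OF less.prems[unfolded p] b]]) (use room p in simp)
    then show ?thesis
      unfolding p using slide.down[of T r c b] b by blast
  next
    case no_down: False
    show ?thesis
    proof (cases "T (r, Suc c)")
      case None
      then have "T (Suc r, c) = None" using no_down by (cases "T (Suc r, c)") auto
      then show ?thesis
        unfolding p using slide.stop[of T r c] None by blast
    next
      case (Some a)
      have a: "\<forall>b. T (Suc r, c) = Some b \<longrightarrow> a < b"
        using no_down Some by (auto simp: not_le)
      have "\<exists>U. slide (r, Suc c) (T((r, c) := Some a, (r, Suc c) := None)) U"
        by (rule less.hyps[OF _ punctured_right[OF less.prems[unfolded p] Some a]]) (use room p in simp)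
      then show ?thesis
        unfolding p using slide.right[of T r c a] Some a by blast
    qed
  qed
qed

text \<open>Cutting the corner off the inner shape turns it into the hole.\<close>

lemma corner_punctured:
  assumes "has_skew_shape T \<nu> \<mu>" "corner \<mu> (r, c)" "semistandard T"
  shows "punctured (row \<nu>) ((row \<mu>)(r := c)) (r, c) T" "psize ((row \<mu>)(r := c)) < psize (row \<mu>)"
proof -
  have p: "par (row \<nu>)" "par (row \<mu>)"
    using assms(1) by (simp_all add: has_skew_shape_def par_row)
  have sub: "row \<mu> i \<le> row \<nu> i" for i
    using assms(1) by (simp add: has_skew_shape_def diagram_eq_cells cells_subset_iff)
  have dom: "dom T = cells (row \<nu>) - cells (row \<mu>)"
    using assms(1) by (simp add: has_skew_shape_def diagram_eq_cells)
  have c: "c < row \<mu> r" "\<not> Suc c < row \<mu> r" "\<not> c < row \<mu> (Suc r)"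
    using assms(2) by (simp_all add: corner_def diagram_eq_cells)
  then have rc: "row \<mu> r = Suc c" "row \<mu> (Suc r) \<le> c" by auto
  note rem = par_remove_corner[OF p(2) rc]
  have "(r, c) \<in> cells (row \<nu>)"
    using less_le_trans[OF c(1) sub[of r]] by simp
  moreover have "dom T = cells (row \<nu>) - cells ((row \<mu>)(r := c)) - {(r, c)}"
  proof -
    have "(r, c) \<in> cells (row \<mu>)" using c(1) by simp
    then show ?thesis unfolding rem(2) dom by blast
  qed
  moreover have "((row \<mu>)(r := c)) i \<le> row \<nu> i" for i
    using sub[of i] c(1) by (cases "i = r") simp_all
  ultimately show "punctured (row \<nu>) ((row \<mu>)(r := c)) (r, c) T"
    using rem p assms(3) by (simp add: punctured_def)
  show "psize ((row \<mu>)(r := c)) < psize (row \<mu>)"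
  proof -
    have "(r, c) \<in> cells (row \<mu>)" using c(1) by simp
    then show ?thesis
      unfolding psize_def rem(2) using par_finite_cells[OF p(2)] by (rule card_Diff1_less[rotated])
  qed
qed

lemma jdt_invariant:
  assumes "jdt T U" "semistandard T" "two_valued k T"
  shows "semistandard U \<and> same_statistics k T U"
proof -
  obtain \<nu> \<mu> r c where j: "has_skew_shape T \<nu> \<mu>" "corner \<mu> (r, c)" "slide (r, c) T U"
    using assms(1) unfolding jdt_def by (metis surj_pair)
  from slide_invariant[OF j(3) corner_punctured(1)[OF j(1,2) assms(2)] assms(3)]
  show ?thesis by (auto simp: skew_def)
qed

lemma jdt_rtrancl_invariant:
  assumes "jdt\<^sup>*\<^sup>* T U" "semistandard T" "two_valued k T"
  shows "semistandard U \<and> same_statistics k T U"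
  using assms(1)
proof (induction rule: rtranclp_induct)
  case base
  then show ?case using assms by (simp add: same_statistics_def)
next
  case (step U V)
  then show ?case
    using jdt_invariant[of U V k] by (simp add: same_statistics_def)
qed

text \<open>Each slide reduces the inner shape; as corner one may take the end of the last row.\<close>

lemma rectification_exists:
  assumes "skew f g T" "two_valued k T"
  shows "\<exists>U. jdt\<^sup>*\<^sup>* T U \<and> straight U"
  using assms
proof (induction "psize g" arbitrary: f g T rule: less_induct)
  case less
  have par: "par f" "par g" and dom: "dom T = cells f - cells g"
    and ss: "semistandard T" and sub: "\<And>i. g i \<le> f i"
    using less.prems(1) by (auto simp: skew_def)
  obtain \<nu> where \<nu>: "is_partition \<nu>" "row \<nu> = f" by (rule par_is_row[OF par(1)])
  obtain \<mu> where \<mu>: "is_partition \<mu>" "row \<mu> = g" by (rule par_is_row[OF par(2)])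
  show ?case
  proof (cases "\<mu> = []")
    case True
    then have "g = (\<lambda>_. 0)" using \<mu>(2) by (auto simp: row_def)
    then have "dom T = cells f" using dom by (auto simp: cells_def)
    then have "straight T" using par(1) straight_iff by blast
    then show ?thesis by blast
  next
    case False
    define r where "r = length \<mu> - 1"
    define c where "c = \<mu> ! r - 1"
    have r: "r < length \<mu>" "length \<mu> = Suc r" using False by (auto simp: r_def)
    then have "0 < \<mu> ! r" using \<mu>(1) by (simp add: is_partition_def)
    then have corner: "corner \<mu> (r, c)"
      using r by (auto simp: corner_def diagram_def c_def)
    have skew: "has_skew_shape T \<nu> \<mu>"
      using \<mu> \<nu> dom sub by (simp add: has_skew_shape_def diagram_eq_cells cells_subset_iff)
    note P = corner_punctured[OF skew corner ss]
    obtain U where U: "slide (r, c) T U" using slide_exists[OF P(1)] by blast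
    from slide_invariant[OF U P(1) less.prems(2)] obtain f' where
      f': "skew f' ((row \<mu>)(r := c)) U" "two_valued k U" by (auto simp: same_statistics_def)
    have "jdt T U" unfolding jdt_def using skew corner U by blast
    moreover obtain V where "jdt\<^sup>*\<^sup>* U V" "straight V"
      using less.hyps[OF P(2)[unfolded \<mu>(2)] f'[unfolded \<mu>(2)]] by blast
    ultimately show ?thesis
      by (meson converse_rtranclp_into_rtranclp)
  qed
qed

definition two_row_tableau :: "nat \<Rightarrow> nat \<Rightarrow> nat \<Rightarrow> filling" where
  "two_row_tableau k n j = (\<lambda>(r, c). if r = 0 \<and> c < n then Some k
     else if r = 0 \<and> c < 2 * n - j \<or> r = 1 \<and> c < j then Some (Suc k) else None)"

text \<open>Strictness of the columns leaves room for two rows only, and for larger letters only in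
  the second. So all smaller letters stand in the first row, and the second row consists of
  bracketed larger letters.\<close>

lemma straight_two_valued:
  assumes "straight U" and ss: "semistandard U" and two: "two_valued k U"
    and A: "card (entries k U) = n" and B: "card (entries (Suc k) U) = n"
  shows "bracket (entries k U) (entries (Suc k) U) \<le> n"
    "U = two_row_tableau k n (bracket (entries k U) (entries (Suc k) U))"
proof -
  obtain h where h: "par h" "dom U = cells h"
    using assms(1) straight_iff by auto
  have e: "c < h r \<longleftrightarrow> (\<exists>a. U (r, c) = Some a)" for r c
    by (rule dom_cells_iff[OF h(2)])
  have vals: "a = k \<or> a = Suc k" if "U p = Some a" for p a
    using two that unfolding two_valued_def by blast
  have below: "\<exists>b. U (r', c) = Some b \<and> b < a" if "U (r, c) = Some a" "r' < r" for r r' c a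
  proof -
    have "c < h r'" using e[of c r] that par_antimono[OF h(1), of r' r] by auto
    then obtain b where "U (r', c) = Some b" using e by blast
    then show ?thesis using semistandard_col[OF ss _ that(1,2)] by blast
  qed
  have row1: "a = Suc k" if a: "U (r, c) = Some a" and r: "0 < r" for r c a
  proof -
    obtain b where "U (0, c) = Some b" "b < a" using below[OF a r] by blast
    then show ?thesis using vals[of "(0, c)" b] vals[OF a] by auto
  qed
  have rows_ge2: "h r = 0" if r: "2 \<le> r" for r
  proof (rule ccontr)
    assume "h r \<noteq> 0"
    then obtain a where a: "U (r, 0) = Some a" using e[of 0 r] by auto
    obtain b where "U (1, 0) = Some b" "b < a" using below[OF a, of 1] r by auto
    then show False using row1[of 1 0 b] vals[OF a] by auto
  qed
  define l where "l = level U k"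
  have l: "par l" "cells l = entries k U"
  proof -
    have "{p. \<exists>a\<le>k. U p = Some a} = entries k U"
      using vals by (force simp: entries_def)
    then show "par l" "cells l = entries k U"
      using level_cells[OF assms(1) ss, of k] by (simp_all add: l_def)
  qed
  have l_zero: "l r = 0" if "1 \<le> r" for r
  proof (rule ccontr)
    assume "l r \<noteq> 0"
    then have "(r, 0) \<in> entries k U" using l(2) mem_cells[of r 0 l] by auto
    then show False using row1[of r 0 k] that by (auto simp: entries_def)
  qed
  have "psize l = n" using A l(2) by (simp add: psize_def)
  moreover have "psize l = l 0" using psize_eq_sum[of 1 l] l_zero by simp
  ultimately have l0: "l 0 = n" by simp
  have ones: "U (r, c) = Some k \<longleftrightarrow> r = 0 \<and> c < n" for r c
  proof -
    have "U (r, c) = Some k \<longleftrightarrow> (r, c) \<in> cells l" by (simp add: l(2) entries_def)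
    then show ?thesis using l0 l_zero[of r] by (cases r) auto
  qed
  have fin: "finite (entries i U)" for i
    using finite_entries[of U i] par_finite_cells[OF h(1)] h(2) by simp
  have "dom U = entries k U \<union> entries (Suc k) U"
    using vals by (force simp: entries_def)
  then have "psize h = card (entries k U \<union> entries (Suc k) U)"
    using h(2) by (simp add: psize_def)
  also have "\<dots> = 2 * n"
    using A B fin by (subst card_Un_disjoint) (auto simp: entries_def)
  finally have "psize h = 2 * n" .
  moreover have "psize h = h 0 + h 1"
    using psize_eq_sum[of 2 h] rows_ge2 by (simp add: numeral_2_eq_2)
  ultimately have sum: "h 0 + h 1 = 2 * n" by simp
  have h1: "h 1 \<le> h 0" by (rule par_antimono[OF h(1)]) simp
  have br: "bracket (entries k U) (entries (Suc k) U) = h 1"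
  proof (rule bracket_eqI)
    have "{p \<in> entries (Suc k) U. 0 < fst p} = Pair 1 ` {..<h 1}"
    proof (intro set_eqI iffI)
      fix p assume "p \<in> {p \<in> entries (Suc k) U. 0 < fst p}"
      then obtain r c where p: "p = (r, c)" "U (r, c) = Some (Suc k)" "0 < r"
        by (cases p) (auto simp: entries_def)
      then have "c < h r" using e by blast
      then show "p \<in> Pair 1 ` {..<h 1}"
        using p rows_ge2[of r] by (cases "r = 1") auto
    next
      fix p :: cell assume "p \<in> Pair 1 ` {..<h 1}"
      then obtain c where p: "p = (1, c)" "c < h 1" by auto
      then obtain a where "U (1, c) = Some a" using e by blast
      then show "p \<in> {p \<in> entries (Suc k) U. 0 < fst p}"
        using row1[of 1 c a] p by (simp add: entries_def)
    qed
    then show "stat (entries k U) (entries (Suc k) U) 0 = h 1"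
      by (simp add: stat_def card_image inj_on_def)
    then have s0: "stat (entries k U) (entries (Suc k) U) 0 = h 1" .
    fix s
    show "h 1 \<le> stat (entries k U) (entries (Suc k) U) s"
    proof (cases s)
      case 0
      then show ?thesis using s0 by simp
    next
      case (Suc s')
      have "{p \<in> entries k U. fst p < s} = entries k U"
        using ones Suc by (auto simp: entries_def)
      then show ?thesis using A sum h1 by (simp add: stat_def)
    qed
  qed
  show "bracket (entries k U) (entries (Suc k) U) \<le> n"
    unfolding br using sum h1 by simp
  have "U (r, c) = two_row_tableau k n (h 1) (r, c)" for r c
  proof (cases "U (r, c)")
    case None
    then have "\<not> c < h r" "\<not> (r = 0 \<and> c < n)" using e[of c r] ones[of r c] by auto
    then show ?thesis
      using None sum by (auto simp: two_row_tableau_def)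
  next
    case (Some a)
    then have c: "c < h r" using e by blast
    show ?thesis
    proof (cases "a = k")
      case True
      then show ?thesis using Some ones[of r c] by (simp add: two_row_tableau_def)
    next
      case False
      then have "a = Suc k" "\<not> (r = 0 \<and> c < n)" using vals[OF Some] Some ones[of r c] by auto
      moreover have "r = 0 \<or> r = 1" using c rows_ge2[of r] by (cases "2 \<le> r") auto
      ultimately show ?thesis using Some c sum by (auto simp: two_row_tableau_def)
    qed
  qed
  then show "U = two_row_tableau k n (bracket (entries k U) (entries (Suc k) U))"
    unfolding br by auto
qed

lemma is_partition_two_rows: "j \<le> n \<Longrightarrow> is_partition (two_rows n j)"
  by (auto simp: is_partition_def two_rows_def)

lemma row_two_rows: "j \<le> n \<Longrightarrow> row (two_rows n j) = (\<lambda>r. if r = 0 then 2 * n - j else if r = 1 then j else 0)"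
  by (auto simp: row_def two_rows_def fun_eq_iff less_Suc_eq nth_Cons split: nat.splits)

lemma dom_two_row_tableau:
  assumes "j \<le> n"
  shows "dom (two_row_tableau k n j) = cells (\<lambda>r. if r = 0 then 2 * n - j else if r = 1 then j else 0)"
  using assms by (auto simp: two_row_tableau_def cells_def split: if_splits)

lemma has_shape_two_row_tableau: "j \<le> n \<Longrightarrow> has_shape (two_row_tableau k n j) (two_rows n j)"
  by (simp add: has_shape_def is_partition_two_rows diagram_eq_cells row_two_rows dom_two_row_tableau)

text \<open>Every straight tableau reached by slides has the same statistics as \<open>T\<close> and
  is determined by them, which is why the choice of the slides does not matter.\<close>

lemma rect_two_valued:
  assumes T: "skew f g T" "two_valued k T"
    and n: "card (entries k T) = n" "card (entries (Suc k) T) = n"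
  shows "bracket (entries k T) (entries (Suc k) T) \<le> n"
    "rect T = two_row_tableau k n (bracket (entries k T) (entries (Suc k) T))"
proof -
  have ss: "semistandard T" using T(1) by (simp add: skew_def)
  have U: "bracket (entries k T) (entries (Suc k) T) \<le> n \<and>
      U = two_row_tableau k n (bracket (entries k T) (entries (Suc k) T))"
    if "jdt\<^sup>*\<^sup>* T U \<and> straight U" for U
  proof -
    have inv: "semistandard U" "same_statistics k T U"
      using jdt_rtrancl_invariant[of T U k] that ss T(2) by auto
    then show ?thesis
      using straight_two_valued[of U k n] that n by (simp add: same_statistics_def)
  qed
  obtain V where V: "jdt\<^sup>*\<^sup>* T V \<and> straight V" using rectification_exists[OF T] by blast
  show "bracket (entries k T) (entries (Suc k) T) \<le> n" using U[OF V] by simp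
  show "rect T = two_row_tableau k n (bracket (entries k T) (entries (Suc k) T))"
    unfolding rect_def
  proof (rule the_equality)
    show "jdt\<^sup>*\<^sup>* T (two_row_tableau k n (bracket (entries k T) (entries (Suc k) T))) \<and>
        straight (two_row_tableau k n (bracket (entries k T) (entries (Suc k) T)))"
      using U[OF V] V by metis
  qed (use U in blast)
qed

section \<open>Plethysm by power sums and by functions of degree two\<close>

lemma Sym_zero: "0 \<in> Sym"
  using Sym_sum[of "{}"] by simp

lemma Sym_sign: "f \<in> Sym \<Longrightarrow> (-1) ^ n * f \<in> Sym"
  by (cases "even n") (simp_all add: Sym_uminus)

lemma pgen_nth: "fps_nth pgen k = (if k = 0 then 0 else psym k)"
  by (simp add: pgen_def)

lemma elementary_ode_nth: "fps_nth (- alternate pgen) k = (if k = 0 then 0 else - ((-1) ^ k * psym k))"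
  by (simp add: alternate_nth pgen_nth)

lemma sym_endo_sign:
  "sym_endo \<phi> \<Longrightarrow> f \<in> Sym \<Longrightarrow> \<phi> ((-1) ^ n * f) = (-1) ^ n * \<phi> f"
  by (cases "even n") (simp_all add: sym_endo_uminus)

text \<open>By Newton's identities an endomorphism that fixes the power sums fixes the
  \<open>h\<^sub>n\<close> and \<open>e\<^sub>n\<close>.\<close>

lemma plethysm_psym_1:
  assumes P: "is_plethysm P"
  shows "P (psym 1) (hsym n) = hsym n" "P (psym 1) (esym n) = esym n"
proof -
  have \<phi>: "sym_endo (P (psym 1))" and p: "P (psym 1) (psym k) = psym k" if "1 \<le> k" for k
    using P that by (auto simp: is_plethysm_def)
  then have \<phi>: "sym_endo (P (psym 1))" by blast
  show "P (psym 1) (hsym n) = hsym n"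
  proof (rule endo_fixing_power_sums[OF \<phi>, of hsym pgen])
    show "euler (Abs_fps hsym) = pgen * Abs_fps hsym"
      using newton_hsym by (simp add: hgen_def)
  qed (simp_all add: Sym_hsym hsym_0 pgen_nth Sym_psym Sym_zero p[unfolded One_nat_def])
  show "P (psym 1) (esym n) = esym n"
  proof (rule endo_fixing_power_sums[OF \<phi>, of esym "- alternate pgen"])
    show "euler (Abs_fps esym) = - alternate pgen * Abs_fps esym"
      using newton_esym by (simp add: egen_def)
    fix k :: nat assume k: "1 \<le> k"
    show "P (psym 1) (fps_nth (- alternate pgen) k) = fps_nth (- alternate pgen) k"
      unfolding elementary_ode_nth using k
      by (simp add: sym_endo_uminus[OF \<phi>] sym_endo_sign[OF \<phi>] Sym_sign Sym_psym p del: One_nat_def)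
  qed (simp_all add: Sym_esym esym_0 alternate_nth pgen_nth Sym_psym Sym_zero Sym_sign Sym_uminus)
qed

lemma plethysm_psym_2:
  assumes P: "is_plethysm P"
  shows "P (psym 2) (hsym n) = signed_square hsym n"
    "P (psym 2) (esym n) = (-1) ^ n * signed_square esym n"
proof -
  have p: "P (psym 2) (psym k) = psym (2 * k)" if "1 \<le> k" for k
    using P that by (simp add: is_plethysm_def)
  have "\<forall>k\<ge>1. sym_endo (P (psym k))" using P by (simp add: is_plethysm_def)
  then have \<phi>: "sym_endo (P (psym 2))" by simp
  have "P (psym 2) (hsym n) = 1 ^ n * signed_square hsym n"
  proof (rule endo_doubling_power_sums[OF \<phi>, of hsym pgen])
    show "euler (Abs_fps hsym) = pgen * Abs_fps hsym"
      using newton_hsym by (simp add: hgen_def)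
  qed (simp_all add: Sym_hsym hsym_0 pgen_nth Sym_psym Sym_zero p)
  then show "P (psym 2) (hsym n) = signed_square hsym n" by simp
  show "P (psym 2) (esym n) = (-1) ^ n * signed_square esym n"
  proof (rule endo_doubling_power_sums[OF \<phi>, of esym "- alternate pgen"])
    show "euler (Abs_fps esym) = - alternate pgen * Abs_fps esym"
      using newton_esym by (simp add: egen_def)
    fix k :: nat assume k: "1 \<le> k"
    show "P (psym 2) (fps_nth (- alternate pgen) k) = (-1) ^ k * fps_nth (- alternate pgen) (2 * k)"
      unfolding elementary_ode_nth using k
      by (simp add: sym_endo_uminus[OF \<phi>] sym_endo_sign[OF \<phi>] Sym_sign Sym_psym p)
  qed (simp_all add: Sym_esym esym_0 alternate_nth pgen_nth Sym_psym Sym_zero Sym_sign Sym_uminus)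
qed

lemma hstrip_by_two_zero: "{\<nu>. hstrip_by 2 (\<lambda>_. 0) \<nu>} = {row [2]}"
proof -
  have row: "row [2] = (\<lambda>i. if i = 0 then 2 else 0)"
    by (auto simp: row_def fun_eq_iff)
  have "par (row [2])" by (rule par_row) (simp add: is_partition_def)
  moreover have "\<forall>i\<ge>1. row [2] i = 0" by (simp add: row)
  from psize_eq_sum[OF this] have "psize (row [2]) = 2" by (simp add: row)
  ultimately have "hstrip_by 2 (\<lambda>_. 0) (row [2])"
    by (simp add: hstrip_by_def hstrip_def par_zero) (simp add: row)
  moreover have "\<nu> = row [2]" if h: "hstrip_by 2 (\<lambda>_. 0) \<nu>" for \<nu>
  proof -
    have z: "\<nu> (Suc i) = 0" for i using h by (simp add: hstrip_by_def hstrip_def)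
    then have "\<forall>i\<ge>1. \<nu> i = 0" by (metis One_nat_def Suc_le_D)
    from psize_eq_sum[OF this] have "\<nu> 0 = 2" using h by (simp add: hstrip_by_def)
    then have "\<nu> i = row [2] i" for i
      using z by (cases i) (simp_all add: row)
    then show ?thesis by blast
  qed
  ultimately show ?thesis by blast
qed

text \<open>Multiply \<open>s\<^sub>\<emptyset> = 1\<close> by \<open>h\<^sub>2\<close>.\<close>

lemma schur_two: "schur [2] = hsym 2"
  using pieri[OF par_zero, of 2] unfolding hstrip_by_two_zero
  by (simp add: schur_fun_zero schur_eq_schur_fun is_partition_def)

lemma conj_par_zero: "conj_par (\<lambda>_. 0) = (\<lambda>_. 0)"
  by (simp add: conj_par_def cells_def rows_def fun_eq_iff)

lemma schur_one_one: "schur [1, 1] = esym 2"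
proof -
  have "cells (conj_par (row [2])) = cells (row [1, 1])"
  proof -
    have "par (row [2])" by (rule par_row) (simp add: is_partition_def)
    from cells_conj_par[OF this] show ?thesis
      by (auto simp: row_def cells_def image_iff less_Suc_eq nth_Cons split: nat.splits if_splits)
  qed
  then have "conj_par (row [2]) = row [1, 1]" by (simp only: cells_inject)
  then show ?thesis
    using dual_pieri_conjugate[OF par_zero, of 2] unfolding hstrip_by_two_zero
    by (simp add: conj_par_zero schur_fun_zero schur_eq_schur_fun is_partition_def)
qed

lemma newton_two:
  "of_nat 2 * hsym 2 = psym 1 * psym 1 + psym 2"
  "of_nat 2 * esym 2 = psym 1 * psym 1 - psym 2"
proof -
  have h: "of_nat n * hsym n = (\<Sum>i=0..n. fps_nth pgen i * hsym (n - i))" for n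
    using arg_cong[OF newton_hsym, of "\<lambda>f. fps_nth f n"] by (simp add: euler_nth hgen_def fps_mult_nth)
  have e: "of_nat n * esym n = (\<Sum>i=0..n. fps_nth (- alternate pgen) i * esym (n - i))" for n
    using arg_cong[OF newton_esym, of "\<lambda>f. fps_nth f n"]
    by (simp only: euler_nth egen_def fps_mult_nth fps_nth_Abs_fps)
  show "of_nat 2 * hsym 2 = psym 1 * psym 1 + psym 2"
    using h[of 1] h[of 2] by (simp add: pgen_nth hsym_0 numeral_2_eq_2)
  show "of_nat 2 * esym 2 = psym 1 * psym 1 - psym 2"
    using e[of 1] e[of 2] unfolding elementary_ode_nth by (simp add: esym_0 numeral_2_eq_2)
qed

lemma plethysm_degree_two:
  assumes P: "is_plethysm P" and g: "g \<in> Sym" "P (psym 1) g = g"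
  shows "of_nat 2 * P (schur [2]) g = g\<^sup>2 + P (psym 2) g"
    "of_nat 2 * P (schur [1, 1]) g = g\<^sup>2 - P (psym 2) g"
proof -
  have \<phi>: "sym_endo (\<lambda>f. P f g)" using P g by (simp add: is_plethysm_def)
  have add: "P (a + b) g = P a g + P b g" if "a \<in> Sym" "b \<in> Sym" for a b
    using \<phi> that unfolding sym_endo_def by blast
  have sq: "P (psym 1 * psym 1) g = g\<^sup>2"
    using sym_endo_mult[OF \<phi> Sym_psym[of 1] Sym_psym[of 1]] g by (simp add: power2_eq_square)
  have "of_nat 2 * P (hsym 2) g = P (psym 1 * psym 1 + psym 2) g"
    using sym_endo_of_nat_mult[OF \<phi> Sym_hsym, of 2 2] unfolding newton_two by simp
  then show "of_nat 2 * P (schur [2]) g = g\<^sup>2 + P (psym 2) g"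
    by (simp only: schur_two add Sym_mult Sym_psym sq)
  have "of_nat 2 * P (esym 2) g = P (psym 1 * psym 1 + - psym 2) g"
    using sym_endo_of_nat_mult[OF \<phi> Sym_esym, of 2 2] unfolding newton_two by simp
  then show "of_nat 2 * P (schur [1, 1]) g = g\<^sup>2 - P (psym 2) g"
    by (simp only: schur_one_one add Sym_mult Sym_psym Sym_uminus sq sym_endo_uminus[OF \<phi>]) simp
qed

lemma split_by_sign:
  fixes F :: "'a \<Rightarrow> 'b :: comm_ring_1" and s :: "'a \<Rightarrow> int"
  assumes "finite S" "\<And>x. x \<in> S \<Longrightarrow> s x = 1 \<or> s x = -1"
  shows "sum F S + (\<Sum>x\<in>S. of_int (s x) * F x) = of_nat 2 * sum F {x \<in> S. s x = 1}"
    "sum F S - (\<Sum>x\<in>S. of_int (s x) * F x) = of_nat 2 * sum F {x \<in> S. s x = -1}"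
proof -
  let ?A = "{x \<in> S. s x = 1}" and ?B = "{x \<in> S. s x = -1}"
  have S: "S = ?A \<union> ?B" using assms(2) by blast
  have fin: "finite ?A" "finite ?B" and disj: "?A \<inter> ?B = {}" using assms(1) by auto
  have split: "sum G S = sum G ?A + sum G ?B" for G :: "'a \<Rightarrow> 'b"
    using sum.union_disjoint[OF fin disj, of G] by (simp only: flip: S)
  have "(\<Sum>x\<in>?A. of_int (s x) * F x) = sum F ?A" by (rule sum.cong) auto
  moreover have "(\<Sum>x\<in>?B. of_int (s x) * F x) = - sum F ?B"
    unfolding sum_negf[symmetric] by (rule sum.cong) auto
  ultimately show "sum F S + (\<Sum>x\<in>S. of_int (s x) * F x) = of_nat 2 * sum F ?A"
    "sum F S - (\<Sum>x\<in>S. of_int (s x) * F x) = of_nat 2 * sum F ?B"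
    unfolding split by simp_all
qed

section \<open>Tableaux in which every part is doubled\<close>

lemma length_double: "length (double xs) = 2 * length xs"
  by (induction xs) (simp_all add: double_def)

lemma double_nth: "i < length xs \<Longrightarrow> double xs ! (2 * i) = xs ! i \<and> double xs ! Suc (2 * i) = xs ! i"
proof (induction xs arbitrary: i)
  case (Cons x xs)
  have "double (x # xs) = x # x # double xs" by (simp add: double_def)
  then show ?case using Cons by (cases i) auto
qed simp

lemma tableaux_eq_tabs: "tableaux \<alpha> = tabs (length \<alpha>) (\<lambda>i. \<alpha> ! i)"
proof -
  have "has_content T \<alpha> \<longleftrightarrow> (\<forall>i. content T (Suc i) = (if i < length \<alpha> then \<alpha> ! i else 0))"
    if ss: "semistandard T" for T
  proof -
    have "{p. T p = Some 0} = {}" using semistandard_pos[OF ss] by blast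
    then have zero: "content T 0 = 0" by (simp only: content_def card.empty)
    show ?thesis
    proof
      assume "has_content T \<alpha>"
      then have h: "content T k = (if 1 \<le> k \<and> k \<le> length \<alpha> then \<alpha> ! (k - 1) else 0)" for k
        by (simp add: has_content_def)
      show "\<forall>i. content T (Suc i) = (if i < length \<alpha> then \<alpha> ! i else 0)"
        using h[of "Suc _"] by (simp add: Suc_le_eq)
    next
      assume h: "\<forall>i. content T (Suc i) = (if i < length \<alpha> then \<alpha> ! i else 0)"
      have "content T k = (if 1 \<le> k \<and> k \<le> length \<alpha> then \<alpha> ! (k - 1) else 0)" for k
        using zero h by (cases k) (simp_all add: Suc_le_eq)
      then show "has_content T \<alpha>" by (simp add: has_content_def)
    qed
  qed
  then show ?thesis
    unfolding tableaux_def tabs_def by blast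
qed

lemma content_eq_card_entries: "content T k = card (entries k T)"
  by (simp add: content_def entries_def)

lemma entries_subfilling: "entries k (subfilling S T) = (if k \<in> S then entries k T else {})"
  by (auto simp: entries_def subfilling_def restrict_map_def split: if_splits)

lemma entries_eq_level_diff:
  assumes "straight T" "semistandard T"
  shows "entries (Suc k) T = cells (level T (Suc k)) - cells (level T k)"
  unfolding level_cells(2)[OF assms] entries_def by (auto simp: le_Suc_eq)

lemma semistandard_submap:
  assumes "semistandard T" "\<And>p a. U p = Some a \<Longrightarrow> T p = Some a"
  shows "semistandard U"
  using assms unfolding semistandard_def by blast

lemma skew_subfilling:
  assumes T: "straight T" "semistandard T"
  shows "skew (level T (Suc (Suc k))) (level T k) (subfilling {Suc k, Suc (Suc k)} T)"
proof -
  note lc = level_cells[OF T]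
  have "\<forall>i. level T k i \<le> level T (Suc (Suc k)) i"
    unfolding cells_subset_iff[symmetric] lc(2) by auto
  moreover have "dom (subfilling {Suc k, Suc (Suc k)} T) = cells (level T (Suc (Suc k))) - cells (level T k)"
    unfolding lc(2) by (auto simp: subfilling_def restrict_map_def le_Suc_eq split: if_splits)
  moreover have "semistandard (subfilling {Suc k, Suc (Suc k)} T)"
  proof (rule semistandard_submap[OF T(2)])
    show "T p = Some a" if "subfilling {Suc k, Suc (Suc k)} T p = Some a" for p a
      using that by (simp add: subfilling_def restrict_map_def split: if_splits)
  qed
  ultimately show ?thesis by (simp add: skew_def lc(1))
qed

lemma two_valued_subfilling: "two_valued k (subfilling {k, Suc k} T)"
  by (auto simp: two_valued_def subfilling_def restrict_map_def split: if_splits)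

text \<open>The number \<open>j\<close> of the statement for the entries \<open>2 i + 1\<close> and
  \<open>2 i + 2\<close>.\<close>

definition pair_bracket :: "filling \<Rightarrow> nat \<Rightarrow> nat" where
  "pair_bracket Q i = cbracket (level Q (2 * i)) (level Q (2 * i + 2)) (level Q (2 * i + 1))"

lemma Q_part_eq:
  assumes Q: "straight Q" "semistandard Q"
    and n: "content Q (2 * i + 1) = n" "content Q (2 * i + 2) = n"
  shows "pair_bracket Q i \<le> n" "Q_part Q i = two_row_tableau (2 * i + 1) n (pair_bracket Q i)"
proof -
  let ?k = "Suc (2 * i)"
  let ?T = "subfilling {?k, Suc ?k} Q"
  have ent: "entries ?k ?T = entries ?k Q" "entries (Suc ?k) ?T = entries (Suc ?k) Q"
    by (simp_all add: entries_subfilling)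
  have br: "bracket (entries ?k ?T) (entries (Suc ?k) ?T) = pair_bracket Q i"
    unfolding ent entries_eq_level_diff[OF Q] pair_bracket_def cbracket_def by simp
  have c: "card (entries ?k ?T) = n" "card (entries (Suc ?k) ?T) = n"
    using n unfolding ent content_eq_card_entries by simp_all
  note r = rect_two_valued[OF skew_subfilling[OF Q, of "2 * i"] two_valued_subfilling c, unfolded br]
  show "pair_bracket Q i \<le> n" by (rule r(1))
  show "Q_part Q i = two_row_tableau (2 * i + 1) n (pair_bracket Q i)"
    using r(2) by (simp add: Q_part_def)
qed

lemma has_shape_unique: "has_shape T \<mu> \<Longrightarrow> has_shape T \<nu> \<Longrightarrow> \<mu> = \<nu>"
  using shape_eqI by metis

lemma two_rows_inject: "j \<le> n \<Longrightarrow> j' \<le> n \<Longrightarrow> two_rows n j = two_rows n j' \<Longrightarrow> j = j'"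
  by (drule arg_cong[of _ _ "\<lambda>xs. row xs 1"]) (simp add: row_two_rows)

lemma two_cols_inject:
  assumes "j \<le> n" "j' \<le> n" "two_cols n j = two_cols n j'"
  shows "j = j'"
  using arg_cong[OF assms(3), of length] assms(1,2) by (simp add: two_cols_def)

context
  fixes lam :: "nat list" and Q :: filling
  assumes Q: "Q \<in> tableaux (double lam)"
begin

lemma tableau_facts: "straight Q" "semistandard Q"
    "i < length lam \<Longrightarrow> content Q (2 * i + 1) = lam ! i" "i < length lam \<Longrightarrow> content Q (2 * i + 2) = lam ! i"
  using Q double_nth[of i lam] by (auto simp: tableaux_eq_tabs tabs_def length_double)

lemma pair_bracket_le: "i < length lam \<Longrightarrow> pair_bracket Q i \<le> lam ! i"
  using Q_part_eq(1)[of Q i "lam ! i"] tableau_facts by simp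

lemma has_shape_Q_part: "i < length lam \<Longrightarrow> has_shape (Q_part Q i) (two_rows (lam ! i) (pair_bracket Q i))"
  using Q_part_eq[of Q i "lam ! i"] tableau_facts has_shape_two_row_tableau by simp

lemma sign_exp_eq:
  assumes "i < length lam"
  shows "sign_exp lam Q i = pair_bracket Q i"
  unfolding sign_exp_def
proof (rule the_equality)
  show "pair_bracket Q i \<le> lam ! i \<and> has_shape (Q_part Q i) (two_rows (lam ! i) (pair_bracket Q i))"
    using pair_bracket_le[OF assms] has_shape_Q_part[OF assms] by simp
  fix j assume "j \<le> lam ! i \<and> has_shape (Q_part Q i) (two_rows (lam ! i) j)"
  then show "j = pair_bracket Q i"
    using has_shape_unique has_shape_Q_part[OF assms] pair_bracket_le[OF assms] two_rows_inject by metis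
qed

lemma sign_eq_chain_sign: "sign lam Q = chain_sign (length lam) (level Q)"
  unfolding sign_def chain_sign_def
  by (rule prod.cong) (simp_all add: sign_exp_eq pair_bracket_def)

lemma schur_shape_level: "schur (shape Q) = schur_fun (level Q (2 * length lam))"
  using Q level_tabs[of Q "2 * length lam" _ "2 * length lam"] schur_shape[OF tableau_facts(1)]
  by (simp add: tableaux_eq_tabs length_double)

end

lemma sum_tableaux_double:
  "(\<Sum>Q\<in>tableaux (double lam). G (level Q)) = (\<Sum>c\<in>strip_chains (2 * length lam) (\<lambda>i. double lam ! i). G c)"
  unfolding tableaux_eq_tabs length_double by (rule sum.reindex_bij_betw[OF bij_betw_level])

lemma finite_tableaux_double: "finite (tableaux (double lam))"
  unfolding tableaux_eq_tabs using bij_betw_finite[OF bij_betw_level] finite_chains by blast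

lemma prod_lessThan_double:
  fixes f :: "nat \<Rightarrow> 'a :: comm_monoid_mult"
  shows "(\<Prod>i<2 * L. f i) = (\<Prod>i<L. f (2 * i) * f (Suc (2 * i)))"
  by (induction L) (simp_all add: mult.assoc)

lemma prod_list_map_nth: "prod_list (map f xs) = (\<Prod>i<length xs. f (xs ! i) :: 'a :: comm_monoid_mult)"
  by (simp add: prod.list_conv_set_nth atLeast0LessThan)

text \<open>Stated for any family that satisfies the Pieri rule with \<open>q\<close>, so that it
  covers both \<open>s\<^sub>\<nu>\<close> with \<open>h\<^sub>n\<close> and
  \<open>s\<^bsub>\<nu>'\<^esub>\<close> with \<open>e\<^sub>n\<close>.\<close>

lemma square_expansion:
  assumes "\<sigma> (\<lambda>_. 0) = 1" and pieri: "\<And>\<mu> n. par \<mu> \<Longrightarrow> \<sigma> \<mu> * q n = (\<Sum>\<nu> | hstrip_by n \<mu> \<nu>. \<sigma> \<nu>)"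
  shows "(prod_list (map q lam))\<^sup>2 = (\<Sum>Q\<in>tableaux (double lam). \<sigma> (level Q (2 * length lam)) :: mps)"
proof -
  have "(\<Sum>Q\<in>tableaux (double lam). \<sigma> (level Q (2 * length lam))) = (\<Prod>i<2 * length lam. q (double lam ! i))"
    unfolding sum_tableaux_double[of "\<lambda>c. \<sigma> (c (2 * length lam))"] by (rule pieri_chains[OF assms])
  also have "\<dots> = (\<Prod>i<length lam. q (lam ! i) * q (lam ! i))"
    unfolding prod_lessThan_double by (rule prod.cong) (simp_all add: double_nth)
  also have "\<dots> = (prod_list (map q lam))\<^sup>2"
    by (simp add: prod_list_map_nth power2_eq_square prod.distrib)
  finally show ?thesis ..
qed

lemma signed_square_expansion:
  assumes "\<sigma> (\<lambda>_. 0) = 1" and pieri: "\<And>\<mu> n. par \<mu> \<Longrightarrow> \<sigma> \<mu> * q n = (\<Sum>\<nu> | hstrip_by n \<mu> \<nu>. \<sigma> \<nu>)"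
  shows "(\<Prod>i<length lam. signed_square q (lam ! i)) =
    (\<Sum>Q\<in>tableaux (double lam). of_int (sign lam Q) * \<sigma> (level Q (2 * length lam)) :: mps)"
proof -
  have "(\<Sum>Q\<in>tableaux (double lam). of_int (sign lam Q) * \<sigma> (level Q (2 * length lam))) =
      (\<Sum>Q\<in>tableaux (double lam). of_int (chain_sign (length lam) (level Q)) * \<sigma> (level Q (2 * length lam)))"
    by (intro sum.cong refl) (simp add: sign_eq_chain_sign)
  also have "\<dots> = (\<Prod>i<length lam. signed_square q (lam ! i))"
    unfolding sum_tableaux_double[of "\<lambda>c. of_int (chain_sign (length lam) c) * \<sigma> (c (2 * length lam))"]
    by (rule pieri_signed_chains[OF assms]) (simp_all add: double_nth)
  finally show ?thesis ..
qed

lemma sign_values: "sign lam Q = 1 \<or> sign lam Q = -1"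
proof -
  have "\<bar>sign lam Q\<bar> = 1" by (simp add: sign_def abs_prod power_abs)
  then show ?thesis by linarith
qed

lemma sign_c_values: "sign_c lam Q = 1 \<or> sign_c lam Q = -1"
proof -
  have "\<bar>sign_c lam Q\<bar> = 1" by (simp add: sign_c_def abs_prod power_abs)
  then show ?thesis by linarith
qed

section \<open>Conjugate tableaux\<close>

lemma conjugate_conjugate [simp]: "conjugate (conjugate T) = T"
  by (auto simp: conjugate_def)

lemma dom_conjugate: "dom (conjugate T) = prod.swap ` dom T"
  by (force simp: conjugate_def dom_def)

lemma straight_conjugate: "straight T \<Longrightarrow> straight (conjugate T)"
  unfolding straight_iff dom_conjugate using par_conj_par cells_conj_par by metis

lemma content_conjugate: "content (conjugate T) k = content T k"
proof -
  have "{p. conjugate T p = Some k} = prod.swap ` {p. T p = Some k}"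
    by (force simp: conjugate_def)
  then show ?thesis by (simp add: content_def card_image)
qed

lemma conj_tableaux_eq: "conj_tableaux \<alpha> = conjugate ` tableaux \<alpha>"
proof (intro set_eqI iffI)
  fix Q assume "Q \<in> conj_tableaux \<alpha>"
  then have "conjugate Q \<in> tableaux \<alpha>"
    by (simp add: conj_tableaux_def tableaux_def straight_conjugate has_content_def content_conjugate)
  then show "Q \<in> conjugate ` tableaux \<alpha>"
    by (metis conjugate_conjugate imageI)
next
  fix Q assume "Q \<in> conjugate ` tableaux \<alpha>"
  then show "Q \<in> conj_tableaux \<alpha>"
    by (auto simp: conj_tableaux_def tableaux_def straight_conjugate has_content_def content_conjugate)
qed

lemma inj_conjugate: "inj_on conjugate S"
  by (metis conjugate_conjugate inj_onI)

lemma conjugate_subfilling: "conjugate (subfilling S (conjugate T)) = subfilling S T"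
  by (auto simp: fun_eq_iff conjugate_def subfilling_def restrict_map_def)

lemma Qc_part_conjugate: "Qc_part (conjugate Q) i = conjugate (Q_part Q i)"
  by (simp add: Qc_part_def Q_part_def conjugate_subfilling)

lemma is_partition_two_cols: "is_partition (two_cols n j)"
  by (auto simp: is_partition_def two_cols_def sorted_wrt_iff_nth_less nth_append)

text \<open>Conjugating \<open>(2 n - j, j)\<close> gives \<open>j\<close> rows of length
  \<open>2\<close>, so the number called \<open>j\<close> for conjugate tableaux is
  \<open>n - j\<close>.\<close>

lemma has_shape_conjugate_two_row_tableau:
  assumes "j \<le> n"
  shows "has_shape (conjugate (two_row_tableau k n j)) (two_cols n (n - j))"
proof -
  have r: "row (two_cols n (n - j)) = (\<lambda>r. if r < j then 2 else if r < 2 * n - j then 1 else 0)"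
    using assms by (auto simp: row_def two_cols_def fun_eq_iff nth_append)
  have "dom (conjugate (two_row_tableau k n j)) = cells (row (two_cols n (n - j)))"
    unfolding r dom_conjugate dom_two_row_tableau[OF assms] using assms
    by (auto simp: cells_def image_iff less_Suc_eq numeral_2_eq_2 split: if_splits)
  then show ?thesis
    by (simp add: has_shape_def is_partition_two_cols diagram_eq_cells)
qed

lemma schur_shape_conjugate: "straight Q \<Longrightarrow> schur (shape (conjugate Q)) = schur_fun (conj_par (rows (dom Q)))"
  by (simp add: schur_shape straight_conjugate dom_conjugate conj_par_def straight_rows(2))

context
  fixes lam :: "nat list" and Q :: filling
  assumes Q: "Q \<in> tableaux (double lam)"
begin

lemma has_shape_Qc_part:
  "i < length lam \<Longrightarrow> has_shape (Qc_part (conjugate Q) i) (two_cols (lam ! i) (lam ! i - pair_bracket Q i))"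
  using Q_part_eq[of Q i "lam ! i"] tableau_facts[OF Q] has_shape_conjugate_two_row_tableau
  by (simp add: Qc_part_conjugate)

lemma sign_exp_c_eq:
  assumes "i < length lam"
  shows "sign_exp_c lam (conjugate Q) i = lam ! i - pair_bracket Q i"
  unfolding sign_exp_c_def
proof (rule the_equality)
  show "lam ! i - pair_bracket Q i \<le> lam ! i \<and>
      has_shape (Qc_part (conjugate Q) i) (two_cols (lam ! i) (lam ! i - pair_bracket Q i))"
    using has_shape_Qc_part[OF assms] by simp
  fix j assume "j \<le> lam ! i \<and> has_shape (Qc_part (conjugate Q) i) (two_cols (lam ! i) j)"
  then show "j = lam ! i - pair_bracket Q i"
    using has_shape_unique has_shape_Qc_part[OF assms] two_cols_inject[of _ "lam ! i"] by (metis diff_le_self)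
qed

lemma sign_c_conjugate: "sign_c lam (conjugate Q) = (\<Prod>i<length lam. (-1) ^ (lam ! i)) * sign lam Q"
proof -
  have "(-1) ^ sign_exp_c lam (conjugate Q) i = ((-1) ^ (lam ! i) * (-1) ^ sign_exp lam Q i :: int)"
    if "i < length lam" for i
  proof -
    have "even (lam ! i - pair_bracket Q i) \<longleftrightarrow> even (lam ! i + pair_bracket Q i)"
      using pair_bracket_le[OF Q that] by (simp add: even_diff_nat)
    then show ?thesis
      unfolding sign_exp_c_eq[OF that] sign_exp_eq[OF Q that] power_add[symmetric]
      by (simp add: minus_one_power_iff)
  qed
  then show ?thesis
    by (simp add: sign_c_def sign_def prod.distrib[symmetric])
qed

lemma schur_shape_conjugate_level: "schur (shape (conjugate Q)) = schur_fun (conj_par (level Q (2 * length lam)))"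
  using Q level_tabs[of Q "2 * length lam" _ "2 * length lam"] schur_shape_conjugate[OF tableau_facts(1)[OF Q]]
  by (simp add: tableaux_eq_tabs length_double)

end

theorem theorem1:
  fixes P :: "mps \<Rightarrow> mps \<Rightarrow> mps" and lam :: "nat list"
  assumes "is_plethysm P" and "is_partition lam"
  shows
    "((\<forall>Q\<in>tableaux (double lam). \<forall>i<length lam.
         \<exists>j\<le>lam ! i. has_shape (Q_part Q i) (two_rows (lam ! i) j)) \<and>
      (hsym_part lam)\<^sup>2 = (\<Sum>Q\<in>tableaux (double lam). schur (shape Q)) \<and>
      P (schur [2]) (hsym_part lam) =
        (\<Sum>Q\<in>{Q \<in> tableaux (double lam). sign lam Q = 1}. schur (shape Q)) \<and>
      P (schur [1, 1]) (hsym_part lam) =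
        (\<Sum>Q\<in>{Q \<in> tableaux (double lam). sign lam Q = -1}. schur (shape Q))) \<and>
     ((\<forall>Q\<in>conj_tableaux (double lam). \<forall>i<length lam.
         \<exists>j\<le>lam ! i. has_shape (Qc_part Q i) (two_cols (lam ! i) j)) \<and>
      (esym_part lam)\<^sup>2 = (\<Sum>Q\<in>conj_tableaux (double lam). schur (shape Q)) \<and>
      P (schur [2]) (esym_part lam) =
        (\<Sum>Q\<in>{Q \<in> conj_tableaux (double lam). sign_c lam Q = 1}. schur (shape Q)) \<and>
      P (schur [1, 1]) (esym_part lam) =
        (\<Sum>Q\<in>{Q \<in> conj_tableaux (double lam). sign_c lam Q = -1}. schur (shape Q)))"
proof -
  let ?T = "tableaux (double lam)" and ?C = "conj_tableaux (double lam)" and ?N = "2 * length lam"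
  note P = assms(1)
  have endo: "sym_endo (P (psym 1))" "sym_endo (P (psym 2))"
    using P by (simp_all add: is_plethysm_def)
  have finC: "finite ?C"
    unfolding conj_tableaux_eq by (rule finite_imageI[OF finite_tableaux_double])
  have h: "hsym_part lam \<in> Sym" "P (psym 1) (hsym_part lam) = hsym_part lam"
    "P (psym 2) (hsym_part lam) = (\<Prod>i<length lam. signed_square hsym (lam ! i))"
    using sym_endo_prod_list[where F = hsym and xs = lam, OF endo(1) Sym_hsym] sym_endo_prod_list[where F = hsym and xs = lam, OF endo(2) Sym_hsym]
    unfolding hsym_part_def plethysm_psym_1[OF P] plethysm_psym_2[OF P] by (simp_all add: prod_list_map_nth)
  have e: "esym_part lam \<in> Sym" "P (psym 1) (esym_part lam) = esym_part lam"
    "P (psym 2) (esym_part lam) = (\<Prod>i<length lam. (-1) ^ (lam ! i) * signed_square esym (lam ! i))"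
    using sym_endo_prod_list[where F = esym and xs = lam, OF endo(1) Sym_esym] sym_endo_prod_list[where F = esym and xs = lam, OF endo(2) Sym_esym]
    unfolding esym_part_def plethysm_psym_1[OF P] plethysm_psym_2[OF P] by (simp_all add: prod_list_map_nth)
  have hsq: "(hsym_part lam)\<^sup>2 = (\<Sum>Q\<in>?T. schur (shape Q))"
  proof -
    have "(prod_list (map hsym lam))\<^sup>2 = (\<Sum>Q\<in>?T. schur_fun (level Q ?N))"
      by (rule square_expansion) (simp_all only: schur_fun_zero pieri)
    then show ?thesis
      by (simp add: hsym_part_def schur_shape_level)
  qed
  have hsigned: "P (psym 2) (hsym_part lam) = (\<Sum>Q\<in>?T. of_int (sign lam Q) * schur (shape Q))"
  proof -
    have "(\<Prod>i<length lam. signed_square hsym (lam ! i)) = (\<Sum>Q\<in>?T. of_int (sign lam Q) * schur_fun (level Q ?N))"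
      by (rule signed_square_expansion) (simp_all only: schur_fun_zero pieri)
    then show ?thesis
      by (simp add: h(3) schur_shape_level)
  qed
  have cz: "schur_fun (conj_par (\<lambda>_. 0)) = 1"
    by (simp add: schur_fun_zero conj_par_zero)
  have sumC: "sum G ?C = (\<Sum>Q\<in>?T. G (conjugate Q))" for G :: "filling \<Rightarrow> mps"
    unfolding conj_tableaux_eq using sum.reindex[OF inj_conjugate] by (simp add: comp_def)
  have esq: "(esym_part lam)\<^sup>2 = (\<Sum>Q\<in>?C. schur (shape Q))"
  proof -
    have "(prod_list (map esym lam))\<^sup>2 = (\<Sum>Q\<in>?T. schur_fun (conj_par (level Q ?N)))"
      by (rule square_expansion[of "\<lambda>f. schur_fun (conj_par f)"]) (simp_all only: cz dual_pieri_conjugate)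
    then show ?thesis
      by (simp add: esym_part_def sumC schur_shape_conjugate_level)
  qed
  have esigned: "P (psym 2) (esym_part lam) = (\<Sum>Q\<in>?C. of_int (sign_c lam Q) * schur (shape Q))"
  proof -
    let ?s = "\<Prod>i<length lam. (-1) ^ (lam ! i) :: mps"
    have "(\<Prod>i<length lam. signed_square esym (lam ! i)) =
        (\<Sum>Q\<in>?T. of_int (sign lam Q) * schur_fun (conj_par (level Q ?N)))"
      by (rule signed_square_expansion[of "\<lambda>f. schur_fun (conj_par f)"]) (simp_all only: cz dual_pieri_conjugate)
    then have "P (psym 2) (esym_part lam) = (\<Sum>Q\<in>?T. ?s * (of_int (sign lam Q) * schur_fun (conj_par (level Q ?N))))"
      by (simp only: e(3) prod.distrib sum_distrib_left)
    then show ?thesis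
      by (simp add: sumC schur_shape_conjugate_level sign_c_conjugate mult.assoc)
  qed
  have cancel: "a = b" if "of_nat 2 * a = of_nat 2 * b" for a b :: mps
    using of_nat_mult_left_cancel_mps[OF _ that] by simp
  note hsplit = split_by_sign[where s = "sign lam" and F = "\<lambda>Q. schur (shape Q)",
      OF finite_tableaux_double sign_values]
  note esplit = split_by_sign[where s = "sign_c lam" and F = "\<lambda>Q. schur (shape Q)", OF finC sign_c_values]
  have "P (schur [2]) (hsym_part lam) = (\<Sum>Q\<in>{Q \<in> ?T. sign lam Q = 1}. schur (shape Q))"
    by (rule cancel) (simp only: plethysm_degree_two(1)[OF P h(1,2)] hsq hsigned hsplit(1))
  moreover have "P (schur [1, 1]) (hsym_part lam) = (\<Sum>Q\<in>{Q \<in> ?T. sign lam Q = -1}. schur (shape Q))"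
    by (rule cancel) (simp only: plethysm_degree_two(2)[OF P h(1,2)] hsq hsigned hsplit(2))
  moreover have "P (schur [2]) (esym_part lam) = (\<Sum>Q\<in>{Q \<in> ?C. sign_c lam Q = 1}. schur (shape Q))"
    by (rule cancel) (simp only: plethysm_degree_two(1)[OF P e(1,2)] esq esigned esplit(1))
  moreover have "P (schur [1, 1]) (esym_part lam) = (\<Sum>Q\<in>{Q \<in> ?C. sign_c lam Q = -1}. schur (shape Q))"
    by (rule cancel) (simp only: plethysm_degree_two(2)[OF P e(1,2)] esq esigned esplit(2))
  moreover have "\<forall>Q\<in>?T. \<forall>i<length lam. \<exists>j\<le>lam ! i. has_shape (Q_part Q i) (two_rows (lam ! i) j)"
    using pair_bracket_le has_shape_Q_part by blast
  moreover have "\<forall>Q\<in>?C. \<forall>i<length lam. \<exists>j\<le>lam ! i. has_shape (Qc_part Q i) (two_cols (lam ! i) j)"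
    unfolding conj_tableaux_eq using has_shape_Qc_part diff_le_self by blast
  ultimately show ?thesis
    using hsq esq by (intro conjI)
qed

end
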